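(* Let $\mathcal G = (\mathsf X \cup \mathsf Y \cup \mathsf U, \mathsf A \cup \mathsf B \cup \mathsf C)$ be a system graph with state nodes $\mathsf X=\{\mathsf x_1,\dots,\mathsf x_N\}$, output nodes $\mathsf Y=\{\mathsf y_1,\dots,\mathsf y_P\}$ and input nodes $\mathsf U=\{\mathsf u_1,\dots,\mathsf u_M\}$ ($\mathsf Y$ and $\mathsf U$ may be empty), and let $\mathfrak D(\mathcal G)$ be the class of all meromorphic pairs $\{f,h\}$ whose graph is $\mathcal G$. Then: (i) $\mathfrak D(\mathcal G)$ is structurally accessible if and only if each state node is the end-node of a directed path in $\mathcal G$ that starts at a node of $\mathsf U$. (ii) $\mathfrak D(\mathcal G)$ is structurally observable if and only if each state node is the start-node of a directed path in $\mathcal G$ that ends at a node of $\mathsf Y$.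
   Context: System graph: a directed graph $\mathcal G = (\mathsf X \cup \mathsf Y \cup \mathsf U, \mathsf A \cup \mathsf B \cup \mathsf C)$ where all edges in $\mathsf A$ are of the form $\mathsf x_j\to \mathsf x_i$ (self-loops allowed), all edges in $\mathsf B$ of the form $\mathsf u_j\to\mathsf x_i$, and all edges in $\mathsf C$ of the form $\mathsf x_j\to\mathsf y_i$. Meromorphic pair: $\{f,h\}$ with $f:\mathbb R^N\times\mathbb R^M\to\mathbb R^N$, $h:\mathbb R^N\to\mathbb R^P$ (possibly undefined where denominators vanish), each component being a quotient of real-analytic functions with denominator not identically zero. It represents the system $\dot x = f(x,u)$, $y=h(x)$. For meromorphic functions, "$\equiv 0$" means identically zero, "$\not\equiv0$" means not identically zero (equivalently, nonzero on an open dense subset). Graph of a pair: $\mathcal G_{f,h}$ has nodes $\mathsf X\cup\mathsf Y\cup\mathsf U$, with edge $\mathsf x_j\to\mathsf x_i$ iff $\partial f_i/\partial x_j\not\equiv 0$; edge $\mathsf u_j\to\mathsf x_i$ iff $\partial f_i/\partial u_j\not\equiv0$; edge $\mathsf x_j\to\mathsf y_i$ iff $\partial h_i/\partial x_j\not\equiv 0$. Define $\mathfrak D(\mathcal G)=\{\text{all meromorphic }\{f,h\}: \mathcal G_{f,h}=\mathcal G\}$. Let $\mathcal K$ be the field of meromorphic functions in (finitely many of) the variables $x,u,\dot u,\ddot u,\dots$. The time derivative along the system of $\varphi\in\mathcal K$ is $\dot\varphi=\frac{\partial\varphi}{\partial x}f(x,u)+\sum_{j\ge0}\frac{\partial\varphi}{\partial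 u^{(j)}}u^{(j+1)}$; iterating gives $\varphi^{(k)}$, and $y^{(k)}$ is the $k$-th derivative of $y=h(x)$, so its components belong to $\mathcal K$. Differentials $\mathrm d\varphi$ lie in the $\mathcal K$-vector space with basis the symbols $\mathrm dx_i$, $\mathrm du_i^{(j)}$. Autonomous element: a non-constant meromorphic function $\xi(x)$ such that $\partial\xi^{(k)}/\partial u\equiv0$ for all $k\ge0$. The system is accessible if it has no autonomous element. Hidden element: a non-constant meromorphic function $\zeta(x)$ such that for all $k\ge0$, $\mathrm d\zeta\notin\operatorname{span}_{\mathcal K}\{\mathrm dy,\mathrm d\dot y,\dots,\mathrm dy^{(k)}\}+\operatorname{span}_{\mathcal K}\{\mathrm du^{(j)}: j\ge 0\}$ (inputs are regarded as known). The system is observable if it has no hidden element. $\mathfrak D(\mathcal G)$ is structurally accessible (resp. structurally observable) if it contains at least one accessible (resp. observable) system. *)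

theory Defs
  imports
    "HOL-Complex_Analysis.Cauchy_Integral_Formula"
    "HOL-Computational_Algebra.Fraction_Field"
    "Graph_Theory.Pair_Digraph"
begin

section \<open>Real-analytic functions of finitely many variables\<close>

text \<open>
  Variables are drawn from an arbitrary type; a point is an assignment of reals to all variables.
  A function is real-analytic in the finite set \<open>S\<close> of variables if around every point it is the
  sum of a (multivariate) power series in the variables of \<open>S\<close>, converging unconditionally on
  a polydisc. Multi-indices are exponent functions vanishing outside \<open>S\<close>.  Since the polydisc only
  constrains the coordinates in \<open>S\<close>, such a function depends on the variables in \<open>S\<close> only.
\<close>

definition multi_indices :: "'v set \<Rightarrow> ('v \<Rightarrow> nat) set" where
  "multi_indices S = {\<alpha>. \<forall>v. v \<notin> S \<longrightarrow> \<alpha> v = 0}"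

definition analytic_in_vars :: "'v set \<Rightarrow> (('v \<Rightarrow> real) \<Rightarrow> real) \<Rightarrow> bool" where
  "analytic_in_vars S F \<longleftrightarrow> finite S \<and>
     (\<forall>a. \<exists>r>0. \<exists>c. \<forall>p. (\<forall>v\<in>S. \<bar>p v - a v\<bar> < r) \<longrightarrow>
        ((\<lambda>\<alpha>. c \<alpha> * (\<Prod>v\<in>S. (p v - a v) ^ \<alpha> v)) has_sum F p) (multi_indices S))"

definition real_analytic :: "(('v \<Rightarrow> real) \<Rightarrow> real) \<Rightarrow> bool" where
  "real_analytic F \<longleftrightarrow> (\<exists>S. analytic_in_vars S F)"

lemma analytic_in_vars_cong:
  assumes F: "analytic_in_vars S F" and pq: "\<And>v. v \<in> S \<Longrightarrow> p v = q v"
  shows "F p = F q"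
proof -
  obtain r c where r: "r > 0" and c: "\<forall>p'. (\<forall>v\<in>S. \<bar>p' v - p v\<bar> < r) \<longrightarrow>
        ((\<lambda>\<alpha>. c \<alpha> * (\<Prod>v\<in>S. (p' v - p v) ^ \<alpha> v)) has_sum F p') (multi_indices S)"
    using F unfolding analytic_in_vars_def by blast
  have 1: "((\<lambda>\<alpha>. c \<alpha> * (\<Prod>v\<in>S. (p v - p v) ^ \<alpha> v)) has_sum F p) (multi_indices S)"
    using r by (intro c[THEN spec, THEN mp]) simp
  have 2: "((\<lambda>\<alpha>. c \<alpha> * (\<Prod>v\<in>S. (q v - p v) ^ \<alpha> v)) has_sum F q) (multi_indices S)"
    using r pq by (intro c[THEN spec, THEN mp]) simp
  have "(\<lambda>\<alpha>. c \<alpha> * (\<Prod>v\<in>S. (q v - p v) ^ \<alpha> v)) = (\<lambda>\<alpha>. c \<alpha> * (\<Prod>v\<in>S. (p v - p v) ^ \<alpha> v))"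
    using pq by simp
  then show ?thesis using has_sum_unique[OF 1] 2 by simp
qed

lemma analytic_in_vars_mono:
  assumes F: "analytic_in_vars S F" and S: "S \<subseteq> S'" "finite S'"
  shows "analytic_in_vars S' F"
  unfolding analytic_in_vars_def
proof (intro conjI allI S(2))
  fix a
  obtain r c where r: "r > 0" and c: "\<And>p. (\<forall>v\<in>S. \<bar>p v - a v\<bar> < r) \<Longrightarrow>
        ((\<lambda>\<alpha>. c \<alpha> * (\<Prod>v\<in>S. (p v - a v) ^ \<alpha> v)) has_sum F p) (multi_indices S)"
    using F unfolding analytic_in_vars_def by blast
  have "((\<lambda>\<alpha>. (if \<alpha> \<in> multi_indices S then c \<alpha> else 0) * (\<Prod>v\<in>S'. (p v - a v) ^ \<alpha> v)) has_sum F p)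
          (multi_indices S')" if p: "\<forall>v\<in>S'. \<bar>p v - a v\<bar> < r" for p
  proof -
    have prod_eq: "(\<Prod>v\<in>S'. (p v - a v) ^ \<alpha> v) = (\<Prod>v\<in>S. (p v - a v) ^ \<alpha> v)"
      if "\<alpha> \<in> multi_indices S" for \<alpha>
      using that S by (intro prod.mono_neutral_right) (auto simp: multi_indices_def)
    have "((\<lambda>\<alpha>. c \<alpha> * (\<Prod>v\<in>S. (p v - a v) ^ \<alpha> v)) has_sum F p) (multi_indices S)"
      using c p S by blast
    also have "?this \<longleftrightarrow> ?thesis"
      using S by (intro has_sum_cong_neutral) (auto simp: prod_eq, auto simp: multi_indices_def)
    finally show ?thesis .
  qed
  with r show "\<exists>r>0. \<exists>c. \<forall>p. (\<forall>v\<in>S'. \<bar>p v - a v\<bar> < r) \<longrightarrow>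
        ((\<lambda>\<alpha>. c \<alpha> * (\<Prod>v\<in>S'. (p v - a v) ^ \<alpha> v)) has_sum F p) (multi_indices S')"
    by (intro exI[of _ r] conjI exI[of _ "\<lambda>\<alpha>. if \<alpha> \<in> multi_indices S then c \<alpha> else 0"] allI impI)
qed

lemma analytic_in_vars_const: "analytic_in_vars {} (\<lambda>_ :: 'v \<Rightarrow> real. k)"
proof -
  have "((\<lambda>\<alpha>. k) has_sum k) (multi_indices {} :: ('v \<Rightarrow> nat) set)"
    using has_sum_finiteI[of "{\<lambda>_. 0} :: ('v \<Rightarrow> nat) set" k "\<lambda>_. k"]
    by (simp add: multi_indices_def flip: fun_eq_iff)
  then show ?thesis
    unfolding analytic_in_vars_def
    by (intro conjI allI exI[of _ "1::real"] exI[of _ "\<lambda>_. k"]) simp_all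
qed

lemma analytic_in_vars_coord: "analytic_in_vars {v} (\<lambda>p. p v)"
  unfolding analytic_in_vars_def
proof (intro conjI allI)
  fix a :: "'a \<Rightarrow> real"
  define z e :: "'a \<Rightarrow> nat" where "z = (\<lambda>_. 0)" and "e = (\<lambda>_. 0)(v := 1)"
  have ze: "z \<noteq> e" unfolding z_def e_def by (metis fun_upd_same zero_neq_one)
  define c where "c = (\<lambda>\<alpha>. if \<alpha> = z then a v else if \<alpha> = e then 1 else 0)"
  have "((\<lambda>\<alpha>. c \<alpha> * (\<Prod>v\<in>{v}. (p v - a v) ^ \<alpha> v)) has_sum p v) (multi_indices {v})" for p
    by (rule has_sum_finite_neutralI[of "{z, e}"])
       (use ze in \<open>auto simp: c_def multi_indices_def\<close>, auto simp: z_def e_def)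
  then show "\<exists>r>0. \<exists>c. \<forall>p. (\<forall>v\<in>{v}. \<bar>p v - a v\<bar> < r) \<longrightarrow>
        ((\<lambda>\<alpha>. c \<alpha> * (\<Prod>v\<in>{v}. (p v - a v) ^ \<alpha> v)) has_sum p v) (multi_indices {v})"
    by (intro exI[of _ "1::real"]) auto
qed auto

lemma analytic_in_vars_add:
  assumes "analytic_in_vars S F" "analytic_in_vars S G"
  shows "analytic_in_vars S (\<lambda>p. F p + G p)"
  unfolding analytic_in_vars_def
proof (intro conjI allI)
  show "finite S" using assms by (auto simp: analytic_in_vars_def)
  fix a
  obtain r c where r: "r > 0" and c: "\<And>p. (\<forall>v\<in>S. \<bar>p v - a v\<bar> < r) \<Longrightarrow>
        ((\<lambda>\<alpha>. c \<alpha> * (\<Prod>v\<in>S. (p v - a v) ^ \<alpha> v)) has_sum F p) (multi_indices S)"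
    using assms(1) unfolding analytic_in_vars_def by blast
  obtain r' c' where r': "r' > 0" and c': "\<And>p. (\<forall>v\<in>S. \<bar>p v - a v\<bar> < r') \<Longrightarrow>
        ((\<lambda>\<alpha>. c' \<alpha> * (\<Prod>v\<in>S. (p v - a v) ^ \<alpha> v)) has_sum G p) (multi_indices S)"
    using assms(2) unfolding analytic_in_vars_def by blast
  have "((\<lambda>\<alpha>. (c \<alpha> + c' \<alpha>) * (\<Prod>v\<in>S. (p v - a v) ^ \<alpha> v)) has_sum (F p + G p)) (multi_indices S)"
    if "\<forall>v\<in>S. \<bar>p v - a v\<bar> < min r r'" for p
    unfolding distrib_right using that by (intro has_sum_add c c') auto
  with r r' show "\<exists>r>0. \<exists>c. \<forall>p. (\<forall>v\<in>S. \<bar>p v - a v\<bar> < r) \<longrightarrow>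
        ((\<lambda>\<alpha>. c \<alpha> * (\<Prod>v\<in>S. (p v - a v) ^ \<alpha> v)) has_sum (F p + G p)) (multi_indices S)"
    by (intro exI[of _ "min r r'"] conjI exI[of _ "\<lambda>\<alpha>. c \<alpha> + c' \<alpha>"] allI impI) simp_all
qed

lemma finite_multi_indices_le:
  assumes "finite S"
  shows "finite {\<alpha> \<in> multi_indices S. \<forall>v. \<alpha> v \<le> \<gamma> v}"
proof -
  have "finite {\<alpha>. \<forall>v. (v \<in> S \<longrightarrow> \<alpha> v \<in> {..sum \<gamma> S}) \<and> (v \<notin> S \<longrightarrow> \<alpha> v = (0::nat))}"
    by (rule finite_set_of_finite_funs) (use assms in auto)
  then show ?thesis
    by (rule rev_finite_subset)
       (use assms in \<open>auto simp: multi_indices_def intro: order_trans[OF _ member_le_sum]\<close>)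
qed

lemma has_sum_times_real:
  fixes f :: "'a \<Rightarrow> real" and g :: "'b \<Rightarrow> real"
  assumes "(f has_sum a) A" "(g has_sum b) B"
  shows "((\<lambda>(x, y). f x * g y) has_sum (a * b)) (A \<times> B)"
proof (rule has_sum_SigmaI)
  show "((\<lambda>y. case (x, y) of (x, y) \<Rightarrow> f x * g y) has_sum f x * b) B" for x
    using assms(2) by (auto intro: has_sum_cmult_right)
  show "((\<lambda>x. f x * b) has_sum a * b) A"
    using assms(1) by (rule has_sum_cmult_left)
  have f: "(\<lambda>x. norm (f x)) summable_on A" and g: "(\<lambda>x. norm (g x)) summable_on B"
    using assms summable_on_iff_abs_summable_on_real has_sum_imp_summable by blast+
  have "(\<lambda>z. norm (case z of (x, y) \<Rightarrow> f x * g y)) summable_on A \<times> B"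
  proof (rule summable_on_SigmaI)
    show "((\<lambda>y. norm (case (x, y) of (x, y) \<Rightarrow> f x * g y)) has_sum
              (norm (f x) * infsum (\<lambda>y. norm (g y)) B)) B" for x
      using g by (auto simp: abs_mult intro!: has_sum_cmult_right)
    show "(\<lambda>x. norm (f x) * infsum (\<lambda>y. norm (g y)) B) summable_on A"
      using f by (rule summable_on_cmult_left)
  qed auto
  then show "(\<lambda>(x, y). f x * g y) summable_on A \<times> B"
    by (rule abs_summable_summable)
qed

lemma analytic_in_vars_mult:
  assumes "analytic_in_vars S F" "analytic_in_vars S G"
  shows "analytic_in_vars S (\<lambda>p. F p * G p)"
  unfolding analytic_in_vars_def
proof (intro conjI allI)
  show fin: "finite S" using assms by (auto simp: analytic_in_vars_def)
  fix a
  obtain r c where r: "r > 0" and c: "\<And>p. (\<forall>v\<in>S. \<bar>p v - a v\<bar> < r) \<Longrightarrow>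
        ((\<lambda>\<alpha>. c \<alpha> * (\<Prod>v\<in>S. (p v - a v) ^ \<alpha> v)) has_sum F p) (multi_indices S)"
    using assms(1) unfolding analytic_in_vars_def by blast
  obtain r' c' where r': "r' > 0" and c': "\<And>p. (\<forall>v\<in>S. \<bar>p v - a v\<bar> < r') \<Longrightarrow>
        ((\<lambda>\<alpha>. c' \<alpha> * (\<Prod>v\<in>S. (p v - a v) ^ \<alpha> v)) has_sum G p) (multi_indices S)"
    using assms(2) unfolding analytic_in_vars_def by blast
  let ?I = "multi_indices S"
  let ?L = "\<lambda>\<gamma>. {\<alpha> \<in> ?I. \<forall>v. \<alpha> v \<le> \<gamma> v}"
  define d where "d = (\<lambda>\<gamma>. \<Sum>\<alpha>\<in>?L \<gamma>. c \<alpha> * c' (\<lambda>v. \<gamma> v - \<alpha> v))"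
  have "((\<lambda>\<gamma>. d \<gamma> * (\<Prod>v\<in>S. (p v - a v) ^ \<gamma> v)) has_sum (F p * G p)) ?I"
    if "\<forall>v\<in>S. \<bar>p v - a v\<bar> < min r r'" for p
  proof -
    define m where "m = (\<lambda>\<alpha>. \<Prod>v\<in>S. (p v - a v) ^ \<alpha> v)"
    have "((\<lambda>(\<alpha>, \<beta>). (c \<alpha> * m \<alpha>) * (c' \<beta> * m \<beta>)) has_sum (F p * G p)) (?I \<times> ?I)"
      unfolding m_def using that by (intro has_sum_times_real c c') auto
    also have "?this \<longleftrightarrow>
       ((\<lambda>(\<gamma>, \<alpha>). (c \<alpha> * c' (\<lambda>v. \<gamma> v - \<alpha> v)) * m \<gamma>) has_sum (F p * G p)) (Sigma ?I ?L)"
    proof (rule has_sum_reindex_bij_witness[where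
            j = "\<lambda>(\<alpha>, \<beta>). (\<lambda>v. \<alpha> v + \<beta> v, \<alpha>)" and i = "\<lambda>(\<gamma>, \<alpha>). (\<alpha>, \<lambda>v. \<gamma> v - \<alpha> v)"])
      show "(case (case z of (\<alpha>, \<beta>) \<Rightarrow> (\<lambda>v. \<alpha> v + \<beta> v, \<alpha>)) of
              (\<gamma>, \<alpha>) \<Rightarrow> c \<alpha> * c' (\<lambda>v. \<gamma> v - \<alpha> v) * m \<gamma>)
           = (case z of (\<alpha>, \<beta>) \<Rightarrow> (c \<alpha> * m \<alpha>) * (c' \<beta> * m \<beta>))" for z
        by (cases z) (simp add: m_def power_add prod.distrib)
    qed (auto simp: multi_indices_def)
    finally have "((\<lambda>\<gamma>. d \<gamma> * m \<gamma>) has_sum (F p * G p)) ?I"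
    proof (rule has_sum_SigmaD)
      fix \<gamma> assume "\<gamma> \<in> ?I"
      show "((\<lambda>\<alpha>. case (\<gamma>, \<alpha>) of (\<gamma>, \<alpha>) \<Rightarrow> c \<alpha> * c' (\<lambda>v. \<gamma> v - \<alpha> v) * m \<gamma>) has_sum d \<gamma> * m \<gamma>) (?L \<gamma>)"
        unfolding d_def by (rule has_sum_finiteI)
          (use fin in \<open>auto simp: sum_distrib_right intro: finite_multi_indices_le\<close>)
    qed
    then show ?thesis by (simp add: m_def)
  qed
  with r r' show "\<exists>r>0. \<exists>c. \<forall>p. (\<forall>v\<in>S. \<bar>p v - a v\<bar> < r) \<longrightarrow>
        ((\<lambda>\<alpha>. c \<alpha> * (\<Prod>v\<in>S. (p v - a v) ^ \<alpha> v)) has_sum (F p * G p)) (multi_indices S)"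
    by (intro exI[of _ "min r r'"] conjI exI[of _ d] allI impI) simp_all
qed

lemma analytic_in_vars_line:
  assumes F: "analytic_in_vars S F"
  obtains \<delta> C where "\<delta> > 0" "\<And>t. \<bar>t\<bar> < \<delta> \<Longrightarrow> (\<lambda>n. C n * t ^ n) sums F (\<lambda>v. a v + t * w v)"
proof -
  have fin: "finite S" using F by (auto simp: analytic_in_vars_def)
  obtain r c where r: "r > 0" and c: "\<And>p. (\<forall>v\<in>S. \<bar>p v - a v\<bar> < r) \<Longrightarrow>
        ((\<lambda>\<alpha>. c \<alpha> * (\<Prod>v\<in>S. (p v - a v) ^ \<alpha> v)) has_sum F p) (multi_indices S)"
    using F unfolding analytic_in_vars_def by blast
  define B where "B = 1 + (\<Sum>v\<in>S. \<bar>w v\<bar>)"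
  have B: "B > 0" and wB: "\<And>v. v \<in> S \<Longrightarrow> \<bar>w v\<bar> < B"
  proof -
    have "(\<Sum>v\<in>S. \<bar>w v\<bar>) \<ge> 0" by (rule sum_nonneg) auto
    then show "B > 0" unfolding B_def by linarith
    fix v assume "v \<in> S"
    then have "\<bar>w v\<bar> \<le> (\<Sum>v\<in>S. \<bar>w v\<bar>)" using fin by (intro member_le_sum) auto
    then show "\<bar>w v\<bar> < B" unfolding B_def by linarith
  qed
  let ?I = "multi_indices S"
  let ?L = "\<lambda>n. {\<alpha> \<in> ?I. sum \<alpha> S = n}"
  have finL: "finite (?L n)" for n
  proof (rule finite_subset[OF _ finite_multi_indices_le[OF fin, of "\<lambda>_. n"]], safe)
    fix \<alpha> v assume \<alpha>: "\<alpha> \<in> ?I"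
    then show "\<alpha> v \<le> sum \<alpha> S"
      using fin by (cases "v \<in> S") (auto intro: member_le_sum simp: multi_indices_def)
  qed
  define C where "C = (\<lambda>n. \<Sum>\<alpha>\<in>?L n. c \<alpha> * (\<Prod>v\<in>S. w v ^ \<alpha> v))"
  show thesis
  proof (rule that[of "r / B" C])
    show "r / B > 0" using r B by simp
    fix t :: real assume t: "\<bar>t\<bar> < r / B"
    have "\<bar>t\<bar> * \<bar>w v\<bar> < r" if "v \<in> S" for v
    proof -
      have "\<bar>t\<bar> * \<bar>w v\<bar> \<le> \<bar>t\<bar> * B" using wB[OF that] by (intro mult_left_mono) auto
      also have "\<dots> < r" using t B by (simp add: field_simps)
      finally show ?thesis .
    qed
    then have "((\<lambda>\<alpha>. c \<alpha> * (\<Prod>v\<in>S. (a v + t * w v - a v) ^ \<alpha> v)) has_sum F (\<lambda>v. a v + t * w v)) ?I"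
      by (intro c) (auto simp: abs_mult)
    also have "?this \<longleftrightarrow> ((\<lambda>(n, \<alpha>). c \<alpha> * (\<Prod>v\<in>S. w v ^ \<alpha> v) * t ^ n) has_sum
                F (\<lambda>v. a v + t * w v)) (Sigma UNIV ?L)"
      by (rule has_sum_reindex_bij_witness[where j = "\<lambda>\<alpha>. (sum \<alpha> S, \<alpha>)" and i = snd])
         (auto simp: power_mult_distrib prod.distrib power_sum)
    finally have "((\<lambda>n. C n * t ^ n) has_sum F (\<lambda>v. a v + t * w v)) UNIV"
    proof (rule has_sum_SigmaD)
      fix n
      show "((\<lambda>\<alpha>. case (n, \<alpha>) of (n, \<alpha>) \<Rightarrow> c \<alpha> * (\<Prod>v\<in>S. w v ^ \<alpha> v) * t ^ n) has_sum C n * t ^ n) (?L n)"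
        unfolding C_def by (rule has_sum_finiteI) (use finL in \<open>auto simp: sum_distrib_right\<close>)
    qed
    then show "(\<lambda>n. C n * t ^ n) sums F (\<lambda>v. a v + t * w v)"
      by (rule has_sum_imp_sums)
  qed
qed

lemma real_analytic_line_dichotomy:
  assumes f: "\<delta> > 0" "\<And>t. \<bar>t\<bar> < \<delta> \<Longrightarrow> (\<lambda>n. C n * t ^ n) sums (f t :: real)"
  obtains s where "s > 0" "\<And>t. \<bar>t\<bar> < s \<Longrightarrow> f t = 0"
  | s where "s > 0" "\<And>t. \<bar>t\<bar> < s \<Longrightarrow> t \<noteq> 0 \<Longrightarrow> f t \<noteq> 0"
proof (cases "\<forall>n. C n = 0")
  case True
  have "f t = 0" if "\<bar>t\<bar> < \<delta>" for t
    using f(2)[OF that] True by (simp add: sums_unique2)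
  then show ?thesis using f(1) that(1) by blast
next
  case False
  then obtain m where m: "C m \<noteq> 0" by blast
  show ?thesis
  proof (cases "f 0 = 0")
    case True
    have "C 0 = 0" using f(2)[of 0] f(1) True by simp
    with m have "m > 0" by (cases m) auto
    obtain s where s: "0 < s" "\<And>z. z \<in> cball 0 s - {0} \<Longrightarrow> f z \<noteq> 0"
      by (rule powser_0_nonzero[of \<delta> 0 C f m]) (use f True m \<open>m > 0\<close> in auto)
    show ?thesis by (rule that(2)[OF s(1)]) (use s(2) in auto)
  next
    case False
    define K where "K = \<delta> / 2"
    have "summable (\<lambda>n. C n * K ^ n)"
      using f(2)[of K] f(1) by (auto simp: K_def sums_iff)
    then have "isCont (\<lambda>x. \<Sum>n. C n * x ^ n) 0"
      by (rule isCont_powser) (use f(1) in \<open>auto simp: K_def\<close>)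
    moreover have ev: "eventually (\<lambda>x. x \<in> {-\<delta><..<\<delta>}) (nhds 0)"
      using f(1) by (intro eventually_nhds_in_open) auto
    have "eventually (\<lambda>x. (\<Sum>n. C n * x ^ n) = f x) (nhds 0)"
      by (rule eventually_mono[OF ev]) (metis f(2) sums_unique abs_less_iff greaterThanLessThan_iff minus_less_iff)
    ultimately have "isCont f 0"
      by (simp add: isCont_cong)
    then have "eventually (\<lambda>x. f x \<noteq> 0) (at 0)"
      using False unfolding isCont_def by (rule tendsto_imp_eventually_ne)
    then obtain s where "s > 0" "\<And>t. t \<noteq> 0 \<Longrightarrow> dist t 0 < s \<Longrightarrow> f t \<noteq> 0"
      unfolding eventually_at by blast
    then show ?thesis by (intro that(2)) auto
  qed
qed

lemma analytic_in_vars_line_punctured: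
  assumes F: "analytic_in_vars S F" and nz: "F (\<lambda>v. a v + t0 * w v) \<noteq> 0"
  shows "\<exists>s>0. \<forall>t'. \<bar>t' - t\<bar> < s \<longrightarrow> t' \<noteq> t \<longrightarrow> F (\<lambda>v. a v + t' * w v) \<noteq> 0"
proof -
  define f where "f = (\<lambda>t. F (\<lambda>v. a v + t * w v))"
  have dich: "(\<exists>s>0. \<forall>t'. \<bar>t' - t\<bar> < s \<longrightarrow> f t' = 0) \<or>
              (\<exists>s>0. \<forall>t'. \<bar>t' - t\<bar> < s \<longrightarrow> t' \<noteq> t \<longrightarrow> f t' \<noteq> 0)" for t
  proof -
    obtain \<delta> C where \<delta>: "\<delta> > 0"
      "\<And>u. \<bar>u\<bar> < \<delta> \<Longrightarrow> (\<lambda>n. C n * u ^ n) sums F (\<lambda>v. (a v + t * w v) + u * w v)"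
      using analytic_in_vars_line[OF F, of "\<lambda>v. a v + t * w v" w] by metis
    have eq: "F (\<lambda>v. (a v + t * w v) + u * w v) = f (t + u)" for u
      by (simp add: f_def algebra_simps)
    show ?thesis
    proof (rule real_analytic_line_dichotomy[of \<delta> C "\<lambda>u. f (t + u)"])
      fix s :: real assume s: "s > 0" "\<And>u. \<bar>u\<bar> < s \<Longrightarrow> f (t + u) = 0"
      have "f t' = 0" if "\<bar>t' - t\<bar> < s" for t' using s(2)[of "t' - t"] that by simp
      with s(1) show ?thesis by blast
    next
      fix s :: real assume s: "s > 0" "\<And>u. \<bar>u\<bar> < s \<Longrightarrow> u \<noteq> 0 \<Longrightarrow> f (t + u) \<noteq> 0"
      have "f t' \<noteq> 0" if "\<bar>t' - t\<bar> < s" "t' \<noteq> t" for t' using s(2)[of "t' - t"] that by simp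
      with s(1) show ?thesis by blast
    qed (use \<delta> eq in auto)
  qed
  define Z where "Z = {t. \<exists>s>0. \<forall>t'. \<bar>t' - t\<bar> < s \<longrightarrow> f t' = 0}"
  define W where "W = {t. \<exists>s>0. \<forall>t'. \<bar>t' - t\<bar> < s \<longrightarrow> t' \<noteq> t \<longrightarrow> f t' \<noteq> 0}"
  have "open Z"
    unfolding open_dist
  proof
    fix t assume "t \<in> Z"
    then obtain s where s: "s > 0" "\<And>t'. \<bar>t' - t\<bar> < s \<Longrightarrow> f t' = 0" by (auto simp: Z_def)
    have "y \<in> Z" if y: "dist y t < s" for y
    proof -
      have "f t' = 0" if "\<bar>t' - y\<bar> < s - dist y t" for t'
        using that by (intro s(2)) (auto simp: dist_real_def)
      with y show ?thesis unfolding Z_def by (intro CollectI exI[of _ "s - dist y t"]) auto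
    qed
    with s(1) show "\<exists>e>0. \<forall>y. dist y t < e \<longrightarrow> y \<in> Z" by blast
  qed
  moreover have "open W"
    unfolding open_dist
  proof
    fix t assume "t \<in> W"
    then obtain s where s: "s > 0" "\<And>t'. \<bar>t' - t\<bar> < s \<Longrightarrow> t' \<noteq> t \<Longrightarrow> f t' \<noteq> 0" by (auto simp: W_def)
    have "y \<in> W" if y: "dist y t < s" for y
    proof (cases "y = t")
      case True
      then show ?thesis using s unfolding W_def by blast
    next
      case False
      have "f t' \<noteq> 0" if "\<bar>t' - y\<bar> < min (s - dist y t) (dist y t)" for t'
        using that by (intro s(2)) (auto simp: dist_real_def)
      with y False show ?thesis
        unfolding W_def by (intro CollectI exI[of _ "min (s - dist y t) (dist y t)"]) auto
    qed
    with s(1) show "\<exists>e>0. \<forall>y. dist y t < e \<longrightarrow> y \<in> W" by blast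
  qed
  moreover have "UNIV \<subseteq> Z \<union> W" using dich by (auto simp: Z_def W_def)
  moreover have "Z \<inter> W \<inter> UNIV = {}"
  proof (rule ccontr)
    assume "Z \<inter> W \<inter> UNIV \<noteq> {}"
    then obtain t s s' where "s > 0" "s' > 0" "\<And>t'. \<bar>t' - t\<bar> < s \<Longrightarrow> f t' = 0"
      "\<And>t'. \<bar>t' - t\<bar> < s' \<Longrightarrow> t' \<noteq> t \<Longrightarrow> f t' \<noteq> 0"
      unfolding Z_def W_def by blast
    note * = this
    from *(1,2) obtain u where "0 < u" "u < s" "u < s'" using dense[of 0 "min s s'"] by auto
    then show False using *(3,4)[of "t + u"] by simp
  qed
  ultimately have "Z \<inter> UNIV = {} \<or> W \<inter> UNIV = {}"
    using connected_UNIV unfolding connected_def by blast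
  moreover have "t0 \<notin> Z"
    using nz unfolding Z_def f_def by (auto intro: exI[of _ t0])
  ultimately have "t \<in> W" using \<open>UNIV \<subseteq> Z \<union> W\<close> by blast
  then show ?thesis by (auto simp: W_def f_def)
qed

lemma analytic_in_vars_no_zero_divisors:
  assumes F: "analytic_in_vars S F" and G: "analytic_in_vars S' G"
    and p: "F p \<noteq> 0" and q: "G q \<noteq> 0"
  shows "\<exists>z. F z * G z \<noteq> 0"
proof -
  define w where "w = (\<lambda>v. q v - p v)"
  have "F (\<lambda>v. p v + 0 * w v) \<noteq> 0" "G (\<lambda>v. p v + 1 * w v) \<noteq> 0"
    using p q by (simp_all add: w_def)
  then obtain s s' where "s > 0" "\<forall>t'. \<bar>t' - 0\<bar> < s \<longrightarrow> t' \<noteq> 0 \<longrightarrow> F (\<lambda>v. p v + t' * w v) \<noteq> 0"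
    "s' > 0" "\<forall>t'. \<bar>t' - 0\<bar> < s' \<longrightarrow> t' \<noteq> 0 \<longrightarrow> G (\<lambda>v. p v + t' * w v) \<noteq> 0"
    using analytic_in_vars_line_punctured[OF F, of p 0 w 0]
      analytic_in_vars_line_punctured[OF G, of p 1 w 0] by blast
  note * = this
  from *(1,3) obtain u where u: "0 < u" "u < s" "u < s'" using dense[of 0 "min s s'"] by auto
  then have "F (\<lambda>v. p v + u * w v) * G (\<lambda>v. p v + u * w v) \<noteq> 0"
    using *(2,4) by simp
  then show ?thesis by blast
qed

text \<open>Partial derivatives, by termwise differentiation of the power series.\<close>

lemma analytic_in_vars_partial_aux:
  assumes F: "analytic_in_vars S F" and v: "v \<in> S"
  obtains r c where "r > 0"
    "\<And>p. (\<forall>u\<in>S. \<bar>p u - a u\<bar> < r) \<Longrightarrow> \<exists>D. ((\<lambda>t. F (p(v := t))) has_real_derivative D) (at (p v)) \<and>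
       ((\<lambda>\<alpha>. c \<alpha> * (\<Prod>u\<in>S. (p u - a u) ^ \<alpha> u)) has_sum D) (multi_indices S)"
proof -
  have fin: "finite S" using F by (auto simp: analytic_in_vars_def)
  obtain r c where r: "r > 0" and c: "\<And>p. (\<forall>v\<in>S. \<bar>p v - a v\<bar> < r) \<Longrightarrow>
        ((\<lambda>\<alpha>. c \<alpha> * (\<Prod>v\<in>S. (p v - a v) ^ \<alpha> v)) has_sum F p) (multi_indices S)"
    using F unfolding analytic_in_vars_def by blast
  let ?I = "multi_indices S"
  define J where "J = {\<beta> \<in> ?I. \<beta> v = 0}"
  define c' where "c' = (\<lambda>\<alpha>. real (Suc (\<alpha> v)) * c (\<alpha>(v := Suc (\<alpha> v))))"
  have regroup: "(g has_sum T) ?I \<longleftrightarrow> ((\<lambda>(n, \<beta>). g (\<beta>(v := n))) has_sum T) (UNIV \<times> J)"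
    for g :: "_ \<Rightarrow> real" and T
    by (rule has_sum_reindex_bij_witness[where j = "\<lambda>\<alpha>. (\<alpha> v, \<alpha>(v := 0))" and i = "\<lambda>(n, \<beta>). \<beta>(v := n)"])
       (use v in \<open>auto simp: multi_indices_def J_def\<close>)
  show thesis
  proof (rule that[OF r, of c'])
    fix p assume p: "\<forall>u\<in>S. \<bar>p u - a u\<bar> < r"
    define s where "s = p v - a v"
    obtain \<rho> where \<rho>: "\<bar>s\<bar> < \<rho>" "\<rho> < r" using p v dense unfolding s_def by blast
    define m where "m = (\<lambda>\<alpha>. \<Prod>u\<in>S - {v}. (p u - a u) ^ \<alpha> u)"
    have m_upd: "m (\<alpha>(v := n)) = m \<alpha>" for \<alpha> n
      unfolding m_def by (intro prod.cong) auto
    have prod_split: "(\<Prod>u\<in>S. ((p(v := a v + t)) u - a u) ^ \<alpha> u) = m \<alpha> * t ^ \<alpha> v" for t \<alpha>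
      unfolding m_def using fin v by (subst prod.remove[of S v]) (auto intro!: prod.cong)
    have prod_split': "(\<Prod>u\<in>S. (p u - a u) ^ \<alpha> u) = m \<alpha> * s ^ \<alpha> v" for \<alpha>
      using prod_split[of s \<alpha>] by (simp add: s_def)
    have hs: "((\<lambda>\<alpha>. c \<alpha> * (m \<alpha> * t ^ \<alpha> v)) has_sum F (p(v := a v + t))) ?I" if "\<bar>t\<bar> < r" for t
      using c[of "p(v := a v + t)"] p that unfolding prod_split by auto
    have hs2: "((\<lambda>(n, \<beta>). c (\<beta>(v := n)) * m \<beta> * t ^ n) has_sum F (p(v := a v + t))) (UNIV \<times> J)"
      if "\<bar>t\<bar> < r" for t
      using hs[OF that] by (subst (asm) regroup) (simp add: m_upd mult.assoc)
    have \<rho>r: "\<bar>\<rho>\<bar> < r" "\<rho> > 0" using \<rho> by auto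
    define C where "C = (\<lambda>n. infsum (\<lambda>\<beta>. c (\<beta>(v := n)) * m \<beta>) J)"
    have C: "((\<lambda>\<beta>. c (\<beta>(v := n)) * m \<beta>) has_sum C n) J" for n
    proof -
      have "(\<lambda>(n, \<beta>). c (\<beta>(v := n)) * m \<beta> * \<rho> ^ n) summable_on (UNIV \<times> J)"
        using hs2[OF \<rho>r(1)] has_sum_imp_summable by blast
      then have "(\<lambda>\<beta>. c (\<beta>(v := n)) * m \<beta> * \<rho> ^ n) summable_on J"
        by (rule summable_on_SigmaD1) auto
      then have "(\<lambda>\<beta>. c (\<beta>(v := n)) * m \<beta> * \<rho> ^ n * inverse (\<rho> ^ n)) summable_on J"
        by (rule summable_on_cmult_left)
      then have "(\<lambda>\<beta>. c (\<beta>(v := n)) * m \<beta>) summable_on J"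
        using \<rho>r by (simp add: mult.assoc)
      then show ?thesis unfolding C_def by simp
    qed
    have sums: "(\<lambda>n. C n * t ^ n) sums F (p(v := a v + t))" if "\<bar>t\<bar> < r" for t
    proof (rule has_sum_imp_sums, rule has_sum_SigmaD[OF hs2[OF that]])
      fix n :: nat
      show "((\<lambda>\<beta>. case (n, \<beta>) of (n, \<beta>) \<Rightarrow> c (\<beta>(v := n)) * m \<beta> * t ^ n) has_sum C n * t ^ n) J"
        using has_sum_cmult_left[OF C] by simp
    qed
    define D where "D = (\<Sum>n. diffs C n * s ^ n)"
    have "((\<lambda>t. \<Sum>n. C n * t ^ n) has_real_derivative D) (at s)"
      unfolding D_def using sums[OF \<rho>r(1)] \<rho> by (intro termdiffs_strong[of _ \<rho>]) (auto simp: sums_iff)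
    then have "((\<lambda>t. F (p(v := a v + t))) has_real_derivative D) (at s)"
    proof (rule has_field_derivative_transform_within_open[where S = "{-r<..<r}"])
      show "(\<Sum>n. C n * t ^ n) = F (p(v := a v + t))" if "t \<in> {-r<..<r}" for t
        using sums[of t] that by (auto simp: sums_iff)
    qed (use \<rho> in auto)
    then have "((\<lambda>t. F (p(v := a v + t))) has_real_derivative D) (at (p v + - a v))"
      by (simp add: s_def)
    then have deriv: "((\<lambda>t. F (p(v := t))) has_real_derivative D) (at (p v))"
      by (subst (asm) DERIV_shift) simp
    have "(\<lambda>\<alpha>. c' \<alpha> * (m \<alpha> * s ^ \<alpha> v)) summable_on ?I"
    proof -
      have "(\<lambda>\<alpha>. c \<alpha> * (m \<alpha> * \<rho> ^ \<alpha> v)) summable_on ?I"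
        using hs[OF \<rho>r(1)] has_sum_imp_summable by blast
      then have "(\<lambda>\<alpha>. c \<alpha> * (m \<alpha> * \<rho> ^ \<alpha> v)) summable_on ((\<lambda>\<alpha>. \<alpha>(v := Suc (\<alpha> v))) ` ?I)"
        by (rule summable_on_subset) (use v in \<open>auto simp: multi_indices_def\<close>)
      moreover have "inj_on (\<lambda>\<alpha>. \<alpha>(v := Suc (\<alpha> v))) ?I"
      proof (rule inj_onI, rule ext)
        fix \<alpha> \<beta> :: "'a \<Rightarrow> nat" and u
        assume "\<alpha>(v := Suc (\<alpha> v)) = \<beta>(v := Suc (\<beta> v))"
        then show "\<alpha> u = \<beta> u" by (cases "u = v") (metis fun_upd_same Suc_inject, metis fun_upd_other)
      qed
      ultimately have "(\<lambda>\<alpha>. c (\<alpha>(v := Suc (\<alpha> v))) * (m \<alpha> * \<rho> ^ Suc (\<alpha> v))) summable_on ?I"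
        by (subst (asm) summable_on_reindex) (auto simp: o_def m_upd)
      then have sm: "(\<lambda>\<alpha>. \<bar>c (\<alpha>(v := Suc (\<alpha> v))) * (m \<alpha> * \<rho> ^ Suc (\<alpha> v))\<bar>) summable_on ?I"
        by (subst (asm) summable_on_iff_abs_summable_on_real) simp
      have "(\<lambda>n. of_nat n * (\<bar>s\<bar> / \<rho>) ^ n) \<longlonglongrightarrow> 0" "(\<lambda>n. (\<bar>s\<bar> / \<rho>) ^ n) \<longlonglongrightarrow> 0"
        using \<rho> \<rho>r by (auto intro!: powser_times_n_limit_0 LIMSEQ_power_zero)
      from tendsto_add[OF this] have "convergent (\<lambda>n. of_nat n * (\<bar>s\<bar> / \<rho>) ^ n + (\<bar>s\<bar> / \<rho>) ^ n)"
        by (auto simp: convergent_def)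
      then have "Bseq (\<lambda>n. of_nat n * (\<bar>s\<bar> / \<rho>) ^ n + (\<bar>s\<bar> / \<rho>) ^ n)"
        by (rule convergent_imp_Bseq)
      then obtain K where K: "K > 0" "\<And>n. norm (of_nat n * (\<bar>s\<bar> / \<rho>) ^ n + (\<bar>s\<bar> / \<rho>) ^ n) \<le> K"
        by (rule BseqE) blast
      have bound: "real (Suc n) * \<bar>s\<bar> ^ n \<le> K / \<rho> * \<rho> ^ Suc n" for n
      proof -
        have "real (Suc n) * (\<bar>s\<bar> / \<rho>) ^ n \<le> K"
          using K(2)[of n] by (simp add: algebra_simps)
        then have "real (Suc n) * (\<bar>s\<bar> / \<rho>) ^ n * \<rho> ^ n \<le> K * \<rho> ^ n"
          using \<rho>r by (intro mult_right_mono) auto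
        then show ?thesis using \<rho>r by (simp add: power_divide)
      qed
      have "(\<lambda>\<alpha>. norm (c' \<alpha> * (m \<alpha> * s ^ \<alpha> v))) summable_on ?I"
      proof (rule Infinite_Sum.abs_summable_on_comparison_test')
        show "(\<lambda>\<alpha>. K / \<rho> * \<bar>c (\<alpha>(v := Suc (\<alpha> v))) * (m \<alpha> * \<rho> ^ Suc (\<alpha> v))\<bar>) summable_on ?I"
          using sm by (rule summable_on_cmult_right)
        fix \<alpha>
        have "norm (c' \<alpha> * (m \<alpha> * s ^ \<alpha> v))
            = \<bar>c (\<alpha>(v := Suc (\<alpha> v))) * m \<alpha>\<bar> * (real (Suc (\<alpha> v)) * \<bar>s\<bar> ^ \<alpha> v)"
          by (simp add: c'_def abs_mult power_abs mult_ac)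
        also have "\<dots> \<le> \<bar>c (\<alpha>(v := Suc (\<alpha> v))) * m \<alpha>\<bar> * (K / \<rho> * \<rho> ^ Suc (\<alpha> v))"
          by (intro mult_left_mono bound) auto
        also have "\<dots> = K / \<rho> * \<bar>c (\<alpha>(v := Suc (\<alpha> v))) * (m \<alpha> * \<rho> ^ Suc (\<alpha> v))\<bar>"
          using \<rho>r by (simp add: abs_mult mult_ac)
        finally show "norm (c' \<alpha> * (m \<alpha> * s ^ \<alpha> v))
            \<le> K / \<rho> * \<bar>c (\<alpha>(v := Suc (\<alpha> v))) * (m \<alpha> * \<rho> ^ Suc (\<alpha> v))\<bar>" .
      qed
      then show ?thesis by (rule abs_summable_summable)
    qed
    then obtain D' where D': "((\<lambda>\<alpha>. c' \<alpha> * (m \<alpha> * s ^ \<alpha> v)) has_sum D') ?I"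
      by (auto simp: summable_on_def)
    have "((\<lambda>(n, \<beta>). real (Suc n) * (c (\<beta>(v := Suc n)) * m \<beta>) * s ^ n) has_sum D') (UNIV \<times> J)"
      using D' by (subst (asm) regroup) (simp add: m_upd c'_def mult_ac)
    then have "((\<lambda>n. diffs C n * s ^ n) has_sum D') UNIV"
    proof (rule has_sum_SigmaD)
      fix n :: nat
      have "((\<lambda>\<beta>. real (Suc n) * (c (\<beta>(v := Suc n)) * m \<beta>) * s ^ n) has_sum
               real (Suc n) * C (Suc n) * s ^ n) J"
        by (intro has_sum_cmult_left has_sum_cmult_right C)
      then show "((\<lambda>\<beta>. case (n, \<beta>) of (n, \<beta>) \<Rightarrow> real (Suc n) * (c (\<beta>(v := Suc n)) * m \<beta>) * s ^ n)
                    has_sum diffs C n * s ^ n) J"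
        by (simp add: diffs_def)
    qed
    then have "D' = D" unfolding D_def using has_sum_imp_sums sums_unique by blast
    then show "\<exists>D. ((\<lambda>t. F (p(v := t))) has_real_derivative D) (at (p v)) \<and>
       ((\<lambda>\<alpha>. c' \<alpha> * (\<Prod>u\<in>S. (p u - a u) ^ \<alpha> u)) has_sum D) (multi_indices S)"
      using deriv D' unfolding prod_split' by blast
  qed
qed

lemma analytic_in_vars_DERIV:
  assumes F: "analytic_in_vars S F"
  shows "((\<lambda>t. F (p(v := t))) has_real_derivative deriv (\<lambda>t. F (p(v := t))) (p v)) (at (p v))"
proof -
  have "finite S" using F by (auto simp: analytic_in_vars_def)
  then have F': "analytic_in_vars (insert v S) F"
    using F by (intro analytic_in_vars_mono[OF F]) auto
  obtain r c where "r > 0" and *: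
    "\<And>q. (\<forall>u\<in>insert v S. \<bar>q u - p u\<bar> < r) \<Longrightarrow>
       \<exists>D. ((\<lambda>t. F (q(v := t))) has_real_derivative D) (at (q v)) \<and>
       ((\<lambda>\<alpha>. c \<alpha> * (\<Prod>u\<in>insert v S. (q u - p u) ^ \<alpha> u)) has_sum D) (multi_indices (insert v S))"
    by (rule analytic_in_vars_partial_aux[OF F', of v p]) auto
  then obtain D where "((\<lambda>t. F (p(v := t))) has_real_derivative D) (at (p v))"
    using *[of p] by auto
  then show ?thesis using DERIV_imp_deriv by metis
qed

lemma analytic_in_vars_partial:
  assumes F: "analytic_in_vars S F"
  shows "analytic_in_vars (insert v S) (\<lambda>p. deriv (\<lambda>t. F (p(v := t))) (p v))"
  unfolding analytic_in_vars_def
proof (intro conjI allI)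
  show fin: "finite (insert v S)" using F by (auto simp: analytic_in_vars_def)
  have F': "analytic_in_vars (insert v S) F"
    using F fin by (intro analytic_in_vars_mono[OF F]) auto
  fix a
  obtain r c where "r > 0" and *:
    "\<And>q. (\<forall>u\<in>insert v S. \<bar>q u - a u\<bar> < r) \<Longrightarrow>
       \<exists>D. ((\<lambda>t. F (q(v := t))) has_real_derivative D) (at (q v)) \<and>
       ((\<lambda>\<alpha>. c \<alpha> * (\<Prod>u\<in>insert v S. (q u - a u) ^ \<alpha> u)) has_sum D) (multi_indices (insert v S))"
    by (rule analytic_in_vars_partial_aux[OF F', of v a]) auto
  have "((\<lambda>\<alpha>. c \<alpha> * (\<Prod>u\<in>insert v S. (p u - a u) ^ \<alpha> u)) has_sum
           deriv (\<lambda>t. F (p(v := t))) (p v)) (multi_indices (insert v S))"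
    if p: "\<forall>u\<in>insert v S. \<bar>p u - a u\<bar> < r" for p
  proof -
    obtain D where D: "((\<lambda>t. F (p(v := t))) has_real_derivative D) (at (p v))"
      "((\<lambda>\<alpha>. c \<alpha> * (\<Prod>u\<in>insert v S. (p u - a u) ^ \<alpha> u)) has_sum D) (multi_indices (insert v S))"
      using *[OF p] by (elim exE conjE)
    then show ?thesis using DERIV_imp_deriv[OF D(1)] by simp
  qed
  then show "\<exists>r>0. \<exists>c. \<forall>p. (\<forall>v\<in>insert v S. \<bar>p v - a v\<bar> < r) \<longrightarrow>
        ((\<lambda>\<alpha>. c \<alpha> * (\<Prod>v\<in>insert v S. (p v - a v) ^ \<alpha> v)) has_sum
           deriv (\<lambda>t. F (p(v := t))) (p v)) (multi_indices (insert v S))"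
    using \<open>r > 0\<close> by (intro exI[of _ r] conjI exI[of _ c] allI impI)
qed

lemma real_analytic2:
  assumes "real_analytic F" "real_analytic G"
  obtains S where "analytic_in_vars S F" "analytic_in_vars S G"
proof -
  obtain S S' where *: "analytic_in_vars S F" "analytic_in_vars S' G"
    using assms by (auto simp: real_analytic_def)
  then have "finite (S \<union> S')" by (auto simp: analytic_in_vars_def)
  with * show thesis by (intro that[of "S \<union> S'"]) (auto intro: analytic_in_vars_mono)
qed

lemma real_analytic_const: "real_analytic (\<lambda>_. k)"
  unfolding real_analytic_def by (rule exI, rule analytic_in_vars_const)

lemma real_analytic_coord: "real_analytic (\<lambda>p. p v)"
  unfolding real_analytic_def by (rule exI, rule analytic_in_vars_coord)

lemma real_analytic_add:
  assumes "real_analytic F" "real_analytic G" shows "real_analytic (\<lambda>p. F p + G p)"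
  using real_analytic2[OF assms] analytic_in_vars_add[of _ F G] unfolding real_analytic_def by metis

lemma real_analytic_mult:
  assumes "real_analytic F" "real_analytic G" shows "real_analytic (\<lambda>p. F p * G p)"
  using real_analytic2[OF assms] analytic_in_vars_mult[of _ F G] unfolding real_analytic_def by metis

lemma real_analytic_uminus: "real_analytic F \<Longrightarrow> real_analytic (\<lambda>p. - F p)"
  using real_analytic_mult[OF real_analytic_const[of "-1"], of F] by simp

lemma real_analytic_diff:
  "real_analytic F \<Longrightarrow> real_analytic G \<Longrightarrow> real_analytic (\<lambda>p. F p - G p)"
  using real_analytic_add[OF _ real_analytic_uminus, of F G] by simp

lemma real_analytic_partial:
  "real_analytic F \<Longrightarrow> real_analytic (\<lambda>p. deriv (\<lambda>t. F (p(v := t))) (p v))"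
  unfolding real_analytic_def by (elim exE, rule exI, erule analytic_in_vars_partial)

lemma real_analytic_DERIV:
  "real_analytic F \<Longrightarrow>
     ((\<lambda>t. F (p(v := t))) has_real_derivative deriv (\<lambda>t. F (p(v := t))) (p v)) (at (p v))"
  unfolding real_analytic_def by (elim exE, erule analytic_in_vars_DERIV)


section \<open>The ring of real-analytic functions\<close>

typedef 'v analytic = "{F :: ('v \<Rightarrow> real) \<Rightarrow> real. real_analytic F}"
  morphisms analytic_fun Abs_analytic
  using real_analytic_const by blast

setup_lifting type_definition_analytic

instantiation analytic :: (type) idom
begin

lift_definition zero_analytic :: "'a analytic" is "\<lambda>_. 0" by (rule real_analytic_const)
lift_definition one_analytic :: "'a analytic" is "\<lambda>_. 1" by (rule real_analytic_const)
lift_definition plus_analytic :: "'a analytic \<Rightarrow> 'a analytic \<Rightarrow> 'a analytic"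
  is "\<lambda>F G p. F p + G p" by (rule real_analytic_add)
lift_definition minus_analytic :: "'a analytic \<Rightarrow> 'a analytic \<Rightarrow> 'a analytic"
  is "\<lambda>F G p. F p - G p" by (rule real_analytic_diff)
lift_definition uminus_analytic :: "'a analytic \<Rightarrow> 'a analytic"
  is "\<lambda>F p. - F p" by (rule real_analytic_uminus)
lift_definition times_analytic :: "'a analytic \<Rightarrow> 'a analytic \<Rightarrow> 'a analytic"
  is "\<lambda>F G p. F p * G p" by (rule real_analytic_mult)

instance
proof
  fix a b c :: "'a analytic"
  show "a * b * c = a * (b * c)" by transfer (simp add: mult_ac)
  show "a * b = b * a" by transfer (simp add: mult_ac)
  show "1 * a = a" by transfer simp
  show "a + b + c = a + (b + c)" by transfer (simp add: add_ac)
  show "a + b = b + a" by transfer (simp add: add_ac)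
  show "0 + a = a" by transfer simp
  show "- a + a = 0" by transfer simp
  show "a - b = a + - b" by transfer simp
  show "(a + b) * c = a * c + b * c" "a * (b + c) = a * b + a * c"
    by (transfer, simp add: algebra_simps)+
  show "0 * a = 0" "a * 0 = 0" by (transfer, simp)+
  show "(0 :: 'a analytic) \<noteq> 1" by transfer (simp add: fun_eq_iff)
  show "a \<noteq> 0 \<Longrightarrow> b \<noteq> 0 \<Longrightarrow> a * b \<noteq> 0"
  proof transfer
    fix F G :: "('a \<Rightarrow> real) \<Rightarrow> real"
    assume "real_analytic F" "real_analytic G" "F \<noteq> (\<lambda>_. 0)" "G \<noteq> (\<lambda>_. 0)"
    then show "(\<lambda>p. F p * G p) \<noteq> (\<lambda>_. 0)"
      using analytic_in_vars_no_zero_divisors[of _ F _ G]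
      unfolding real_analytic_def fun_eq_iff by metis
  qed
qed

end

lift_definition analytic_const :: "real \<Rightarrow> 'v analytic" is "\<lambda>k _. k"
  by (rule real_analytic_const)

lift_definition analytic_coord :: "'v \<Rightarrow> 'v analytic" is "\<lambda>v p. p v"
  by (rule real_analytic_coord)

lift_definition analytic_partial :: "'v \<Rightarrow> 'v analytic \<Rightarrow> 'v analytic"
  is "\<lambda>v F p. deriv (\<lambda>t. F (p(v := t))) (p v)"
  by (rule real_analytic_partial)

lift_definition analytic_depends_only_on :: "'v set \<Rightarrow> 'v analytic \<Rightarrow> bool"
  is "\<lambda>V F. \<forall>p q. (\<forall>v\<in>V. p v = q v) \<longrightarrow> F p = F q" .

lemma analytic_partial_mult:
  "analytic_partial v (a * b) = analytic_partial v a * b + a * analytic_partial v b"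
proof (transfer, rule ext)
  fix v :: 'a and F G :: "('a \<Rightarrow> real) \<Rightarrow> real" and p
  assume "real_analytic F" "real_analytic G"
  from DERIV_mult[OF this[THEN real_analytic_DERIV[where p = p and v = v]]]
  show "deriv (\<lambda>t. F (p(v := t)) * G (p(v := t))) (p v) =
        deriv (\<lambda>t. F (p(v := t))) (p v) * G p + F p * deriv (\<lambda>t. G (p(v := t))) (p v)"
    by (simp add: DERIV_imp_deriv algebra_simps)
qed

lemma finite_analytic_partial_nonzero: "finite {v. analytic_partial v a \<noteq> 0}"
proof transfer
  fix F :: "('a \<Rightarrow> real) \<Rightarrow> real"
  assume "real_analytic F"
  then obtain S where S: "analytic_in_vars S F" by (auto simp: real_analytic_def)
  have "deriv (\<lambda>t. F (p(v := t))) (p v) = 0" if "v \<notin> S" for v p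
  proof -
    have "(\<lambda>t. F (p(v := t))) = (\<lambda>t. F p)"
      using that by (intro ext analytic_in_vars_cong[OF S]) auto
    then show ?thesis by simp
  qed
  then have "{v. (\<lambda>p. deriv (\<lambda>t. F (p(v := t))) (p v)) \<noteq> (\<lambda>_. 0)} \<subseteq> S" by auto
  then show "finite {v. (\<lambda>p. deriv (\<lambda>t. F (p(v := t))) (p v)) \<noteq> (\<lambda>_. 0)}"
    using S finite_subset unfolding analytic_in_vars_def by blast
qed


section \<open>Meromorphic functions\<close>

text \<open>
  A meromorphic function is a quotient of analytic functions with denominator not identically
  zero, two quotients being identified if they agree wherever both denominators are nonzero.
\<close>

type_synonym 'v mero = "'v analytic fract"

definition mero_const :: "real \<Rightarrow> 'v mero" where
  "mero_const k = Fract (analytic_const k) 1"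

definition mero_coord :: "'v \<Rightarrow> 'v mero" where
  "mero_coord v = Fract (analytic_coord v) 1"

definition mero_in :: "'v set \<Rightarrow> 'v mero set" where
  "mero_in V = {Fract a b | a b. b \<noteq> 0 \<and> analytic_depends_only_on V a \<and> analytic_depends_only_on V b}"

text \<open>Partial derivative, by the quotient rule.\<close>

lift_definition mero_partial :: "'v \<Rightarrow> 'v mero \<Rightarrow> 'v mero"
  is "\<lambda>v q. (analytic_partial v (fst q) * snd q - fst q * analytic_partial v (snd q), snd q * snd q)"
proof -
  fix v :: 'v and q q' :: "'v analytic \<times> 'v analytic"
  assume "fractrel q q'"
  then obtain a b c d where q: "q = (a, b)" "q' = (c, d)" and nz: "b \<noteq> 0" "d \<noteq> 0" and eq: "a * d = c * b"
    by (cases q; cases q') auto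
  define a' b' c' d' where "a' = analytic_partial v a" "b' = analytic_partial v b"
    "c' = analytic_partial v c" "d' = analytic_partial v d"
  note defs = this
  have eq': "a' * d + a * d' = c' * b + c * b'"
    using arg_cong[OF eq, of "analytic_partial v"] by (simp add: analytic_partial_mult defs)
  have "(a' * b - a * b') * (d * d) = (c' * d - c * d') * (b * b)"
  proof -
    have "a' * d = c' * b + c * b' - a * d'" using eq' by (metis add_diff_cancel_right')
    then have "(a' * d) * (b * d) - (a * d) * (b' * d) = (c' * b + c * b' - a * d') * (b * d) - (c * b) * (b' * d)"
      using eq by simp
    also have "\<dots> = c' * d * (b * b) - (a * d) * (d' * b)" by (simp add: algebra_simps)
    also have "\<dots> = (c' * d - c * d') * (b * b)" unfolding eq by (simp add: algebra_simps)
    finally show ?thesis by (simp add: algebra_simps)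
  qed
  then show "fractrel (analytic_partial v (fst q) * snd q - fst q * analytic_partial v (snd q), snd q * snd q)
         (analytic_partial v (fst q') * snd q' - fst q' * analytic_partial v (snd q'), snd q' * snd q')"
    using nz by (simp add: q defs)
qed

lemma mero_partial_Fract:
  "b \<noteq> 0 \<Longrightarrow> mero_partial v (Fract a b) =
     Fract (analytic_partial v a * b - a * analytic_partial v b) (b * b)"
  by (simp add: Fract.abs_eq mero_partial.abs_eq)

lemma finite_mero_partial_nonzero: "finite {v. mero_partial v \<phi> \<noteq> 0}"
proof (cases \<phi>)
  case (Fract a b)
  have "{v. mero_partial v \<phi> \<noteq> 0} \<subseteq> {v. analytic_partial v a \<noteq> 0} \<union> {v. analytic_partial v b \<noteq> 0}"
    using Fract by (auto simp: mero_partial_Fract fract_collapse)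
  then show ?thesis
    using finite_analytic_partial_nonzero finite_subset by blast
qed


section \<open>Meromorphic control systems\<close>

text \<open>\<open>State i\<close> is the variable $x_i$ and \<open>Input j k\<close> is the $k$-th time derivative of $u_j$;
  all indices start at 0.\<close>

datatype sysvar = State nat | Input nat nat

definition state_vars :: "nat \<Rightarrow> sysvar set" where
  "state_vars N = State ` {..<N}"

definition input_vars :: "nat \<Rightarrow> sysvar set" where
  "input_vars M = (\<lambda>j. Input j 0) ` {..<M}"

definition all_vars :: "nat \<Rightarrow> nat \<Rightarrow> sysvar set" where
  "all_vars N M = state_vars N \<union> {Input j k | j k. j < M}"

definition mero_field :: "nat \<Rightarrow> nat \<Rightarrow> sysvar mero set" where
  "mero_field N M = mero_in (all_vars N M)"

text \<open>Only the components \<open>f i\<close> with \<open>i < N\<close> and \<open>h i\<close> with \<open>i < P\<close> are relevant below.\<close>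

definition meromorphic_pair ::
  "nat \<Rightarrow> nat \<Rightarrow> nat \<Rightarrow> (nat \<Rightarrow> sysvar mero) \<Rightarrow> (nat \<Rightarrow> sysvar mero) \<Rightarrow> bool" where
  "meromorphic_pair N M P f h \<longleftrightarrow>
     (\<forall>i<N. f i \<in> mero_in (state_vars N \<union> input_vars M)) \<and> (\<forall>i<P. h i \<in> mero_in (state_vars N))"

text \<open>The sum over \<open>k\<close> is finite by \<open>finite_mero_partial_nonzero\<close>.\<close>

definition time_deriv :: "nat \<Rightarrow> nat \<Rightarrow> (nat \<Rightarrow> sysvar mero) \<Rightarrow> sysvar mero \<Rightarrow> sysvar mero" where
  "time_deriv N M f \<phi> =
     (\<Sum>i<N. mero_partial (State i) \<phi> * f i) +
     (\<Sum>j<M. \<Sum>k | mero_partial (Input j k) \<phi> \<noteq> 0.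
        mero_partial (Input j k) \<phi> * mero_coord (Input j (Suc k)))"

definition autonomous_element :: "nat \<Rightarrow> nat \<Rightarrow> (nat \<Rightarrow> sysvar mero) \<Rightarrow> sysvar mero \<Rightarrow> bool" where
  "autonomous_element N M f \<xi> \<longleftrightarrow>
     \<xi> \<in> mero_in (state_vars N) \<and> \<xi> \<notin> range mero_const \<and>
     (\<forall>k. \<forall>j<M. mero_partial (Input j 0) ((time_deriv N M f ^^ k) \<xi>) = 0)"

definition accessible :: "nat \<Rightarrow> nat \<Rightarrow> (nat \<Rightarrow> sysvar mero) \<Rightarrow> bool" where
  "accessible N M f \<longleftrightarrow> \<not> (\<exists>\<xi>. autonomous_element N M f \<xi>)"

text \<open>A one-form is given by its coefficients with respect to the basis of the $dx_i$ and
  $du_j^{(k)}$.\<close>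

type_synonym one_form = "sysvar \<Rightarrow> sysvar mero"

definition differential :: "sysvar mero \<Rightarrow> one_form" where
  "differential \<phi> = (\<lambda>v. mero_partial v \<phi>)"

definition form_span :: "nat \<Rightarrow> nat \<Rightarrow> one_form set \<Rightarrow> one_form set" where
  "form_span N M \<Omega> = {(\<lambda>v. \<Sum>\<omega>\<in>T. c \<omega> * \<omega> v) | T c.
     finite T \<and> T \<subseteq> \<Omega> \<and> (\<forall>\<omega>\<in>T. c \<omega> \<in> mero_field N M)}"

definition hidden_element :: "nat \<Rightarrow> nat \<Rightarrow> nat \<Rightarrow> (nat \<Rightarrow> sysvar mero) \<Rightarrow> (nat \<Rightarrow> sysvar mero) \<Rightarrow>
    sysvar mero \<Rightarrow> bool" where
  "hidden_element N M P f h \<zeta> \<longleftrightarrow>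
     \<zeta> \<in> mero_in (state_vars N) \<and> \<zeta> \<notin> range mero_const \<and>
     (\<forall>k. differential \<zeta> \<notin> {(\<lambda>v. \<omega> v + \<eta> v) | \<omega> \<eta>.
        \<omega> \<in> form_span N M {differential ((time_deriv N M f ^^ l) (h i)) | i l. i < P \<and> l \<le> k} \<and>
        \<eta> \<in> form_span N M {differential (mero_coord (Input j l)) | j l. j < M}})"

definition observable :: "nat \<Rightarrow> nat \<Rightarrow> nat \<Rightarrow> (nat \<Rightarrow> sysvar mero) \<Rightarrow> (nat \<Rightarrow> sysvar mero) \<Rightarrow> bool" where
  "observable N M P f h \<longleftrightarrow> \<not> (\<exists>\<zeta>. hidden_element N M P f h \<zeta>)"


section \<open>System graphs and structural properties\<close>

datatype node = StateNode nat | OutputNode nat | InputNode nat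

definition state_nodes :: "nat \<Rightarrow> node set" where "state_nodes N = StateNode ` {..<N}"
definition output_nodes :: "nat \<Rightarrow> node set" where "output_nodes P = OutputNode ` {..<P}"
definition input_nodes :: "nat \<Rightarrow> node set" where "input_nodes M = InputNode ` {..<M}"

definition system_graph :: "nat \<Rightarrow> nat \<Rightarrow> nat \<Rightarrow> node pair_pre_digraph \<Rightarrow> bool" where
  "system_graph N M P G \<longleftrightarrow>
     pverts G = state_nodes N \<union> output_nodes P \<union> input_nodes M \<and>
     parcs G \<subseteq> state_nodes N \<times> state_nodes N \<union> input_nodes M \<times> state_nodes N
       \<union> state_nodes N \<times> output_nodes P"

definition graph_of_pair ::
  "nat \<Rightarrow> nat \<Rightarrow> nat \<Rightarrow> (nat \<Rightarrow> sysvar mero) \<Rightarrow> (nat \<Rightarrow> sysvar mero) \<Rightarrow> node pair_pre_digraph" where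
  "graph_of_pair N M P f h =
     \<lparr>pverts = state_nodes N \<union> output_nodes P \<union> input_nodes M,
      parcs = {(StateNode j, StateNode i) | i j. i < N \<and> j < N \<and> mero_partial (State j) (f i) \<noteq> 0}
        \<union> {(InputNode j, StateNode i) | i j. i < N \<and> j < M \<and> mero_partial (Input j 0) (f i) \<noteq> 0}
        \<union> {(StateNode j, OutputNode i) | i j. i < P \<and> j < N \<and> mero_partial (State j) (h i) \<noteq> 0}\<rparr>"

definition pairs_with_graph :: "nat \<Rightarrow> nat \<Rightarrow> nat \<Rightarrow> node pair_pre_digraph \<Rightarrow>
    ((nat \<Rightarrow> sysvar mero) \<times> (nat \<Rightarrow> sysvar mero)) set" where
  "pairs_with_graph N M P G = {(f, h). meromorphic_pair N M P f h \<and> graph_of_pair N M P f h = G}"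

definition structurally_accessible :: "nat \<Rightarrow> nat \<Rightarrow> nat \<Rightarrow> node pair_pre_digraph \<Rightarrow> bool" where
  "structurally_accessible N M P G \<longleftrightarrow> (\<exists>(f, h) \<in> pairs_with_graph N M P G. accessible N M f)"

definition structurally_observable :: "nat \<Rightarrow> nat \<Rightarrow> nat \<Rightarrow> node pair_pre_digraph \<Rightarrow> bool" where
  "structurally_observable N M P G \<longleftrightarrow> (\<exists>(f, h) \<in> pairs_with_graph N M P G. observable N M P f h)"

end

theory Submission
  imports Defs "Jordan_Normal_Form.Determinant"
begin

text \<open>
  Let \<open>H\<close> be the set of states that are not reachable from an input. The components of \<open>f\<close> belonging
  to \<open>H\<close> depend on the states in \<open>H\<close> only, so each state in \<open>H\<close> is an autonomous element. Dually, the states from which no output is reachable never enter the derivatives of the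
  outputs, so they are hidden.

  For the converse directions take a spanning forest of the graph, rooted at the inputs (resp.,
  with reversed arcs, at the outputs), and let \<open>f i\<close> be \<open>1\<close> plus a sum of exponentials of the variables
  on the incoming arcs, weighted by \<open>\<epsilon>\<close> on forest arcs and by a higher power of \<open>\<epsilon>\<close> on all others.
  The system is accessible (observable) if the \<open>N \<times> N\<close> matrix of iterated Lie brackets (of state
  gradients of the output derivatives) is nonsingular. After a diagonal rescaling its determinant is
  a polynomial in \<open>\<epsilon>\<close>, and at \<open>\<epsilon> = 0\<close> it is, up to nonzero factors, the Krylov matrix of a real
  triangular matrix carried by the forest. Its eigenvalues are the sums of the exponents along the
  paths to the roots; choosing these sums pairwise distinct makes the Krylov matrix nonsingular, hence
  the determinant does not vanish for some real \<open>\<epsilon> \<noteq> 0\<close>.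
\<close>

section \<open>Calculus of analytic functions\<close>

text \<open>Linear systems cannot serve as witnesses. If one input feeds two states that have no
  further incoming arcs, then x1' = b1 u and x2' = b2 u leave b2 x1 - b1 x2 as an autonomous
  element, although both states are reachable. Self-loops with different eigenvalues would separate
  the branches, but the graph prescribes which loops exist. The summand 1 in \<open>f i\<close> is
  the remedy: in the limit \<epsilon> = 0 it makes every state move with speed 1, and along this
  motion exp (\<alpha> x) is an eigenfunction with eigenvalue \<alpha>. The exponents thus act as
  freely chosen self-loop eigenvalues without adding an arc. The parameter \<epsilon> reconciles two
  demands: every arc of the graph must carry a nonzero coefficient, which forces \<epsilon> \<noteq>
  0, while the matrices are computable only for the uniform drift, that is, at \<epsilon> =
  0.\<close>

lemma sums_powser_has_real_derivative_0:
  fixes C :: "nat \<Rightarrow> real"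
  assumes r: "r > 0" and g: "\<And>t. \<bar>t\<bar> < r \<Longrightarrow> (\<lambda>n. C n * t ^ n) sums g t"
  shows "(g has_real_derivative C 1) (at 0)"
proof -
  have "((\<lambda>t. \<Sum>n. C n * t ^ n) has_real_derivative (\<Sum>n. diffs C n * 0 ^ n)) (at 0)"
    using g[of "r / 2"] r by (intro termdiffs_strong[of _ "r / 2"]) (auto simp: sums_iff)
  also have "(\<Sum>n. diffs C n * 0 ^ n) = C 1"
    by (simp add: diffs_def)
  finally show ?thesis
    by (rule has_field_derivative_transform_within_open[where S = "{-r<..<r}"])
       (use r g in \<open>auto simp: sums_iff\<close>)
qed

text \<open>The mixed derivative is the coefficient of s t. Exchanging the two variables only
  transposes the double series, so both orders of differentiation lead to this one coefficient; this
  is how partial derivatives will be shown to commute.\<close>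

lemma deriv_deriv_double_powser:
  fixes C :: "nat \<Rightarrow> nat \<Rightarrow> real"
  assumes r: "r > 0"
    and g: "\<And>s t. \<bar>s\<bar> < r \<Longrightarrow> \<bar>t\<bar> < r \<Longrightarrow>
      ((\<lambda>(m, n). C m n * s ^ m * t ^ n) has_sum g s t) (UNIV \<times> UNIV)"
  shows "deriv (\<lambda>s. deriv (g s) 0) 0 = C 1 1"
proof -
  define \<rho> where "\<rho> = r / 2"
  have \<rho>: "\<rho> > 0" "\<bar>\<rho>\<bar> < r" using r by (auto simp: \<rho>_def)
  define f where "f = (\<lambda>n s. infsum (\<lambda>m. C m n * s ^ m) UNIV)"
  have f: "((\<lambda>m. C m n * s ^ m) has_sum f n s) UNIV" if s: "\<bar>s\<bar> < r" for n s
  proof -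
    \<comment> \<open>A fixed nonzero value \<rho> of t reduces summability of the double series to
      summability over m for each n; dividing by the power of \<rho> recovers the bare series in
      s.\<close>
    have "((\<lambda>(m, n). C m n * s ^ m * \<rho> ^ n) has_sum g s \<rho>) (UNIV \<times> UNIV)"
      using g[OF s \<rho>(2)] .
    then have "((\<lambda>(n, m). C m n * s ^ m * \<rho> ^ n) has_sum g s \<rho>) (UNIV \<times> UNIV)"
      by (subst (asm) has_sum_swap) simp
    then have "(\<lambda>m. C m n * s ^ m * \<rho> ^ n) summable_on UNIV"
      by (intro summable_on_SigmaD1[where f = "\<lambda>n m. C m n * s ^ m * \<rho> ^ n" and A = UNIV and B = "\<lambda>_. UNIV"])
         (auto intro: has_sum_imp_summable)
    then have "(\<lambda>m. C m n * s ^ m * \<rho> ^ n * inverse (\<rho> ^ n)) summable_on UNIV"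
      by (rule summable_on_cmult_left)
    then have "(\<lambda>m. C m n * s ^ m) summable_on UNIV"
      using \<rho> by (simp add: mult.assoc)
    then show ?thesis unfolding f_def by simp
  qed
  have fs: "(g s has_real_derivative f 1 s) (at 0)" if s: "\<bar>s\<bar> < r" for s
  proof (rule sums_powser_has_real_derivative_0[OF r, of "\<lambda>n. f n s"])
    fix t :: real assume t: "\<bar>t\<bar> < r"
    have "((\<lambda>(n, m). C m n * s ^ m * t ^ n) has_sum g s t) (UNIV \<times> UNIV)"
      using g[OF s t] by (subst has_sum_swap) simp
    then have "((\<lambda>n. f n s * t ^ n) has_sum g s t) UNIV"
      by (rule has_sum_SigmaD) (use has_sum_cmult_left[OF f[OF s]] in simp)
    then show "(\<lambda>n. f n s * t ^ n) sums g s t" by (rule has_sum_imp_sums)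
  qed
  have "(f 1 has_real_derivative C 1 1) (at 0)"
    by (rule sums_powser_has_real_derivative_0[OF r, of "\<lambda>m. C m 1"])
       (use f in \<open>auto intro: has_sum_imp_sums\<close>)
  then have "((\<lambda>s. deriv (g s) 0) has_real_derivative C 1 1) (at 0)"
    by (rule has_field_derivative_transform_within_open[where S = "{-r<..<r}"])
       (use r DERIV_imp_deriv[OF fs] in auto)
  then show ?thesis by (rule DERIV_imp_deriv)
qed

text \<open>All other coordinates stay at their value in \<open>a\<close>, so only multi-indices
  supported on v and w contribute; \<open>e\<close> parametrises these by pairs of
  exponents.\<close>

lemma analytic_in_vars_double_powser:
  assumes F: "analytic_in_vars S F" and vw: "v \<in> S" "w \<in> S" "v \<noteq> w"
  obtains r C where "r > 0" "\<And>s t. \<bar>s\<bar> < r \<Longrightarrow> \<bar>t\<bar> < r \<Longrightarrow>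
      ((\<lambda>(m, n). C m n * s ^ m * t ^ n) has_sum F (a(v := a v + s, w := a w + t))) (UNIV \<times> UNIV)"
proof -
  have fin: "finite S" using F by (auto simp: analytic_in_vars_def)
  obtain r c where r: "r > 0" and c: "\<And>p. (\<forall>v\<in>S. \<bar>p v - a v\<bar> < r) \<Longrightarrow>
        ((\<lambda>\<alpha>. c \<alpha> * (\<Prod>v\<in>S. (p v - a v) ^ \<alpha> v)) has_sum F p) (multi_indices S)"
    using F unfolding analytic_in_vars_def by blast
  define e where "e = (\<lambda>(m, n) u. if u = v then m else if u = w then n else (0::nat))"
  show thesis
  proof (rule that[OF r, of "\<lambda>m n. c (e (m, n))"])
    fix s t :: real assume st: "\<bar>s\<bar> < r" "\<bar>t\<bar> < r"
    define p where "p = a(v := a v + s, w := a w + t)"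
    have p: "p v - a v = s" "p w - a w = t" "\<And>u. u \<noteq> v \<Longrightarrow> u \<noteq> w \<Longrightarrow> p u - a u = 0"
      using vw by (auto simp: p_def)
    have prod_split: "(\<Prod>u\<in>S. (p u - a u) ^ \<alpha> u) =
        s ^ \<alpha> v * t ^ \<alpha> w * (\<Prod>u\<in>S - {v, w}. 0 ^ \<alpha> u)" for \<alpha>
    proof -
      have "(\<Prod>u\<in>S. (p u - a u) ^ \<alpha> u) =
        (\<Prod>u\<in>{v, w}. (p u - a u) ^ \<alpha> u) * (\<Prod>u\<in>S - {v, w}. (p u - a u) ^ \<alpha> u)"
        using prod.subset_diff[OF _ fin, of "{v, w}" "\<lambda>u. (p u - a u) ^ \<alpha> u"] vw
        by (simp add: mult.commute)
      also have "(\<Prod>u\<in>S - {v, w}. (p u - a u) ^ \<alpha> u) = (\<Prod>u\<in>S - {v, w}. 0 ^ \<alpha> u)"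
        by (intro prod.cong) (auto simp: p(3))
      also have "(\<Prod>u\<in>{v, w}. (p u - a u) ^ \<alpha> u) = s ^ \<alpha> v * t ^ \<alpha> w"
        using vw p by simp
      finally show ?thesis .
    qed
    have "((\<lambda>\<alpha>. c \<alpha> * (\<Prod>v\<in>S. (p v - a v) ^ \<alpha> v)) has_sum F p) (multi_indices S)"
      by (rule c) (use st vw r in \<open>auto simp: p_def\<close>)
    also have "?this \<longleftrightarrow> ((\<lambda>\<alpha>. c \<alpha> * (\<Prod>v\<in>S. (p v - a v) ^ \<alpha> v)) has_sum F p) (multi_indices {v, w})"
    proof (rule has_sum_cong_neutral)
      fix \<alpha> assume \<alpha>: "\<alpha> \<in> multi_indices S - multi_indices {v, w}"
      then obtain u where "u \<notin> {v, w}" "\<alpha> u \<noteq> 0"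
        by (auto simp: multi_indices_def)
      moreover from this \<alpha> have "u \<in> S" by (auto simp: multi_indices_def)
      ultimately show "c \<alpha> * (\<Prod>v\<in>S. (p v - a v) ^ \<alpha> v) = 0"
        using fin unfolding prod_split by (auto intro!: prod_zero bexI[of _ u])
    qed (use vw in \<open>auto simp: multi_indices_def\<close>)
    also have "\<dots> \<longleftrightarrow> ((\<lambda>(m, n). c (e (m, n)) * s ^ m * t ^ n) has_sum F p) (UNIV \<times> UNIV)"
    proof (rule has_sum_reindex_bij_witness[where j = "\<lambda>\<alpha>. (\<alpha> v, \<alpha> w)" and i = e])
      fix \<alpha> assume \<alpha>: "\<alpha> \<in> multi_indices {v, w}"
      then show *: "e (\<alpha> v, \<alpha> w) = \<alpha>" by (auto simp: e_def multi_indices_def fun_eq_iff)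
      have "(\<Prod>u\<in>S - {v, w}. 0 ^ \<alpha> u) = (1::real)"
        using \<alpha> by (intro prod.neutral) (auto simp: multi_indices_def)
      then show "(case (\<alpha> v, \<alpha> w) of (m, n) \<Rightarrow> c (e (m, n)) * s ^ m * t ^ n) =
          c \<alpha> * (\<Prod>v\<in>S. (p v - a v) ^ \<alpha> v)"
        by (simp add: * prod_split)
    qed (use vw in \<open>auto simp: e_def multi_indices_def\<close>)
    finally show "((\<lambda>(m, n). c (e (m, n)) * s ^ m * t ^ n) has_sum
        F (a(v := a v + s, w := a w + t))) (UNIV \<times> UNIV)"
      by (simp add: p_def)
  qed
qed

lemma real_analytic_partial_commute:
  assumes F: "real_analytic F"
  shows "deriv (\<lambda>s. deriv (\<lambda>t. F (a(v := s, w := t))) ((a(v := s)) w)) (a v) =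
    deriv (\<lambda>t. deriv (\<lambda>s. F (a(w := t, v := s))) ((a(w := t)) v)) (a w)"
proof (cases "v = w")
  case False
  obtain S0 where S0: "analytic_in_vars S0 F" using F by (auto simp: real_analytic_def)
  define S where "S = insert v (insert w S0)"
  have S: "analytic_in_vars S F" "v \<in> S" "w \<in> S"
    unfolding S_def using S0 by (auto simp: analytic_in_vars_def[of S0] intro: analytic_in_vars_mono[OF S0])
  obtain r C where r: "r > 0" and C: "\<And>s t. \<bar>s\<bar> < r \<Longrightarrow> \<bar>t\<bar> < r \<Longrightarrow>
      ((\<lambda>(m, n). C m n * s ^ m * t ^ n) has_sum F (a(v := a v + s, w := a w + t))) (UNIV \<times> UNIV)"
    using analytic_in_vars_double_powser[OF S False, of a thesis] by blast
  have "deriv (\<lambda>s. deriv (\<lambda>t. F (a(v := a v + s, w := a w + t))) 0) 0 = C 1 1"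
    by (rule deriv_deriv_double_powser[OF r C])
  moreover have "deriv (\<lambda>t. deriv (\<lambda>s. F (a(v := a v + s, w := a w + t))) 0) 0 = C 1 1"
  proof (rule deriv_deriv_double_powser[OF r, of "\<lambda>m n. C n m"])
    fix s t :: real assume "\<bar>s\<bar> < r" "\<bar>t\<bar> < r"
    from C[OF this(2,1)]
    show "((\<lambda>(m, n). C n m * s ^ m * t ^ n) has_sum F (a(v := a v + t, w := a w + s))) (UNIV \<times> UNIV)"
      by (subst (asm) has_sum_swap) (simp add: mult_ac)
  qed
  moreover have shift: "deriv f (a u) = deriv (\<lambda>x. f (a u + x)) 0" for f :: "real \<Rightarrow> real" and u
    by (simp only: deriv_shift_0[of f "a u"] o_def)
  moreover have "a(w := x, v := y) = a(v := y, w := x)" for x y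
    using False by (simp add: fun_upd_twist)
  moreover have "(a(v := x)) w = a w" "(a(w := x)) v = a v" for x
    using False by simp_all
  ultimately show ?thesis
    by (simp only: shift[of _ v] shift[of _ w])
qed simp

lemma analytic_partial_commute:
  "analytic_partial v (analytic_partial w F) = analytic_partial w (analytic_partial v F)"
proof (transfer, rule ext)
  fix v w :: 'a and F :: "('a \<Rightarrow> real) \<Rightarrow> real" and p
  assume "real_analytic F"
  from real_analytic_partial_commute[OF this, of p v w]
  show "deriv (\<lambda>t. deriv (\<lambda>ta. F ((p(v := t))(w := ta))) ((p(v := t)) w)) (p v) =
        deriv (\<lambda>t. deriv (\<lambda>ta. F ((p(w := t))(v := ta))) ((p(w := t)) v)) (p w)" .
qed

lemma analytic_partial_add: "analytic_partial v (a + b) = analytic_partial v a + analytic_partial v b"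
proof (transfer, rule ext)
  fix v :: 'a and F G :: "('a \<Rightarrow> real) \<Rightarrow> real" and p
  assume "real_analytic F" "real_analytic G"
  from DERIV_add[OF this[THEN real_analytic_DERIV[where p = p and v = v]]]
  show "deriv (\<lambda>t. F (p(v := t)) + G (p(v := t))) (p v) =
        deriv (\<lambda>t. F (p(v := t))) (p v) + deriv (\<lambda>t. G (p(v := t))) (p v)"
    by (simp add: DERIV_imp_deriv)
qed

lemma analytic_partial_const [simp]: "analytic_partial v (analytic_const k) = 0"
  by transfer simp

lemma analytic_const_1 [simp]: "analytic_const 1 = 1" and analytic_const_0 [simp]: "analytic_const 0 = 0"
  by (transfer, simp)+

lemma analytic_partial_1 [simp]: "analytic_partial v 1 = 0"
  using analytic_partial_const[of v 1] by simp

lemma analytic_partial_coord: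
  "analytic_partial v (analytic_coord w) = (if v = w then 1 else 0)"
  by transfer (auto simp: fun_eq_iff)

lemma analytic_in_vars_exp: "analytic_in_vars {v} (\<lambda>p. exp (c * p v))"
  unfolding analytic_in_vars_def
proof (intro conjI allI)
  fix a :: "'a \<Rightarrow> real"
  define k where "k = (\<lambda>\<alpha>::'a \<Rightarrow> nat. exp (c * a v) * (c ^ \<alpha> v /\<^sub>R fact (\<alpha> v)))"
  have "((\<lambda>\<alpha>. k \<alpha> * (\<Prod>v\<in>{v}. (p v - a v) ^ \<alpha> v)) has_sum exp (c * p v)) (multi_indices {v})" for p
  proof -
    define x where "x = c * (p v - a v)"
    have "((\<lambda>n. x ^ n /\<^sub>R fact n) has_sum exp x) UNIV"
    proof (rule norm_summable_imp_has_sum)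
      show "summable (\<lambda>n. norm (x ^ n /\<^sub>R fact n))" by (rule summable_norm_exp)
      show "(\<lambda>n. x ^ n /\<^sub>R fact n) sums exp x" by (rule exp_converges)
    qed
    then have "((\<lambda>n. exp (c * a v) * (x ^ n /\<^sub>R fact n)) has_sum exp (c * a v) * exp x) UNIV"
      by (rule has_sum_cmult_right)
    also have "exp (c * a v) * exp x = exp (c * p v)"
      by (simp add: x_def algebra_simps flip: exp_add)
    also have "((\<lambda>n. exp (c * a v) * (x ^ n /\<^sub>R fact n)) has_sum exp (c * p v)) UNIV \<longleftrightarrow>
       ((\<lambda>\<alpha>. k \<alpha> * (\<Prod>v\<in>{v}. (p v - a v) ^ \<alpha> v)) has_sum exp (c * p v)) (multi_indices {v})"
      by (rule has_sum_reindex_bij_witness[where j = "\<lambda>n. (\<lambda>_. 0)(v := n)" and i = "\<lambda>\<alpha>. \<alpha> v"])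
         (auto simp: multi_indices_def fun_eq_iff k_def x_def power_mult_distrib)
    finally show ?thesis .
  qed
  then show "\<exists>r>0. \<exists>c'. \<forall>p. (\<forall>v\<in>{v}. \<bar>p v - a v\<bar> < r) \<longrightarrow>
        ((\<lambda>\<alpha>. c' \<alpha> * (\<Prod>v\<in>{v}. (p v - a v) ^ \<alpha> v)) has_sum exp (c * p v)) (multi_indices {v})"
    by (intro exI[of _ "1::real"] conjI exI[of _ k]) auto
qed auto

lift_definition analytic_exp :: "real \<Rightarrow> 'v \<Rightarrow> 'v analytic" is "\<lambda>c v p. exp (c * p v)"
  unfolding real_analytic_def by (rule exI, rule analytic_in_vars_exp)

lemma analytic_exp_nonzero [simp]: "analytic_exp c v \<noteq> 0"
  by transfer (auto simp: fun_eq_iff)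

lemma analytic_partial_exp:
  "analytic_partial w (analytic_exp c v) = (if w = v then analytic_const c * analytic_exp c v else 0)"
proof (transfer, rule ext)
  fix w v :: 'a and c p
  have "((\<lambda>t. exp (c * t)) has_real_derivative exp (c * p v) * c) (at (p v))"
    by (auto intro!: derivative_eq_intros)
  from DERIV_imp_deriv[OF this]
  show "deriv (\<lambda>t. exp (c * (p(w := t)) v)) (p w) =
      (if w = v then \<lambda>p. c * exp (c * p v) else (\<lambda>_. 0)) p"
    by (cases "w = v") simp_all
qed

lemma analytic_depends_only_on_arith:
  assumes "analytic_depends_only_on V a" "analytic_depends_only_on V b"
  shows "analytic_depends_only_on V (a + b)" "analytic_depends_only_on V (a - b)"
    "analytic_depends_only_on V (a * b)"
  using assms by (transfer, metis)+

lemma analytic_depends_only_on_const [simp]: "analytic_depends_only_on V (analytic_const c)"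
  by transfer simp

lemma analytic_depends_only_on_coord: "v \<in> V \<Longrightarrow> analytic_depends_only_on V (analytic_coord v)"
  by transfer simp

lemma analytic_depends_only_on_exp: "v \<in> V \<Longrightarrow> analytic_depends_only_on V (analytic_exp c v)"
  by transfer simp

lemma analytic_partial_outside:
  assumes "analytic_depends_only_on V a" "v \<notin> V"
  shows "analytic_partial v a = 0"
  using assms
proof transfer
  fix V v and F :: "('a \<Rightarrow> real) \<Rightarrow> real"
  assume F: "\<forall>p q. (\<forall>v\<in>V. p v = q v) \<longrightarrow> F p = F q" and v: "v \<notin> V"
  have "F (p(v := t)) = F p" for p t
    using v by (intro F[rule_format]) auto
  then show "(\<lambda>p. deriv (\<lambda>t. F (p(v := t))) (p v)) = (\<lambda>_. 0)" by simp
qed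

lemma analytic_depends_only_on_partial:
  assumes "analytic_depends_only_on V a"
  shows "analytic_depends_only_on V (analytic_partial v a)"
proof (cases "v \<in> V")
  case True
  with assms show ?thesis
  proof transfer
    fix V v p q and F :: "('a \<Rightarrow> real) \<Rightarrow> real"
    assume F: "\<forall>p q. (\<forall>v\<in>V. p v = q v) \<longrightarrow> F p = F q" and v: "v \<in> V"
    have "F (p(v := t)) = F (q(v := t))" if "\<forall>v\<in>V. p v = q v" for p q t
      using that by (intro F[rule_format]) auto
    then have "(\<lambda>t. F (p(v := t))) = (\<lambda>t. F (q(v := t)))" if "\<forall>v\<in>V. p v = q v" for p q
      using that by blast
    with v show "\<forall>p q. (\<forall>v\<in>V. p v = q v) \<longrightarrow>
        deriv (\<lambda>t. F (p(v := t))) (p v) = deriv (\<lambda>t. F (q(v := t))) (q v)"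
      by metis
  qed
next
  case False
  with analytic_partial_outside[OF assms] analytic_depends_only_on_const[of V 0] show ?thesis by simp
qed


section \<open>Calculus of meromorphic functions\<close>

lemma analytic_const_arith:
  "analytic_const (x + y) = analytic_const x + analytic_const y"
  "analytic_const (x * y) = analytic_const x * analytic_const y"
  by (transfer, simp)+

lemma analytic_const_eq_iff [simp]: "analytic_const x = analytic_const y \<longleftrightarrow> x = y"
  by transfer (auto simp: fun_eq_iff)

lemma mero_const_0 [simp]: "mero_const 0 = 0" and mero_const_1 [simp]: "mero_const 1 = 1"
  by (simp_all add: mero_const_def fract_collapse)

lemma mero_const_add: "mero_const (x + y) = mero_const x + mero_const y"
  and mero_const_mult: "mero_const (x * y) = mero_const x * mero_const y"
  by (simp_all add: mero_const_def analytic_const_arith)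

lemma mero_const_eq_iff [simp]: "mero_const x = mero_const y \<longleftrightarrow> x = y"
  by (simp add: mero_const_def eq_fract)

lemma mero_const_eq_0_iff [simp]: "mero_const x = 0 \<longleftrightarrow> x = 0"
  using mero_const_eq_iff[of x 0] by (simp del: mero_const_eq_iff)

lemma mero_const_minus: "mero_const (- x) = - mero_const x"
  using mero_const_add[of x "- x"] by (simp add: eq_neg_iff_add_eq_0 add.commute)

lemma mero_const_diff: "mero_const (x - y) = mero_const x - mero_const y"
  using mero_const_add[of x "- y"] by (simp add: mero_const_minus)

lemma mero_const_power: "mero_const (x ^ n) = mero_const x ^ n"
  by (induction n) (simp_all add: mero_const_mult)

definition mero_exp :: "real \<Rightarrow> 'v \<Rightarrow> 'v mero" where
  "mero_exp c v = Fract (analytic_exp c v) 1"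

lemma mero_exp_nonzero [simp]: "mero_exp c v \<noteq> 0"
  by (simp add: mero_exp_def Zero_fract_def eq_fract)

text \<open>Partial derivatives, input derivatives and flows along vector fields are all instances,
  which lets the perturbation argument run for an abstract derivation.\<close>

definition mero_derivation :: "('v mero \<Rightarrow> 'v mero) \<Rightarrow> bool" where
  "mero_derivation d \<longleftrightarrow> (\<forall>\<phi> \<psi>. d (\<phi> + \<psi>) = d \<phi> + d \<psi>) \<and>
     (\<forall>\<phi> \<psi>. d (\<phi> * \<psi>) = d \<phi> * \<psi> + \<phi> * d \<psi>) \<and> (\<forall>k. d (mero_const k) = 0)"

lemma mero_derivation_add: "mero_derivation d \<Longrightarrow> d (\<phi> + \<psi>) = d \<phi> + d \<psi>"
  and mero_derivation_mult: "mero_derivation d \<Longrightarrow> d (\<phi> * \<psi>) = d \<phi> * \<psi> + \<phi> * d \<psi>"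
  and mero_derivation_const: "mero_derivation d \<Longrightarrow> d (mero_const k) = 0"
  by (auto simp: mero_derivation_def)

lemma mero_derivation_0: "mero_derivation d \<Longrightarrow> d 0 = 0"
  using mero_derivation_const[of d 0] by simp

lemma mero_derivation_1: "mero_derivation d \<Longrightarrow> d 1 = 0"
  using mero_derivation_const[of d 1] by simp

lemma mero_derivation_const_mult: "mero_derivation d \<Longrightarrow> d (mero_const k * \<phi>) = mero_const k * d \<phi>"
  by (simp add: mero_derivation_mult mero_derivation_const)

lemma mero_derivation_sum: "mero_derivation d \<Longrightarrow> d (\<Sum>i\<in>A. F i) = (\<Sum>i\<in>A. d (F i))"
  by (induction A rule: infinite_finite_induct) (simp_all add: mero_derivation_0 mero_derivation_add)

lemma mero_partial_derivation: "mero_derivation (mero_partial v)"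
  unfolding mero_derivation_def
proof (intro conjI allI)
  fix \<phi> \<psi> :: "'a mero"
  obtain a b where \<phi>: "\<phi> = Fract a b" "b \<noteq> 0" by (cases \<phi>)
  obtain c d where \<psi>: "\<psi> = Fract c d" "d \<noteq> 0" by (cases \<psi>)
  have nz: "b * d \<noteq> 0" using \<phi> \<psi> by simp
  show "mero_partial v (\<phi> + \<psi>) = mero_partial v \<phi> + mero_partial v \<psi>"
    using \<phi>(2) \<psi>(2) nz unfolding \<phi>(1) \<psi>(1)
    by (simp add: mero_partial_Fract analytic_partial_add analytic_partial_mult eq_fract)
       (simp add: algebra_simps)
  show "mero_partial v (\<phi> * \<psi>) = mero_partial v \<phi> * \<psi> + \<phi> * mero_partial v \<psi>"
    using \<phi>(2) \<psi>(2) nz unfolding \<phi>(1) \<psi>(1)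
    by (simp add: mero_partial_Fract analytic_partial_add analytic_partial_mult eq_fract)
       (simp add: algebra_simps)
next
  fix k show "mero_partial v (mero_const k) = 0"
    by (simp add: mero_const_def mero_partial_Fract fract_collapse)
qed

lemmas mero_partial_add = mero_derivation_add[OF mero_partial_derivation]
  and mero_partial_mult = mero_derivation_mult[OF mero_partial_derivation]
  and mero_partial_const [simp] = mero_derivation_const[OF mero_partial_derivation]
  and mero_partial_0 [simp] = mero_derivation_0[OF mero_partial_derivation]
  and mero_partial_1 [simp] = mero_derivation_1[OF mero_partial_derivation]
  and mero_partial_const_mult = mero_derivation_const_mult[OF mero_partial_derivation]
  and mero_partial_sum = mero_derivation_sum[OF mero_partial_derivation]

lemma mero_partial_Fract_1: "mero_partial v (Fract a 1) = Fract (analytic_partial v a) 1"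
  by (simp add: mero_partial_Fract)

lemma mero_partial_coord: "mero_partial v (mero_coord w) = (if v = w then 1 else 0)"
  by (simp add: mero_coord_def mero_partial_Fract_1 analytic_partial_coord fract_collapse)

lemma mero_partial_exp:
  "mero_partial w (mero_exp c v) = (if w = v then mero_const c * mero_exp c v else 0)"
  by (simp add: mero_exp_def mero_const_def mero_partial_Fract_1 analytic_partial_exp fract_collapse)

text \<open>The commutator of two derivations satisfies the product rule. It vanishes on analytic
  functions, and applying it to \<phi> * b = a, where \<phi> = a / b, forces it to vanish on
  quotients.\<close>

lemma mero_partial_commute:
  "mero_partial v (mero_partial w \<phi>) = mero_partial w (mero_partial v \<phi>)"
proof -
  define d where "d = (\<lambda>\<phi>. mero_partial v (mero_partial w \<phi>) - mero_partial w (mero_partial v \<phi>))"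
  have d_mult: "d (\<phi> * \<psi>) = d \<phi> * \<psi> + \<phi> * d \<psi>" for \<phi> \<psi>
    by (simp add: d_def mero_partial_mult mero_partial_add algebra_simps)
  have d_analytic: "d (Fract a 1) = 0" for a
    by (simp add: d_def mero_partial_Fract_1 analytic_partial_commute[of v])
  obtain a b where \<phi>: "\<phi> = Fract a b" "b \<noteq> 0" by (cases \<phi>)
  have "\<phi> * Fract b 1 = Fract a 1"
    using \<phi> by (simp add: eq_fract)
  then have "d \<phi> * Fract b 1 = 0"
    using d_mult[of \<phi> "Fract b 1"] by (simp add: d_analytic)
  moreover have "Fract b 1 \<noteq> 0" using \<phi>(2) by (simp add: Zero_fract_def eq_fract)
  ultimately have "d \<phi> = 0" by simp
  then show ?thesis by (simp add: d_def)
qed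

lemma mero_inE:
  assumes "\<phi> \<in> mero_in V"
  obtains a b where "\<phi> = Fract a b" "b \<noteq> 0" "analytic_depends_only_on V a" "analytic_depends_only_on V b"
  using assms by (auto simp: mero_in_def)

lemma mero_inI:
  "b \<noteq> 0 \<Longrightarrow> analytic_depends_only_on V a \<Longrightarrow> analytic_depends_only_on V b \<Longrightarrow> Fract a b \<in> mero_in V"
  by (auto simp: mero_in_def)

lemma analytic_depends_only_on_01 [simp]:
  "analytic_depends_only_on V 0" "analytic_depends_only_on V 1"
  using analytic_depends_only_on_const[of V 0] analytic_depends_only_on_const[of V 1] by simp_all

lemma mero_in_const [simp]: "mero_const c \<in> mero_in V"
  by (simp add: mero_const_def mero_inI)

lemma mero_in_01 [simp]: "0 \<in> mero_in V" "1 \<in> mero_in V"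
  using mero_in_const[of 0 V] mero_in_const[of 1 V] by simp_all

lemma mero_in_coord: "v \<in> V \<Longrightarrow> mero_coord v \<in> mero_in V"
  by (simp add: mero_coord_def mero_inI analytic_depends_only_on_coord)

lemma mero_in_exp: "v \<in> V \<Longrightarrow> mero_exp c v \<in> mero_in V"
  by (simp add: mero_exp_def mero_inI analytic_depends_only_on_exp)

lemma mero_in_add: "\<phi> \<in> mero_in V \<Longrightarrow> \<psi> \<in> mero_in V \<Longrightarrow> \<phi> + \<psi> \<in> mero_in V"
  by (elim mero_inE) (simp add: mero_inI analytic_depends_only_on_arith)

lemma mero_in_mult: "\<phi> \<in> mero_in V \<Longrightarrow> \<psi> \<in> mero_in V \<Longrightarrow> \<phi> * \<psi> \<in> mero_in V"
  by (elim mero_inE) (simp add: mero_inI analytic_depends_only_on_arith)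

lemma mero_in_uminus: "\<phi> \<in> mero_in V \<Longrightarrow> - \<phi> \<in> mero_in V"
  using mero_in_mult[OF mero_in_const[of "-1"], of \<phi>] by (simp add: mero_const_minus)

lemma mero_in_inverse: "\<phi> \<in> mero_in V \<Longrightarrow> inverse \<phi> \<in> mero_in V"
proof (elim mero_inE)
  fix a b assume *: "\<phi> = Fract a b" "b \<noteq> 0" "analytic_depends_only_on V a" "analytic_depends_only_on V b"
  show ?thesis
  proof (cases "a = 0")
    case True
    with * show ?thesis by (simp add: fract_collapse)
  next
    case False
    with * show ?thesis by (simp add: mero_inI)
  qed
qed

lemma mero_in_divide: "\<phi> \<in> mero_in V \<Longrightarrow> \<psi> \<in> mero_in V \<Longrightarrow> \<phi> / \<psi> \<in> mero_in V"
  by (simp add: divide_inverse mero_in_mult mero_in_inverse)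

lemma mero_in_sum: "(\<And>i. i \<in> A \<Longrightarrow> F i \<in> mero_in V) \<Longrightarrow> (\<Sum>i\<in>A. F i) \<in> mero_in V"
  by (induction A rule: infinite_finite_induct) (simp_all add: mero_in_add)

lemma mero_in_prod: "(\<And>i. i \<in> A \<Longrightarrow> F i \<in> mero_in V) \<Longrightarrow> (\<Prod>i\<in>A. F i) \<in> mero_in V"
  by (induction A rule: infinite_finite_induct) (simp_all add: mero_in_mult)

lemma mero_in_mono:
  assumes "\<phi> \<in> mero_in V" "V \<subseteq> W"
  shows "\<phi> \<in> mero_in W"
proof -
  have "analytic_depends_only_on W a" if "analytic_depends_only_on V a" for a
    using that assms(2) by transfer (meson subsetD)
  with assms(1) show ?thesis by (auto elim!: mero_inE intro!: mero_inI)
qed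

lemma mero_in_partial: "\<phi> \<in> mero_in V \<Longrightarrow> mero_partial v \<phi> \<in> mero_in V"
  by (elim mero_inE) (simp add: mero_partial_Fract mero_inI analytic_depends_only_on_arith
      analytic_depends_only_on_partial)

lemma mero_partial_outside: "\<phi> \<in> mero_in V \<Longrightarrow> v \<notin> V \<Longrightarrow> mero_partial v \<phi> = 0"
  by (elim mero_inE) (simp add: mero_partial_Fract analytic_partial_outside fract_collapse)

lemma mero_coord_not_const: "mero_coord v \<notin> range mero_const"
proof
  assume "mero_coord v \<in> range mero_const"
  then obtain c where "mero_coord v = mero_const c" by auto
  then have "mero_partial v (mero_coord v) = 0" by simp
  then show False by (simp add: mero_partial_coord)
qed


text \<open>The hypothesis says that \<open>F / G\<close> has zero derivative in direction \<open>v\<close>; being constant near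
  \<open>p\<close> on the line, the quotient is constant on the whole line by analyticity.\<close>
lemma real_analytic_vanish_on_line:
  assumes F: "real_analytic F" and G: "real_analytic G"
    and FG: "\<And>q. deriv (\<lambda>t. F (q(v := t))) (q v) * G q = F q * deriv (\<lambda>t. G (q(v := t))) (q v)"
    and p: "G p \<noteq> 0" "F p = 0"
  shows "F (p(v := t)) = 0"
proof (rule ccontr)
  assume nz: "F (p(v := t)) \<noteq> 0"
  obtain S where S: "analytic_in_vars S F" "analytic_in_vars S G"
    using real_analytic2[OF F G] by blast
  define w where "w = (\<lambda>u. if u = v then 1 else 0 :: real)"
  have line: "(\<lambda>u. p u + s * w u) = p(v := p v + s)" for s
    by (auto simp: w_def)
  obtain s1 where s1: "s1 > 0" "\<And>s. \<bar>s\<bar> < s1 \<Longrightarrow> s \<noteq> 0 \<Longrightarrow> G (p(v := p v + s)) \<noteq> 0"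
    using analytic_in_vars_line_punctured[OF S(2), of p 0 w 0] p(1) unfolding line by auto
  obtain s2 where s2: "s2 > 0" "\<And>s. \<bar>s\<bar> < s2 \<Longrightarrow> s \<noteq> 0 \<Longrightarrow> F (p(v := p v + s)) \<noteq> 0"
    using analytic_in_vars_line_punctured[OF S(1), of p "t - p v" w 0] nz unfolding line by auto
  define I where "I = {p v - s1<..<p v + s1}"
  have Gnz: "G (p(v := x)) \<noteq> 0" if "x \<in> I" for x
  proof (cases "x = p v")
    case False
    have "\<bar>x - p v\<bar> < s1" using that by (auto simp: I_def abs_less_iff)
    with s1(2)[of "x - p v"] False show ?thesis by simp
  qed (use p in simp)
  have "\<exists>c. \<forall>x\<in>I. F (p(v := x)) / G (p(v := x)) = c"
  proof (rule has_field_derivative_zero_constant)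
    show "convex I" by (simp add: I_def)
    fix x assume x: "x \<in> I"
    have D: "((\<lambda>t. H (p(v := t))) has_real_derivative deriv (\<lambda>t. H (p(v := t))) x) (at x)"
      if "real_analytic H" for H
      using real_analytic_DERIV[OF that, of "p(v := x)" v] by simp
    have "((\<lambda>t. F (p(v := t)) / G (p(v := t))) has_real_derivative
      (deriv (\<lambda>t. F (p(v := t))) x * G (p(v := x)) - F (p(v := x)) * deriv (\<lambda>t. G (p(v := t))) x)
        / (G (p(v := x)) * G (p(v := x)))) (at x)"
      by (rule DERIV_divide[OF D[OF F] D[OF G] Gnz[OF x]])
    moreover have "deriv (\<lambda>t. F (p(v := t))) x * G (p(v := x)) = F (p(v := x)) * deriv (\<lambda>t. G (p(v := t))) x"
      using FG[of "p(v := x)"] by simp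
    ultimately have "((\<lambda>t. F (p(v := t)) / G (p(v := t))) has_real_derivative 0) (at x)"
      by (simp only: diff_self div_0)
    then show "((\<lambda>t. F (p(v := t)) / G (p(v := t))) has_real_derivative 0) (at x within I)"
      by (rule has_field_derivative_at_within)
  qed
  then obtain c where c: "\<And>x. x \<in> I \<Longrightarrow> F (p(v := x)) / G (p(v := x)) = c" by blast
  have "p v \<in> I" using s1 by (simp add: I_def)
  with c[of "p v"] p have "c = 0" by simp
  obtain s where s: "0 < s" "s < s1" "s < s2" using s1(1) s2(1) dense[of 0 "min s1 s2"] by auto
  then have "p v + s \<in> I" by (simp add: I_def)
  then have "F (p(v := p v + s)) = 0" using c[of "p v + s"] Gnz \<open>c = 0\<close> by simp
  with s2(2)[of s] s show False by simp
qed

text \<open>Induction on the coordinates in which \<open>q\<close> differs from \<open>p\<close>.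
  The previous lemma changes one coordinate, but only from points where \<open>G\<close> is nonzero,
  and a point halfway between \<open>p\<close> and \<open>q\<close> may violate this. The
  intermediate point is therefore taken close to \<open>p\<close>.\<close>

lemma real_analytic_vanish:
  assumes F: "real_analytic F" and G: "real_analytic G"
    and FG: "\<And>q v. deriv (\<lambda>t. F (q(v := t))) (q v) * G q = F q * deriv (\<lambda>t. G (q(v := t))) (q v)"
    and p: "G p \<noteq> 0" "F p = 0"
  shows "F q = 0"
proof -
  obtain S where S: "analytic_in_vars S F" "analytic_in_vars S G"
    using real_analytic2[OF F G] by blast
  have *: "F q = 0" if "finite T" "\<forall>u. u \<notin> T \<longrightarrow> q u = p u" for T q
    using that
  proof (induction T arbitrary: q rule: finite_induct)
    case empty
    then have "q = p" by auto
    with p show ?case by simp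
  next
    case (insert v T)
    show ?case
    proof (rule ccontr)
      assume nz: "F q \<noteq> 0"
      \<comment> \<open>Here a + w = q. For small t > 0 the point p + t w still has \<open>G\<close>
        nonzero and differs from \<open>p\<close> on \<open>T\<close> only, so the induction
        hypothesis applies to it. Moving its coordinate \<open>v\<close> to \<open>q v\<close> gives
        a + t w, where \<open>F\<close> is nonzero because it is so at t = 1 and zeros on a line are
        isolated.\<close>
      define w where "w = (\<lambda>u. if u = v then 0 else q u - p u)"
      define a where "a = p(v := q v)"
      have "F (\<lambda>u. a u + 1 * w u) \<noteq> 0" "G (\<lambda>u. p u + 0 * w u) \<noteq> 0"
      proof -
        have "(\<lambda>u. a u + 1 * w u) = q" by (auto simp: a_def w_def)
        with nz show "F (\<lambda>u. a u + 1 * w u) \<noteq> 0" by simp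
      qed (use p in simp)
      then obtain s s' where "s > 0" "\<forall>t'. \<bar>t' - 0\<bar> < s \<longrightarrow> t' \<noteq> 0 \<longrightarrow> F (\<lambda>u. a u + t' * w u) \<noteq> 0"
        "s' > 0" "\<forall>t'. \<bar>t' - 0\<bar> < s' \<longrightarrow> t' \<noteq> 0 \<longrightarrow> G (\<lambda>u. p u + t' * w u) \<noteq> 0"
        using analytic_in_vars_line_punctured[OF S(1), of a 1 w 0]
          analytic_in_vars_line_punctured[OF S(2), of p 0 w 0] by blast
      note * = this
      from *(1,3) obtain t where t: "0 < t" "t < s" "t < s'" using dense[of 0 "min s s'"] by auto
      define q' where "q' = (\<lambda>u. p u + t * w u)"
      have q'F: "F q' = 0"
      proof (rule insert.IH, intro allI impI)
        fix u assume "u \<notin> T"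
        then show "q' u = p u" using insert.prems[rule_format, of u] by (simp add: q'_def w_def)
      qed
      have q'G: "G q' \<noteq> 0" using *(4)[rule_format, of t] t by (simp add: q'_def)
      have line_zero: "F (q'(v := q v)) = 0"
        using real_analytic_vanish_on_line[where F = F and G = G and v = v and p = q' and t = "q v"]
          F G FG[where v = v] q'G q'F by simp
      have "q'(v := q v) = (\<lambda>u. a u + t * w u)"
        by (rule ext) (simp add: q'_def a_def w_def)
      with line_zero have "F (\<lambda>u. a u + t * w u) = 0" by (simp only:)
      moreover have "F (\<lambda>u. a u + t * w u) \<noteq> 0" using *(2)[rule_format, of t] t by simp
      ultimately show False by contradiction
    qed
  qed
  have fin: "finite S" using S by (auto simp: analytic_in_vars_def)
  have "F q = F (\<lambda>u. if u \<in> S then q u else p u)"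
    by (rule analytic_in_vars_cong[OF S(1)]) simp
  also have "\<dots> = 0" by (rule *[OF fin]) simp
  finally show ?thesis .
qed

text \<open>The hypothesis is the vanishing of the gradient of a / b, stated without division.
  Subtracting from \<open>a\<close> the multiple of \<open>b\<close> that agrees with it at a point
  where \<open>b\<close> is nonzero preserves the hypothesis and creates a zero there, so the
  difference vanishes identically.\<close>

lemma analytic_proportional:
  assumes b: "b \<noteq> 0"
    and ab: "\<And>v. analytic_partial v a * b = a * analytic_partial v b"
  shows "\<exists>k. a = analytic_const k * b"
proof -
  obtain p where p: "analytic_fun b p \<noteq> 0"
    using b by transfer (auto simp: fun_eq_iff)
  define c where "c = a - analytic_const (analytic_fun a p / analytic_fun b p) * b"
  have cb: "analytic_partial v c * b = c * analytic_partial v b" for v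
  proof -
    define k :: "'a analytic" where "k = analytic_const (analytic_fun a p / analytic_fun b p)"
    have "a = c + k * b" by (simp add: c_def k_def)
    from arg_cong[OF this, of "analytic_partial v"]
    have dc: "analytic_partial v c = analytic_partial v a - k * analytic_partial v b"
      by (simp add: analytic_partial_add analytic_partial_mult k_def)
    show ?thesis
      unfolding dc using ab[of v] unfolding c_def k_def[symmetric] by (simp add: algebra_simps)
  qed
  have "analytic_fun c q = 0" for q
  proof (rule real_analytic_vanish[where F = "analytic_fun c" and G = "analytic_fun b" and p = p])
    show "real_analytic (analytic_fun c)" "real_analytic (analytic_fun b)"
      using analytic_fun by auto
    show "analytic_fun b p \<noteq> 0" by (rule p)
    show "analytic_fun c p = 0"
      using p by (simp add: c_def minus_analytic.rep_eq times_analytic.rep_eq analytic_const.rep_eq)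
    show "deriv (\<lambda>t. analytic_fun c (q(v := t))) (q v) * analytic_fun b q =
        analytic_fun c q * deriv (\<lambda>t. analytic_fun b (q(v := t))) (q v)" for q v
      using arg_cong[OF cb[of v], of "\<lambda>f. analytic_fun f q"]
      by (simp only: times_analytic.rep_eq analytic_partial.rep_eq)
  qed
  then have "c = 0"
    by (simp add: zero_analytic.rep_eq fun_eq_iff flip: analytic_fun_inject)
  then show ?thesis unfolding c_def by auto
qed

lemma mero_const_if_partials_0:
  assumes "\<And>v. mero_partial v \<phi> = 0"
  shows "\<phi> \<in> range mero_const"
proof -
  obtain a b where \<phi>: "\<phi> = Fract a b" "b \<noteq> 0" by (cases \<phi>)
  have "analytic_partial v a * b = a * analytic_partial v b" for v
    using assms[of v] \<phi> by (simp add: mero_partial_Fract Zero_fract_def eq_fract)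
  from analytic_proportional[OF \<phi>(2) this] obtain k where "a = analytic_const k * b" by blast
  then have "\<phi> = mero_const k" using \<phi> by (simp add: mero_const_def eq_fract)
  then show ?thesis by simp
qed


section \<open>Nonsingularity of perturbed Krylov matrices\<close>

text \<open>\<open>par\<close> maps a node of a forest to its parent, roots to \<open>None\<close>.\<close>
primrec krylov :: "(nat \<Rightarrow> nat option) \<Rightarrow> (nat \<Rightarrow> 'a::field) \<Rightarrow> nat \<Rightarrow> nat \<Rightarrow> 'a" where
  "krylov par \<mu> 0 j = (if par j = None then 1 else 0)"
| "krylov par \<mu> (Suc l) j = \<mu> j * krylov par \<mu> l j + (case par j of None \<Rightarrow> 0 | Some k \<Rightarrow> krylov par \<mu> l k)"

text \<open>For \<open>j = m\<close> this is an eigenfunctional for the eigenvalue \<open>\<mu> m\<close>, supported on the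
  path from \<open>m\<close> to its root.\<close>
lemma krylov_eigenfunctional:
  fixes \<mu> :: "nat \<Rightarrow> 'a::field"
  assumes par: "\<And>j k. j < N \<Longrightarrow> par j = Some k \<Longrightarrow> k < N \<and> dep j = Suc (dep k)"
    and inj: "inj_on \<mu> {..<N}" and m: "m < N"
    and j: "j < N" "dep j \<le> dep m"
  shows "\<exists>w. (\<forall>l. (\<Sum>i<N. w i * krylov par \<mu> (Suc l) i) =
                 \<mu> m * (\<Sum>i<N. w i * krylov par \<mu> l i) + (\<mu> j - \<mu> m) * krylov par \<mu> l j) \<and>
             (\<Sum>i<N. w i * krylov par \<mu> 0 i) \<noteq> 0"
  using j
proof (induction "dep j" arbitrary: j rule: less_induct)
  case less
  define e where "e = (\<lambda>i. if i = j then 1 else 0 :: 'a)"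
  have e: "(\<Sum>i<N. e i * f i) = f j" for f
    using less.prems(1) by (simp add: e_def if_distrib if_distribR cong: if_cong)
  show ?case
  proof (cases "par j")
    case None
    show ?thesis
      by (intro exI[of _ e] conjI allI) (simp_all only: e, simp_all add: None algebra_simps)
  next
    case (Some k)
    note k = par[OF less.prems(1) Some]
    obtain w where w: "\<And>l. (\<Sum>i<N. w i * krylov par \<mu> (Suc l) i) =
          \<mu> m * (\<Sum>i<N. w i * krylov par \<mu> l i) + (\<mu> k - \<mu> m) * krylov par \<mu> l k"
        "(\<Sum>i<N. w i * krylov par \<mu> 0 i) \<noteq> 0"
      using less.hyps[of k] k less.prems by auto
    have "k \<noteq> m" using k less.prems by auto
    then have d: "\<mu> m - \<mu> k \<noteq> 0" using inj k m by (auto dest: inj_onD)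
    \<comment> \<open>The multiple of the parent's functional is chosen to cancel the term
      \<open>krylov par \<mu> l k\<close> of the recursion.\<close>
    define w' where "w' = (\<lambda>i. e i + w i / (\<mu> m - \<mu> k))"
    have w': "(\<Sum>i<N. w' i * f i) = f j + (\<Sum>i<N. w i * f i) / (\<mu> m - \<mu> k)" for f
      by (simp add: w'_def distrib_right sum.distrib e sum_divide_distrib)
    have "(\<Sum>i<N. w' i * krylov par \<mu> (Suc l) i) =
        \<mu> m * (\<Sum>i<N. w' i * krylov par \<mu> l i) + (\<mu> j - \<mu> m) * krylov par \<mu> l j" for l
      unfolding w' w(1) using d by (simp add: Some field_simps)
    moreover have "(\<Sum>i<N. w' i * krylov par \<mu> 0 i) \<noteq> 0"
      unfolding w' using w(2) d Some by simp
    ultimately show ?thesis by blast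
  qed
qed

text \<open>A relation among the rows is a polynomial \<open>q\<close> of degree below N. Testing it
  with the eigenfunctional of \<open>m\<close> gives the value of \<open>q\<close> at \<mu> m times
  a nonzero number, so a nonzero \<open>q\<close> would have N distinct roots.\<close>

lemma krylov_independent:
  fixes \<mu> :: "nat \<Rightarrow> 'a::field"
  assumes par: "\<And>j k. j < N \<Longrightarrow> par j = Some k \<Longrightarrow> k < N \<and> dep j = Suc (dep k)"
    and inj: "inj_on \<mu> {..<N}"
    and c: "\<And>j. j < N \<Longrightarrow> (\<Sum>l<N. c l * krylov par \<mu> l j) = 0"
    and l: "l < N"
  shows "c l = 0"
proof -
  define q where "q = (\<Sum>l<N. monom (c l) l)"
  have coeff_q: "coeff q l = (if l < N then c l else 0)" for l
    by (simp add: q_def coeff_sum if_distrib cong: if_cong)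
  have root: "poly q (\<mu> m) = 0" if m: "m < N" for m
  proof -
    obtain w where w: "\<And>l. (\<Sum>i<N. w i * krylov par \<mu> (Suc l) i) = \<mu> m * (\<Sum>i<N. w i * krylov par \<mu> l i)"
        "(\<Sum>i<N. w i * krylov par \<mu> 0 i) \<noteq> 0"
      using krylov_eigenfunctional[OF par inj m m] by auto
    define \<kappa> where "\<kappa> = (\<Sum>i<N. w i * krylov par \<mu> 0 i)"
    have pow: "(\<Sum>i<N. w i * krylov par \<mu> l i) = \<mu> m ^ l * \<kappa>" for l
    proof (induction l)
      case (Suc l)
      show ?case unfolding w(1) Suc.IH by (simp add: mult.assoc)
    qed (simp add: \<kappa>_def)
    have "poly q (\<mu> m) * \<kappa> =
        (\<Sum>l<N. c l * (\<Sum>i<N. w i * krylov par \<mu> l i))"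
      unfolding pow by (simp add: q_def poly_sum poly_monom sum_distrib_right mult.assoc)
    also have "\<dots> = (\<Sum>i<N. w i * (\<Sum>l<N. c l * krylov par \<mu> l i))"
      unfolding sum_distrib_left by (subst sum.swap) (simp add: mult_ac)
    also have "\<dots> = 0" using c by simp
    finally show ?thesis using w(2) by (simp add: \<kappa>_def)
  qed
  have "q = 0"
  proof (rule ccontr)
    assume q: "q \<noteq> 0"
    have "N = card (\<mu> ` {..<N})" using inj by (simp add: card_image)
    also have "\<dots> \<le> card {x. poly q x = 0}"
      using root q by (intro card_mono poly_roots_finite) auto
    also have "\<dots> \<le> degree q" by (rule card_poly_roots_bound[OF q])
    also have "degree q < N"
      using l by (intro degree_lessI) (auto simp: coeff_q)
    finally show False by simp
  qed
  then show ?thesis using coeff_q[of l] l by simp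
qed

text \<open>The coefficients of the polynomial are meromorphic functions. Passing from \<epsilon> =
  0 to a nonzero real \<epsilon> then only requires that a polynomial over a field has finitely many
  roots, and no topology on that field.\<close>

definition poly_family :: "(real \<Rightarrow> 'v mero) \<Rightarrow> bool" where
  "poly_family \<phi> \<longleftrightarrow> (\<exists>p. \<forall>\<epsilon>. \<phi> \<epsilon> = poly p (mero_const \<epsilon>))"

lemma poly_family_fixed [simp]: "poly_family (\<lambda>_. a)"
  unfolding poly_family_def by (rule exI[of _ "[:a:]"]) simp

lemma poly_family_const: "poly_family mero_const"
  unfolding poly_family_def by (rule exI[of _ "[:0, 1:]"]) simp

lemma poly_family_add: "poly_family \<phi> \<Longrightarrow> poly_family \<psi> \<Longrightarrow> poly_family (\<lambda>\<epsilon>. \<phi> \<epsilon> + \<psi> \<epsilon>)"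
  unfolding poly_family_def by (metis poly_add)

lemma poly_family_mult: "poly_family \<phi> \<Longrightarrow> poly_family \<psi> \<Longrightarrow> poly_family (\<lambda>\<epsilon>. \<phi> \<epsilon> * \<psi> \<epsilon>)"
  unfolding poly_family_def by (metis poly_mult)

lemma poly_family_power: "poly_family \<phi> \<Longrightarrow> poly_family (\<lambda>\<epsilon>. \<phi> \<epsilon> ^ n)"
  by (induction n) (simp_all add: poly_family_mult)

lemma poly_family_sum: "(\<And>i. i \<in> A \<Longrightarrow> poly_family (F i)) \<Longrightarrow> poly_family (\<lambda>\<epsilon>. \<Sum>i\<in>A. F i \<epsilon>)"
  by (induction A rule: infinite_finite_induct) (simp_all add: poly_family_add)

lemma poly_family_prod: "(\<And>i. i \<in> A \<Longrightarrow> poly_family (F i)) \<Longrightarrow> poly_family (\<lambda>\<epsilon>. \<Prod>i\<in>A. F i \<epsilon>)"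
  by (induction A rule: infinite_finite_induct) (simp_all add: poly_family_mult)

text \<open>Derivations kill real constants, so they act on the coefficients of the polynomial
  only.\<close>

lemma poly_family_derivation:
  assumes d: "mero_derivation d" and \<phi>: "poly_family \<phi>"
  shows "poly_family (\<lambda>\<epsilon>. d (\<phi> \<epsilon>))"
proof -
  obtain p where p: "\<And>\<epsilon>. \<phi> \<epsilon> = poly p (mero_const \<epsilon>)"
    using \<phi> by (auto simp: poly_family_def)
  have "poly_family (\<lambda>\<epsilon>. d (poly p (mero_const \<epsilon>)))"
  proof (induction p)
    case 0
    show ?case by simp
  next
    case (pCons a p)
    then show ?case
      by (simp add: mero_derivation_add[OF d] mero_derivation_const_mult[OF d]
          poly_family_add poly_family_mult poly_family_const)
  qed
  then show ?thesis by (simp add: p)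
qed

text \<open>The value \<epsilon> = 0 has to be left because all arc weights vanish there and the
  graph is lost.\<close>

lemma poly_family_nonzero:
  assumes \<phi>: "poly_family \<phi>" "\<phi> 0 \<noteq> 0"
  shows "\<exists>\<epsilon>. \<epsilon> \<noteq> 0 \<and> \<phi> \<epsilon> \<noteq> 0"
proof -
  obtain p where p: "\<And>\<epsilon>. \<phi> \<epsilon> = poly p (mero_const \<epsilon>)"
    using \<phi> by (auto simp: poly_family_def)
  have "p \<noteq> 0" using p[of 0] \<phi>(2) by auto
  then have "finite {x. poly p x = 0}" by (rule poly_roots_finite)
  then have "finite (mero_const -` {x. poly p x = 0} :: real set)"
    by (rule finite_vimageI) (simp add: inj_def)
  then have "finite (insert 0 (mero_const -` {x. poly p x = 0}) :: real set)" by simp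
  then obtain \<epsilon> :: real where "\<epsilon> \<notin> insert 0 (mero_const -` {x. poly p x = 0})"
    using infinite_UNIV_char_0[where 'a = real] ex_new_if_finite by blast
  then show ?thesis using p by auto
qed

lemma poly_family_det:
  assumes "\<And>i j. i < n \<Longrightarrow> j < n \<Longrightarrow> poly_family (A i j)"
  shows "poly_family (\<lambda>\<epsilon>. det (mat n n (\<lambda>(i, j). A i j \<epsilon>)))"
proof -
  have "det (mat n n (\<lambda>(i, j). A i j \<epsilon>)) =
      (\<Sum>p | p permutes {0..<n}. signof p * (\<Prod>i=0..<n. A i (p i) \<epsilon>))" for \<epsilon>
    by (subst det_def'[where n = n]) (auto intro!: sum.cong prod.cong simp: permutes_in_image)
  moreover have "poly_family (\<lambda>\<epsilon>. \<Sum>p | p permutes {0..<n}. signof p * (\<Prod>i=0..<n. A i (p i) \<epsilon>))"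
    by (intro poly_family_sum poly_family_mult poly_family_prod poly_family_fixed assms)
       (auto simp: permutes_in_image)
  ultimately show ?thesis by simp
qed

text \<open>The counter makes a walk along parent pointers structurally recursive; the depth of
  \<open>j\<close> is a sufficient start value.\<close>

primrec path_prod :: "(nat \<Rightarrow> nat option) \<Rightarrow> (nat \<Rightarrow> 'a::comm_monoid_mult) \<Rightarrow> nat \<Rightarrow> nat \<Rightarrow> 'a" where
  "path_prod par \<theta> 0 j = \<theta> j"
| "path_prod par \<theta> (Suc n) j = (case par j of None \<Rightarrow> \<theta> j | Some k \<Rightarrow> \<theta> j * path_prod par \<theta> n k)"

text \<open>At \<open>\<epsilon> = 0\<close> the recursion lives on the forest: dividing the \<open>j\<close>-th entry by the product of
  the \<open>\<theta>\<close>s along the path from \<open>j\<close> to its root leaves a system with constant coefficients that is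
  triangular with the distinct eigenvalues \<open>\<mu> j\<close>.\<close>
lemma perturbed_krylov_nonsingular:
  fixes x :: "nat \<Rightarrow> nat \<Rightarrow> real \<Rightarrow> 'v mero" and \<delta> :: "real \<Rightarrow> 'v mero \<Rightarrow> 'v mero"
  assumes par: "\<And>j k. j < N \<Longrightarrow> par j = Some k \<Longrightarrow> k < N \<and> dep j = Suc (dep k)"
    and inj: "inj_on \<mu> {..<N}"
    and x_0: "\<And>j. j < N \<Longrightarrow> poly_family (x 0 j)"
    and x_Suc: "\<And>l j \<epsilon>. j < N \<Longrightarrow> x (Suc l) j \<epsilon> = \<delta> \<epsilon> (x l j \<epsilon>) + (\<Sum>i<N. Q j i \<epsilon> * x l i \<epsilon>)"
    and \<delta>: "\<And>\<phi>. poly_family \<phi> \<Longrightarrow> poly_family (\<lambda>\<epsilon>. \<delta> \<epsilon> (\<phi> \<epsilon>))"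
    and Q: "\<And>j i. j < N \<Longrightarrow> i < N \<Longrightarrow> poly_family (Q j i)"
    and \<delta>_at_0: "mero_derivation (\<delta> 0)"
    and \<theta>_nonzero: "\<And>j. j < N \<Longrightarrow> \<theta> j \<noteq> 0"
    and \<delta>_\<theta>: "\<And>j. j < N \<Longrightarrow>
      \<delta> 0 (\<theta> j) = mero_const (case par j of None \<Rightarrow> \<mu> j | Some k \<Rightarrow> \<mu> j - \<mu> k) * \<theta> j"
    and x_0_at_0: "\<And>j. j < N \<Longrightarrow> x 0 j 0 = (if par j = None then \<theta> j else 0)"
    and Q_at_0: "\<And>j i. j < N \<Longrightarrow> i < N \<Longrightarrow> Q j i 0 = (if par j = Some i then \<theta> j else 0)"
  shows "\<exists>\<epsilon>. \<epsilon> \<noteq> 0 \<and> det (mat N N (\<lambda>(l, j). x l j \<epsilon>)) \<noteq> 0"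
proof (rule poly_family_nonzero)
  have x: "j < N \<Longrightarrow> poly_family (x l j)" for l j
  proof (induction l arbitrary: j)
    case (Suc l)
    have "x (Suc l) j = (\<lambda>\<epsilon>. \<delta> \<epsilon> (x l j \<epsilon>) + (\<Sum>i<N. Q j i \<epsilon> * x l i \<epsilon>))"
      using x_Suc Suc.prems by blast
    moreover have "poly_family \<dots>"
      using Suc by (intro poly_family_add \<delta> poly_family_sum poly_family_mult Q) auto
    ultimately show ?case by simp
  qed (rule x_0)
  then show "poly_family (\<lambda>\<epsilon>. det (mat N N (\<lambda>(l, j). x l j \<epsilon>)))"
    by (rule poly_family_det)
  define E where "E = (\<lambda>j. path_prod par \<theta> (dep j) j)"
  have E_root: "E j = \<theta> j" if "par j = None" for j
    unfolding E_def using that by (cases "dep j") simp_all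
  have E_child: "E j = \<theta> j * E k" if "j < N" "par j = Some k" for j k
    unfolding E_def using par[OF that] that by simp
  have E_nonzero: "E j \<noteq> 0" if "j < N" for j
    using that
  proof (induction "dep j" arbitrary: j rule: less_induct)
    case less
    then show ?case using par[OF less.prems] \<theta>_nonzero E_root E_child by (cases "par j") auto
  qed
  \<comment> \<open>Logarithmic derivatives add up along the path: each edge contributes \<mu> j -
    \<mu> k and the root its own \<mu>, so the sum telescopes to \<mu> j.\<close>
  have \<delta>_E: "\<delta> 0 (E j) = mero_const (\<mu> j) * E j" if "j < N" for j
    using that
  proof (induction "dep j" arbitrary: j rule: less_induct)
    case less
    show ?case
    proof (cases "par j")
      case None
      then show ?thesis using \<delta>_\<theta>[OF less.prems] E_root by simp
    next
      case (Some k)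
      with par[OF less.prems Some] less have "\<delta> 0 (E k) = mero_const (\<mu> k) * E k" by simp
      then have "\<delta> 0 (E j) = \<delta> 0 (\<theta> j) * E k + \<theta> j * (mero_const (\<mu> k) * E k)"
        unfolding E_child[OF less.prems Some] by (simp add: mero_derivation_mult[OF \<delta>_at_0])
      also have "\<dots> = mero_const (\<mu> j) * E j"
        unfolding \<delta>_\<theta>[OF less.prems] E_child[OF less.prems Some]
        using Some by (simp add: mero_const_diff algebra_simps)
      finally show ?thesis .
    qed
  qed
  have krylov_const: "krylov par (\<lambda>j. mero_const (\<mu> j) :: 'v mero) l j = mero_const (krylov par \<mu> l j)" for l j
    by (induction l arbitrary: j)
       (simp_all add: mero_const_add mero_const_mult split: option.split)
  have x_at_0: "j < N \<Longrightarrow> x l j 0 = E j * mero_const (krylov par \<mu> l j)" for l j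
  proof (induction l arbitrary: j)
    case 0
    then show ?case by (simp add: x_0_at_0 E_root)
  next
    case (Suc l)
    have "(\<Sum>i<N. Q j i 0 * x l i 0) = (\<Sum>i<N. if par j = Some i then \<theta> j * x l i 0 else 0)"
      using Suc.prems by (intro sum.cong) (auto simp: Q_at_0)
    also have "\<dots> = (case par j of None \<Rightarrow> 0 | Some k \<Rightarrow> \<theta> j * x l k 0)"
      using par[OF Suc.prems] by (auto split: option.split)
    also have "\<dots> = E j * mero_const (case par j of None \<Rightarrow> 0 | Some k \<Rightarrow> krylov par \<mu> l k)"
      using par[OF Suc.prems] Suc.IH E_child[OF Suc.prems] by (auto split: option.split)
    finally show ?case
      using Suc by (simp add: x_Suc mero_derivation_mult[OF \<delta>_at_0] mero_derivation_const[OF \<delta>_at_0]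
          \<delta>_E mero_const_add mero_const_mult algebra_simps)
  qed
  define A where "A = mat N N (\<lambda>(l, j). x l j 0)"
  have A: "A \<in> carrier_mat N N" by (simp add: A_def)
  \<comment> \<open>A kernel vector of the transpose is a relation among the rows, summed over l, as
    \<open>krylov_independent\<close> requires.\<close>
  have "det (transpose_mat A) \<noteq> 0"
  proof
    assume "det (transpose_mat A) = 0"
    then obtain v where v: "v \<in> carrier_vec N" "v \<noteq> 0\<^sub>v N" "transpose_mat A *\<^sub>v v = 0\<^sub>v N"
      using det_0_iff_vec_prod_zero_field[of "transpose_mat A" N] A by auto
    have "vec_index v l = 0" if "l < N" for l
    proof (rule krylov_independent[OF par _ _ that])
      show "inj_on (\<lambda>j. mero_const (\<mu> j) :: 'v mero) {..<N}"
        using inj by (auto simp: inj_on_def)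
      fix j assume j: "j < N"
      have "0 = vec_index (transpose_mat A *\<^sub>v v) j" using v j by simp
      also have "\<dots> = scalar_prod (col A j) v" using v(1) j A by simp
      also have "\<dots> = (\<Sum>l<N. x l j 0 * vec_index v l)"
        using v(1) j by (auto simp: scalar_prod_def A_def atLeast0LessThan intro!: sum.cong)
      also have "\<dots> = E j * (\<Sum>l<N. vec_index v l * krylov par (\<lambda>j. mero_const (\<mu> j)) l j)"
        using j by (simp add: x_at_0 krylov_const sum_distrib_left mult_ac)
      finally show "(\<Sum>l<N. vec_index v l * krylov par (\<lambda>j. mero_const (\<mu> j)) l j) = 0"
        using E_nonzero[OF j] by simp
    qed auto
    with v show False by auto
  qed
  then show "det (mat N N (\<lambda>(l, j). x l j 0)) \<noteq> 0"
    using det_transpose[OF A] by (simp add: A_def)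
qed

section \<open>Time derivatives\<close>

definition input_deriv :: "nat \<Rightarrow> sysvar mero \<Rightarrow> sysvar mero" where
  "input_deriv M \<phi> = (\<Sum>j<M. \<Sum>k | mero_partial (Input j k) \<phi> \<noteq> 0.
     mero_partial (Input j k) \<phi> * mero_coord (Input j (Suc k)))"

text \<open>\<tau> is the action on the inputs. It is a parameter because observability uses
  \<open>input_deriv\<close> and accessibility uses \<open>input_clock\<close>.\<close>

definition flow ::
  "nat \<Rightarrow> (nat \<Rightarrow> sysvar mero) \<Rightarrow> (sysvar mero \<Rightarrow> sysvar mero) \<Rightarrow> sysvar mero \<Rightarrow> sysvar mero" where
  "flow N f \<tau> \<phi> = (\<Sum>i<N. mero_partial (State i) \<phi> * f i) + \<tau> \<phi>"

lemma time_deriv_eq_flow: "time_deriv N M f = flow N f (input_deriv M)"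
  by (simp add: fun_eq_iff time_deriv_def flow_def input_deriv_def)

text \<open>The index set in \<open>input_deriv\<close> depends on its argument, which obstructs
  additivity and the product rule. For all large n, the arguments in question can be summed over one
  common range.\<close>

lemma eventually_input_deriv_eq:
  "\<forall>\<^sub>F n in sequentially. input_deriv M \<phi> =
     (\<Sum>j<M. \<Sum>k<n. mero_partial (Input j k) \<phi> * mero_coord (Input j (Suc k)))"
proof -
  \<comment> \<open>The value on \<open>State i\<close> is arbitrary; the map only has to collect
    the orders of all input derivatives that occur in \<phi>.\<close>
  define K where "K = (\<lambda>v. case v of State i \<Rightarrow> i | Input j k \<Rightarrow> k) ` {v. mero_partial v \<phi> \<noteq> 0}"
  have "finite K" unfolding K_def by (intro finite_imageI finite_mero_partial_nonzero)
  have K: "k \<in> K" if "mero_partial (Input j k) \<phi> \<noteq> 0" for j k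
    unfolding K_def using that by (intro image_eqI[of _ _ "Input j k"]) auto
  have "input_deriv M \<phi> =
     (\<Sum>j<M. \<Sum>k<n. mero_partial (Input j k) \<phi> * mero_coord (Input j (Suc k)))"
    if n: "n > Max (insert 0 K)" for n
    unfolding input_deriv_def
  proof (rule sum.cong[OF refl], rule sum.mono_neutral_left)
    show "{k. mero_partial (Input j k) \<phi> \<noteq> 0} \<subseteq> {..<n}" for j
    proof
      fix k assume "k \<in> {k. mero_partial (Input j k) \<phi> \<noteq> 0}"
      then have "k \<in> insert 0 K" using K by simp
      then have "k \<le> Max (insert 0 K)" using \<open>finite K\<close> by (intro Max_ge) auto
      with n show "k \<in> {..<n}" by simp
    qed
  qed auto
  then show ?thesis
    using eventually_gt_at_top[of "Max (insert 0 K)"] by (rule eventually_mono[rotated])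
qed

lemma input_deriv_derivation: "mero_derivation (input_deriv M)"
  unfolding mero_derivation_def
proof (intro conjI allI)
  fix \<phi> \<psi>
  have "\<forall>\<^sub>F n in sequentially. input_deriv M (\<phi> + \<psi>) = input_deriv M \<phi> + input_deriv M \<psi>"
    using eventually_input_deriv_eq[of M \<phi>] eventually_input_deriv_eq[of M \<psi>]
      eventually_input_deriv_eq[of M "\<phi> + \<psi>"]
  proof eventually_elim
    case (elim n)
    show ?case unfolding elim
      by (simp add: mero_partial_add distrib_right sum.distrib)
  qed
  then show "input_deriv M (\<phi> + \<psi>) = input_deriv M \<phi> + input_deriv M \<psi>" by simp
  have "\<forall>\<^sub>F n in sequentially. input_deriv M (\<phi> * \<psi>) = input_deriv M \<phi> * \<psi> + \<phi> * input_deriv M \<psi>"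
    using eventually_input_deriv_eq[of M \<phi>] eventually_input_deriv_eq[of M \<psi>]
      eventually_input_deriv_eq[of M "\<phi> * \<psi>"]
  proof eventually_elim
    case (elim n)
    show ?case unfolding elim
      by (simp add: mero_partial_mult sum.distrib sum_distrib_left sum_distrib_right algebra_simps)
  qed
  then show "input_deriv M (\<phi> * \<psi>) = input_deriv M \<phi> * \<psi> + \<phi> * input_deriv M \<psi>" by simp
next
  fix k show "input_deriv M (mero_const k) = 0" by (simp add: input_deriv_def)
qed

text \<open>Restricted to state variables: the partial derivative by \<open>Input j (Suc k)\<close>
  would also hit the factor \<open>mero_coord (Input j (Suc k))\<close>.\<close>

lemma input_deriv_partial_commute:
  "mero_partial (State i) (input_deriv M \<phi>) = input_deriv M (mero_partial (State i) \<phi>)"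
proof -
  have "\<forall>\<^sub>F n in sequentially.
      mero_partial (State i) (input_deriv M \<phi>) = input_deriv M (mero_partial (State i) \<phi>)"
    using eventually_input_deriv_eq[of M \<phi>] eventually_input_deriv_eq[of M "mero_partial (State i) \<phi>"]
  proof eventually_elim
    case (elim n)
    show ?case unfolding elim
      by (simp add: mero_partial_sum mero_partial_mult mero_partial_coord
          mero_partial_commute[of "State i"])
  qed
  then show ?thesis by simp
qed

lemma flow_derivation:
  assumes "mero_derivation \<tau>"
  shows "mero_derivation (flow N f \<tau>)"
  unfolding mero_derivation_def flow_def
  by (auto simp: mero_derivation_add[OF assms] mero_derivation_mult[OF assms]
      mero_derivation_const[OF assms] mero_partial_add mero_partial_mult
      distrib_right distrib_left sum.distrib sum_distrib_left sum_distrib_right mult_ac)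

text \<open>This is the variational equation; the extra sum is the transposed Jacobian of
  \<open>f\<close> applied to the gradient. It yields both the recursion for the gradients of output
  derivatives and the bracket terms.\<close>

lemma flow_partial_commute:
  assumes "mero_derivation \<tau>"
    and "\<And>\<phi>. mero_partial (State j) (\<tau> \<phi>) = \<tau> (mero_partial (State j) \<phi>)"
  shows "mero_partial (State j) (flow N f \<tau> \<phi>) =
    flow N f \<tau> (mero_partial (State j) \<phi>) + (\<Sum>i<N. mero_partial (State j) (f i) * mero_partial (State i) \<phi>)"
  unfolding flow_def
  by (simp add: mero_partial_add mero_partial_sum mero_partial_mult assms(2) sum.distrib
      mero_partial_commute[of "State j"] mult_ac)

lemmas time_deriv_derivation = flow_derivation[OF input_deriv_derivation, folded time_deriv_eq_flow]
  and time_deriv_partial_commute =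
    flow_partial_commute[OF input_deriv_derivation input_deriv_partial_commute, folded time_deriv_eq_flow]

lemma mero_in_time_deriv:
  assumes f: "\<And>i. i < N \<Longrightarrow> f i \<in> mero_field N M" and \<phi>: "\<phi> \<in> mero_field N M"
  shows "time_deriv N M f \<phi> \<in> mero_field N M"
  using f \<phi> unfolding time_deriv_def mero_field_def
  by (intro mero_in_add mero_in_sum mero_in_mult mero_in_partial mero_in_coord)
     (auto simp: all_vars_def)

lemma meromorphic_pair_mero_field:
  assumes "meromorphic_pair N M P f h"
  shows "i < N \<Longrightarrow> f i \<in> mero_field N M" "i < P \<Longrightarrow> h i \<in> mero_field N M"
  using assms unfolding meromorphic_pair_def mero_field_def
  by (auto intro: mero_in_mono simp: all_vars_def input_vars_def)


section \<open>Necessity of the path conditions\<close>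

text \<open>Functions of the states in \<open>H\<close> alone are preserved by the time derivative:
  the \<open>f j\<close> with \<open>j\<close> outside \<open>H\<close> enter with coefficient
  0.\<close>

lemma autonomous_coordinate:
  assumes fh: "meromorphic_pair N M P f h" and i: "i \<in> H" and H: "H \<subseteq> {..<N}"
    and state: "\<And>j k. j \<in> H \<Longrightarrow> k < N \<Longrightarrow> k \<notin> H \<Longrightarrow> mero_partial (State k) (f j) = 0"
    and inp: "\<And>j k. j \<in> H \<Longrightarrow> k < M \<Longrightarrow> mero_partial (Input k 0) (f j) = 0"
  shows "autonomous_element N M f (mero_coord (State i))"
proof -
  \<comment> \<open>Dependence on \<open>H\<close> is expressed by vanishing partial derivatives, so
    that closure under the time derivative follows from the product rule and commuting
    partials.\<close>
  define C where "C = {\<phi>. \<forall>v. v \<notin> State ` H \<longrightarrow> mero_partial v \<phi> = 0}"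
  have f: "f j \<in> C" if "j \<in> H" for j
  proof -
    have "mero_partial v (f j) = 0" if v: "v \<notin> State ` H" for v
    proof (cases "v \<in> state_vars N \<union> input_vars M")
      case True
      then show ?thesis using v state inp \<open>j \<in> H\<close> by (auto simp: state_vars_def input_vars_def)
    next
      case False
      moreover have "f j \<in> mero_in (state_vars N \<union> input_vars M)"
        using fh H \<open>j \<in> H\<close> by (auto simp: meromorphic_pair_def)
      ultimately show ?thesis by (intro mero_partial_outside)
    qed
    then show ?thesis by (simp add: C_def)
  qed
  have C_time_deriv: "time_deriv N M f \<phi> \<in> C" if \<phi>: "\<phi> \<in> C" for \<phi>
  proof -
    have "mero_partial (Input j k) \<phi> = 0" for j k using \<phi> by (auto simp: C_def)
    then have "time_deriv N M f \<phi> = (\<Sum>j<N. mero_partial (State j) \<phi> * f j)"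
      by (simp add: time_deriv_def)
    moreover have "mero_partial v (mero_partial (State j) \<phi> * f j) = 0" if v: "v \<notin> State ` H" for v j
    proof -
      have "mero_partial v (mero_partial (State j) \<phi>) = 0"
        using \<phi> v by (subst mero_partial_commute) (simp add: C_def)
      moreover have "mero_partial (State j) \<phi> = 0 \<or> mero_partial v (f j) = 0"
        using f[of j] \<phi> v by (cases "j \<in> H") (auto simp: C_def)
      ultimately show ?thesis by (auto simp: mero_partial_mult)
    qed
    ultimately show ?thesis by (simp add: C_def mero_partial_sum)
  qed
  have "mero_coord (State i) \<in> C"
    using i by (auto simp: C_def mero_partial_coord)
  then have "(time_deriv N M f ^^ k) (mero_coord (State i)) \<in> C" for k
    by (induction k) (auto intro: C_time_deriv)
  then have "mero_partial (Input j 0) ((time_deriv N M f ^^ k) (mero_coord (State i))) = 0" for j k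
    by (auto simp: C_def)
  moreover have "mero_coord (State i) \<in> mero_in (state_vars N)"
    using i H by (intro mero_in_coord) (auto simp: state_vars_def)
  ultimately show ?thesis
    by (simp add: autonomous_element_def mero_coord_not_const)
qed

lemma form_span_zero_coefficient:
  assumes "\<omega> \<in> form_span N M \<Omega>" "\<And>\<omega>. \<omega> \<in> \<Omega> \<Longrightarrow> \<omega> v = 0"
  shows "\<omega> v = 0"
proof -
  obtain T c where T: "\<omega> = (\<lambda>v. \<Sum>\<omega>\<in>T. c \<omega> * \<omega> v)" "T \<subseteq> \<Omega>"
    using assms(1) unfolding form_span_def by blast
  have "c \<omega> * \<omega> v = 0" if "\<omega> \<in> T" for \<omega>
    using T(2) that assms(2) by auto
  then show ?thesis unfolding T(1) by (rule sum.neutral[OF ballI])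
qed

text \<open>Gradients of output derivatives stay zero in the directions of \<open>H\<close>: in each
  term of the variational equation either the state \<open>m\<close> lies in \<open>H\<close>, where
  induction applies, or \<open>f m\<close> does not depend on the state in \<open>H\<close>. Hence
  no form in the span has a component along the differential of state \<open>i\<close>.\<close>

lemma hidden_coordinate:
  assumes i: "i \<in> H" and H: "H \<subseteq> {..<N}"
    and f: "\<And>j k. j \<in> H \<Longrightarrow> k < N \<Longrightarrow> k \<notin> H \<Longrightarrow> mero_partial (State j) (f k) = 0"
    and h: "\<And>j k. j \<in> H \<Longrightarrow> k < P \<Longrightarrow> mero_partial (State j) (h k) = 0"
  shows "hidden_element N M P f h (mero_coord (State i))"
proof -
  have y: "mero_partial (State j) ((time_deriv N M f ^^ l) (h k)) = 0" if "j \<in> H" "k < P" for j k l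
    using that
  proof (induction l arbitrary: j)
    case (Suc l)
    have "mero_partial (State j) (f m) * mero_partial (State m) ((time_deriv N M f ^^ l) (h k)) = 0"
      if "m < N" for m
    proof (cases "m \<in> H")
      case True
      then show ?thesis using Suc.IH Suc.prems by simp
    next
      case False
      then show ?thesis using f Suc.prems that by simp
    qed
    then have "(\<Sum>m<N. mero_partial (State j) (f m) *
        mero_partial (State m) ((time_deriv N M f ^^ l) (h k))) = 0"
      by (intro sum.neutral) blast
    with Suc show ?case
      by (simp add: time_deriv_partial_commute mero_derivation_0[OF time_deriv_derivation])
  qed (simp add: h)
  have not_in_span: "differential (mero_coord (State i)) \<noteq> (\<lambda>v. \<omega> v + \<eta> v)"
    if \<omega>: "\<omega> \<in> form_span N M {differential ((time_deriv N M f ^^ l) (h i)) | i l. i < P \<and> l \<le> k}"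
      and \<eta>: "\<eta> \<in> form_span N M {differential (mero_coord (Input j l)) | j l. j < M}" for \<omega> \<eta> k
  proof
    assume "differential (mero_coord (State i)) = (\<lambda>v. \<omega> v + \<eta> v)"
    then have "mero_partial (State i) (mero_coord (State i)) = \<omega> (State i) + \<eta> (State i)"
      by (simp add: differential_def fun_eq_iff)
    moreover have "\<omega> (State i) = 0"
      using y i by (intro form_span_zero_coefficient[OF \<omega>]) (auto simp: differential_def)
    moreover have "\<eta> (State i) = 0"
      by (intro form_span_zero_coefficient[OF \<eta>]) (auto simp: differential_def mero_partial_coord)
    ultimately show False by (simp add: mero_partial_coord)
  qed
  show ?thesis
    unfolding hidden_element_def
  proof (intro conjI allI)
    show "mero_coord (State i) \<in> mero_in (state_vars N)"
      using i H by (intro mero_in_coord) (auto simp: state_vars_def)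
    fix k
    show "differential (mero_coord (State i)) \<notin> {(\<lambda>v. \<omega> v + \<eta> v) | \<omega> \<eta>.
        \<omega> \<in> form_span N M {differential ((time_deriv N M f ^^ l) (h i)) | i l. i < P \<and> l \<le> k} \<and>
        \<eta> \<in> form_span N M {differential (mero_coord (Input j l)) | j l. j < M}}"
    proof
      assume "differential (mero_coord (State i)) \<in> {(\<lambda>v. \<omega> v + \<eta> v) | \<omega> \<eta>.
        \<omega> \<in> form_span N M {differential ((time_deriv N M f ^^ l) (h i)) | i l. i < P \<and> l \<le> k} \<and>
        \<eta> \<in> form_span N M {differential (mero_coord (Input j l)) | j l. j < M}}"
      then show False
        by (elim CollectE exE conjE) (rule not_in_span[THEN notE])
    qed
  qed (rule mero_coord_not_const)
qed

section \<open>From vanishing partial derivatives to missing paths\<close>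

lemma graph_of_pair_arcs:
  "(StateNode j, StateNode i) \<in> parcs (graph_of_pair N M P f h) \<longleftrightarrow>
     i < N \<and> j < N \<and> mero_partial (State j) (f i) \<noteq> 0"
  "(InputNode j, StateNode i) \<in> parcs (graph_of_pair N M P f h) \<longleftrightarrow>
     i < N \<and> j < M \<and> mero_partial (Input j 0) (f i) \<noteq> 0"
  "(StateNode j, OutputNode i) \<in> parcs (graph_of_pair N M P f h) \<longleftrightarrow>
     i < P \<and> j < N \<and> mero_partial (State j) (h i) \<noteq> 0"
  by (auto simp: graph_of_pair_def)

lemma accessible_imp_reachable:
  assumes fh: "(f, h) \<in> pairs_with_graph N M P G" and acc: "accessible N M f" and i: "i < N"
  shows "\<exists>u\<in>input_nodes M. (u, StateNode i) \<in> (parcs G)\<^sup>*"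
proof (rule ccontr)
  assume unreachable: "\<not> ?thesis"
  define H where "H = {i. i < N \<and> (\<forall>u\<in>input_nodes M. (u, StateNode i) \<notin> (parcs G)\<^sup>*)}"
  have G: "G = graph_of_pair N M P f h" and mero: "meromorphic_pair N M P f h"
    using fh by (auto simp: pairs_with_graph_def)
  have "autonomous_element N M f (mero_coord (State i))"
  proof (rule autonomous_coordinate[OF mero, of i H])
    show "i \<in> H" "H \<subseteq> {..<N}" using i unreachable by (auto simp: H_def)
    show "mero_partial (State k) (f j) = 0" if "j \<in> H" "k < N" "k \<notin> H" for j k
    proof (rule ccontr)
      assume "\<not> ?thesis"
      then have "(StateNode k, StateNode j) \<in> parcs G"
        using that by (simp add: G graph_of_pair_arcs H_def)
      then show False using that by (auto simp: H_def dest: rtrancl_into_rtrancl)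
    qed
    show "mero_partial (Input k 0) (f j) = 0" if "j \<in> H" "k < M" for j k
    proof (rule ccontr)
      assume "\<not> ?thesis"
      then have "(InputNode k, StateNode j) \<in> parcs G"
        using that by (simp add: G graph_of_pair_arcs H_def)
      then show False using that by (auto simp: H_def input_nodes_def)
    qed
  qed
  with acc show False by (auto simp: accessible_def)
qed

lemma observable_imp_coreachable:
  assumes fh: "(f, h) \<in> pairs_with_graph N M P G" and obs: "observable N M P f h" and i: "i < N"
  shows "\<exists>y\<in>output_nodes P. (StateNode i, y) \<in> (parcs G)\<^sup>*"
proof (rule ccontr)
  assume unreachable: "\<not> ?thesis"
  define H where "H = {i. i < N \<and> (\<forall>y\<in>output_nodes P. (StateNode i, y) \<notin> (parcs G)\<^sup>*)}"
  have G: "G = graph_of_pair N M P f h"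
    using fh by (auto simp: pairs_with_graph_def)
  have "hidden_element N M P f h (mero_coord (State i))"
  proof (rule hidden_coordinate[of i H])
    show "i \<in> H" "H \<subseteq> {..<N}" using i unreachable by (auto simp: H_def)
    show "mero_partial (State j) (f k) = 0" if "j \<in> H" "k < N" "k \<notin> H" for j k
    proof (rule ccontr)
      assume "\<not> ?thesis"
      then have "(StateNode j, StateNode k) \<in> parcs G"
        using that by (simp add: G graph_of_pair_arcs H_def)
      then show False using that by (auto simp: H_def dest: converse_rtrancl_into_rtrancl)
    qed
    show "mero_partial (State j) (h k) = 0" if "j \<in> H" "k < P" for j k
    proof (rule ccontr)
      assume "\<not> ?thesis"
      then have "(StateNode j, OutputNode k) \<in> parcs G"
        using that by (simp add: G graph_of_pair_arcs H_def)
      then show False using that by (auto simp: H_def output_nodes_def)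
    qed
  qed
  with obs show False by (auto simp: observable_def)
qed

text \<open>A simple path exists as soon as a walk does, so the path conditions become statements
  about the reflexive transitive closure. The closure relative to the vertices agrees with the plain
  one because all arcs end in vertices.\<close>

lemma system_graph_apath_iff:
  assumes "system_graph N M P G" "u \<in> pverts G" "v \<in> pverts G"
  shows "(\<exists>\<pi>. pre_digraph.apath (with_proj G) u \<pi> v) \<longleftrightarrow> (u, v) \<in> (parcs G)\<^sup>*"
proof -
  have arcs: "fst e \<in> pverts G \<and> snd e \<in> pverts G" if "e \<in> parcs G" for e
    using assms(1) that unfolding system_graph_def by fastforce
  interpret pair_wf_digraph G by unfold_locales (use arcs in auto)
  have "(\<exists>\<pi>. apath u \<pi> v) \<longleftrightarrow> (u, v) \<in> rtrancl_on (pverts G) (parcs G)"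
    using reachable_apath[of u v] by (simp add: reachable_def)
  also have "\<dots> \<longleftrightarrow> (u, v) \<in> (parcs G)\<^sup>*"
  proof
    assume "(u, v) \<in> (parcs G)\<^sup>*"
    then show "(u, v) \<in> rtrancl_on (pverts G) (parcs G)"
      by (rule rtrancl_consistent_rtrancl_on) (use assms arcs in \<open>force+\<close>)
  qed (rule rtrancl_on_rtranclI)
  finally show ?thesis .
qed

text \<open>The parent of a state is its predecessor on a shortest path from \<open>S\<close>, whose
  distance is then exactly one less. \<open>R\<close> is arbitrary so that the reversed arcs can be
  used for outputs.\<close>

lemma spanning_forest:
  assumes reach: "\<And>i. i < N \<Longrightarrow> \<exists>s\<in>S. (s, StateNode i) \<in> R\<^sup>*"
    and R: "\<And>a i. i < N \<Longrightarrow> (a, StateNode i) \<in> R \<Longrightarrow> a \<in> S \<or> a \<in> state_nodes N"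
    and S: "S \<inter> state_nodes N = {}"
  obtains \<pi> dep where "\<And>i. i < N \<Longrightarrow> (\<pi> i, StateNode i) \<in> R"
    "\<And>i. i < N \<Longrightarrow> \<pi> i \<in> S \<and> dep i = 1 \<or> (\<exists>k<N. \<pi> i = StateNode k \<and> dep i = Suc (dep k))"
proof -
  define dist where "dist = (\<lambda>v. LEAST n. \<exists>s\<in>S. (s, v) \<in> R ^^ n)"
  have dist_le: "dist v \<le> n" if "s \<in> S" "(s, v) \<in> R ^^ n" for s v n
    unfolding dist_def by (rule Least_le) (use that in blast)
  have dist: "\<exists>s\<in>S. (s, v) \<in> R ^^ dist v" if "s \<in> S" "(s, v) \<in> R\<^sup>*" for s v
  proof -
    from that obtain n where "(s, v) \<in> R ^^ n" by (auto simp: rtrancl_power)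
    with that(1) have "\<exists>n. \<exists>s\<in>S. (s, v) \<in> R ^^ n" by blast
    then show ?thesis unfolding dist_def by (rule LeastI_ex)
  qed
  have "\<exists>a. (a, StateNode i) \<in> R \<and>
      (a \<in> S \<and> dist (StateNode i) = 1 \<or> (\<exists>k<N. a = StateNode k \<and> dist (StateNode i) = Suc (dist (StateNode k))))" if i: "i < N" for i
  proof -
    obtain s where s: "s \<in> S" "(s, StateNode i) \<in> R ^^ dist (StateNode i)"
      using reach[OF i] dist by blast
    have "s \<noteq> StateNode i" using S s(1) i by (auto simp: state_nodes_def)
    then obtain m where m: "dist (StateNode i) = Suc m"
      using s(2) by (cases "dist (StateNode i)") simp_all
    have "(s, StateNode i) \<in> R ^^ Suc m" using s(2) unfolding m .
    then obtain a where a: "(s, a) \<in> R ^^ m" "(a, StateNode i) \<in> R"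
      by (rule relpow_Suc_E)
    have "dist a \<le> m" using dist_le[OF s(1) a(1)] .
    moreover have "m \<le> dist a"
    proof -
      have "(s, a) \<in> R\<^sup>*" using a(1) by (auto simp: rtrancl_power)
      then obtain s' where "s' \<in> S" "(s', a) \<in> R ^^ dist a" using dist s(1) by blast
      then have "dist (StateNode i) \<le> Suc (dist a)"
        using a(2) by (intro dist_le relpow_Suc_I)
      with m show ?thesis by simp
    qed
    ultimately have dist_i: "dist (StateNode i) = Suc (dist a)" using m by simp
    have "dist a = 0" if "a \<in> S" using dist_le[OF that, of a 0] by simp
    with dist_i have "a \<in> S \<Longrightarrow> dist (StateNode i) = 1" by simp
    then show ?thesis using R[OF i a(2)] a(2) dist_i unfolding state_nodes_def by blast
  qed
  then have "\<forall>i. \<exists>a. i < N \<longrightarrow> (a, StateNode i) \<in> R \<and>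
      (a \<in> S \<and> dist (StateNode i) = 1 \<or> (\<exists>k<N. a = StateNode k \<and> dist (StateNode i) = Suc (dist (StateNode k))))"
    by blast
  then obtain \<pi> where \<pi>: "\<forall>i. i < N \<longrightarrow> (\<pi> i, StateNode i) \<in> R \<and>
      (\<pi> i \<in> S \<and> dist (StateNode i) = 1 \<or> (\<exists>k<N. \<pi> i = StateNode k \<and> dist (StateNode i) = Suc (dist (StateNode k))))"
    by (rule choice[THEN exE])
  show thesis by (rule that[of \<pi> "\<lambda>i. dist (StateNode i)"]) (use \<pi> in blast)+
qed

section \<open>Rank criteria\<close>

lemma det_nonzero_iff_trivial_kernel:
  fixes A :: "nat \<Rightarrow> nat \<Rightarrow> 'a::field"
  shows "det (mat N N (\<lambda>(l, i). A l i)) \<noteq> 0 \<longleftrightarrow>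
    (\<forall>z. (\<forall>l<N. (\<Sum>i<N. A l i * z i) = 0) \<longrightarrow> (\<forall>i<N. z i = 0))"
proof -
  define B where "B = mat N N (\<lambda>(l, i). A l i)"
  have B: "B \<in> carrier_mat N N" by (simp add: B_def)
  have index: "vec_index (B *\<^sub>v v) l = (\<Sum>i<N. A l i * vec_index v i)"
    if "v \<in> carrier_vec N" "l < N" for v l
    using that by (auto simp: B_def scalar_prod_def atLeast0LessThan intro!: sum.cong)
  have "det B = 0 \<longleftrightarrow> (\<exists>z. (\<forall>l<N. (\<Sum>i<N. A l i * z i) = 0) \<and> (\<exists>i<N. z i \<noteq> 0))"
  proof
    assume "det B = 0"
    then obtain v where v: "v \<in> carrier_vec N" "v \<noteq> 0\<^sub>v N" "B *\<^sub>v v = 0\<^sub>v N"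
      using det_0_iff_vec_prod_zero_field[OF B] by blast
    have "(\<Sum>i<N. A l i * vec_index v i) = 0" if "l < N" for l
      using index[OF v(1) that] v(3) that by simp
    moreover have "\<exists>i<N. vec_index v i \<noteq> 0"
    proof (rule ccontr)
      assume "\<not> ?thesis"
      then have "v = 0\<^sub>v N" using v(1) by (intro eq_vecI) auto
      with v(2) show False by contradiction
    qed
    ultimately show "\<exists>z. (\<forall>l<N. (\<Sum>i<N. A l i * z i) = 0) \<and> (\<exists>i<N. z i \<noteq> 0)"
      by (intro exI[of _ "vec_index v"] conjI allI impI)
  next
    assume "\<exists>z. (\<forall>l<N. (\<Sum>i<N. A l i * z i) = 0) \<and> (\<exists>i<N. z i \<noteq> 0)"
    then obtain z k where z: "\<And>l. l < N \<Longrightarrow> (\<Sum>i<N. A l i * z i) = 0" and k: "k < N" "z k \<noteq> 0"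
      by blast
    define v where "v = vec N z"
    have v: "v \<in> carrier_vec N" by (simp add: v_def)
    have "vec_index v k \<noteq> vec_index (0\<^sub>v N) k" using k by (simp add: v_def)
    then have "v \<noteq> 0\<^sub>v N" by metis
    moreover have "B *\<^sub>v v = 0\<^sub>v N"
    proof (rule eq_vecI)
      fix l assume l: "l < dim_vec (0\<^sub>v N :: 'a vec)"
      then have "vec_index (B *\<^sub>v v) l = (\<Sum>i<N. A l i * z i)"
        using index[OF v, of l] by (simp add: v_def)
      with l z show "vec_index (B *\<^sub>v v) l = vec_index (0\<^sub>v N) l" by simp
    qed (simp add: B_def)
    ultimately show "det B = 0"
      using det_0_iff_vec_prod_zero_field[OF B] v by blast
  qed
  then show ?thesis unfolding B_def by blast
qed

lemma mero_in_det:
  assumes "A \<in> carrier_mat n n" "\<And>i j. i < n \<Longrightarrow> j < n \<Longrightarrow> A $$ (i, j) \<in> mero_in V"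
  shows "det A \<in> mero_in V"
proof -
  have sign: "signof p \<in> mero_in V" for p
    by (cases p rule: sign_cases) (auto intro: mero_in_uminus)
  show ?thesis
    unfolding det_def'[OF assms(1)]
    by (intro mero_in_sum mero_in_mult sign mero_in_prod assms(2))
       (auto simp: permutes_in_image)
qed

text \<open>Coefficients in \<open>form_span\<close> must lie in \<open>mero_field N M\<close>, so
  solvability over all meromorphic functions is not enough. Cramer's rule, through the adjugate,
  expresses the solution by field operations in the entries.\<close>

lemma mero_in_linear_solution:
  assumes det: "det (mat N N (\<lambda>(l, j). A l j)) \<noteq> 0"
    and A: "\<And>l j. l < N \<Longrightarrow> j < N \<Longrightarrow> A l j \<in> mero_in V"
    and b: "\<And>j. j < N \<Longrightarrow> b j \<in> mero_in V"
  obtains c where "\<And>l. l < N \<Longrightarrow> c l \<in> mero_in V" "\<And>j. j < N \<Longrightarrow> (\<Sum>l<N. c l * A l j) = b j"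
proof -
  define B where "B = mat N N (\<lambda>(l, j). A l j)"
  have B: "B \<in> carrier_mat N N" by (simp add: B_def)
  have dims: "dim_row B = N" "dim_col B = N" using B by auto
  have B_in: "B $$ (i, j) \<in> mero_in V" if "i < N" "j < N" for i j
    using A that by (simp add: B_def)
  define K where "K = (\<lambda>j l. adj_mat B $$ (j, l))"
  have K_in: "K j l \<in> mero_in V" if "j < N" "l < N" for j l
  proof -
    have "mat_delete B l j $$ (i', j') \<in> mero_in V" if "i' < N - 1" "j' < N - 1" for i' j'
      using that by (auto simp: mat_delete_def dims intro!: B_in)
    then have "det (mat_delete B l j) \<in> mero_in V"
      by (intro mero_in_det[of _ "N - 1"]) (auto simp: dims)
    moreover have "(- 1) ^ n \<in> mero_in V" for n
      by (cases "even n") (auto intro: mero_in_uminus)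
    ultimately show ?thesis
      using that by (simp add: K_def adj_mat_def dims cofactor_def mero_in_mult)
  qed
  have KB: "(\<Sum>l<N. K j l * A l i) = (if j = i then det B else 0)" if "j < N" "i < N" for j i
  proof -
    have "(adj_mat B * B) $$ (j, i) = (det B \<cdot>\<^sub>m 1\<^sub>m N) $$ (j, i)"
      using adj_mat(3)[OF B] by simp
    moreover have "(adj_mat B * B) $$ (j, i) = (\<Sum>l<N. K j l * A l i)"
      using that by (auto simp: K_def adj_mat_def dims scalar_prod_def B_def atLeast0LessThan intro!: sum.cong)
    ultimately show ?thesis using that by simp
  qed
  have det_B: "det B \<noteq> 0" using det by (simp add: B_def)
  show thesis
  proof (rule that[of "\<lambda>l. (\<Sum>j<N. b j * K j l) / det B"])
    show "(\<Sum>j<N. b j * K j l) / det B \<in> mero_in V" if "l < N" for l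
      using that by (intro mero_in_divide mero_in_sum mero_in_mult b K_in mero_in_det[OF B] B_in) auto
    fix i assume i: "i < N"
    have "(\<Sum>l<N. (\<Sum>j<N. b j * K j l) / det B * A l i) = (\<Sum>l<N. \<Sum>j<N. b j * K j l * A l i) / det B"
      by (simp add: sum_distrib_right sum_divide_distrib)
    also have "(\<Sum>l<N. \<Sum>j<N. b j * K j l * A l i) = (\<Sum>j<N. b j * (\<Sum>l<N. K j l * A l i))"
      by (subst sum.swap) (simp add: sum_distrib_left mult.assoc)
    also have "\<dots> = (\<Sum>j<N. if j = i then b j * det B else 0)"
      using i by (intro sum.cong) (auto simp: KB)
    also have "\<dots> = b i * det B" using i by simp
    finally show "(\<Sum>l<N. (\<Sum>j<N. b j * K j l) / det B * A l i) = b i"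
      using det_B by simp
  qed
qed

text \<open>\<open>form_span\<close> sums over a set of forms, while an indexed family may repeat a
  form; the coefficients of equal forms are added up.\<close>

lemma form_span_sumI:
  assumes "finite A" "\<And>a. a \<in> A \<Longrightarrow> F a \<in> \<Omega>" "\<And>a. a \<in> A \<Longrightarrow> c a \<in> mero_field N M"
  shows "(\<lambda>v. \<Sum>a\<in>A. c a * F a v) \<in> form_span N M \<Omega>"
proof -
  define c' where "c' = (\<lambda>\<omega>. \<Sum>a | a \<in> A \<and> F a = \<omega>. c a)"
  have "(\<Sum>a\<in>A. c a * F a v) = (\<Sum>\<omega>\<in>F ` A. c' \<omega> * \<omega> v)" for v
  proof -
    have "(\<Sum>a\<in>A. c a * F a v) = (\<Sum>\<omega>\<in>F ` A. \<Sum>a | a \<in> A \<and> F a = \<omega>. c a * F a v)"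
      by (rule sum.image_gen[OF assms(1)])
    also have "\<dots> = (\<Sum>\<omega>\<in>F ` A. c' \<omega> * \<omega> v)"
      unfolding c'_def sum_distrib_right by (intro sum.cong refl) auto
    finally show ?thesis .
  qed
  moreover have "c' \<omega> \<in> mero_field N M" for \<omega>
    unfolding c'_def mero_field_def using assms(3) by (intro mero_in_sum) (auto simp: mero_field_def)
  ultimately show ?thesis
    unfolding form_span_def using assms(1,2)
    by (intro CollectI exI[of _ "F ` A"] exI[of _ c'] conjI ext) auto
qed

text \<open>The derivatives of order below N of the single function y_1 + ... + y_P suffice to match
  the state part of the differential of \<zeta>. The discrepancy lies in input directions and is
  absorbed by the input forms.\<close>

lemma observable_if_nonsingular:
  assumes fh: "meromorphic_pair N M P f h"
    and det: "det (mat N N (\<lambda>(l, j). mero_partial (State j) (\<Sum>i<P. (time_deriv N M f ^^ l) (h i)))) \<noteq> 0"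
  shows "observable N M P f h"
  unfolding observable_def
proof
  assume "\<exists>\<zeta>. hidden_element N M P f h \<zeta>"
  then obtain \<zeta> where \<zeta>: "\<zeta> \<in> mero_in (state_vars N)"
    and hidden: "\<And>k. differential \<zeta> \<notin> {(\<lambda>v. \<omega> v + \<eta> v) | \<omega> \<eta>.
        \<omega> \<in> form_span N M {differential ((time_deriv N M f ^^ l) (h i)) | i l. i < P \<and> l \<le> k} \<and>
        \<eta> \<in> form_span N M {differential (mero_coord (Input j l)) | j l. j < M}}"
    unfolding hidden_element_def by blast
  have \<zeta>_field: "\<zeta> \<in> mero_in (all_vars N M)"
    using \<zeta> by (rule mero_in_mono) (auto simp: all_vars_def)
  define Y where "Y = (\<lambda>l i. (time_deriv N M f ^^ l) (h i))"
  have Y: "Y l i \<in> mero_in (all_vars N M)" if "i < P" for l i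
    unfolding Y_def
    by (induction l)
       (use meromorphic_pair_mero_field[OF fh] that in \<open>auto simp flip: mero_field_def intro: mero_in_time_deriv\<close>)
  obtain c where c: "\<And>l. l < N \<Longrightarrow> c l \<in> mero_in (all_vars N M)"
    "\<And>j. j < N \<Longrightarrow> (\<Sum>l<N. c l * mero_partial (State j) (\<Sum>i<P. Y l i)) = mero_partial (State j) \<zeta>"
  proof (rule mero_in_linear_solution[where b = "\<lambda>j. mero_partial (State j) \<zeta>"])
    show "det (mat N N (\<lambda>(l, j). mero_partial (State j) (\<Sum>i<P. Y l i))) \<noteq> 0"
      using det by (simp add: Y_def)
  qed (auto intro!: mero_in_partial mero_in_sum Y \<zeta>_field)
  define \<omega> where "\<omega> = (\<lambda>v. \<Sum>a\<in>{..<N} \<times> {..<P}. c (fst a) * differential (Y (fst a) (snd a)) v)"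
  have \<omega>: "\<omega> \<in> form_span N M {differential ((time_deriv N M f ^^ l) (h i)) | i l. i < P \<and> l \<le> N}"
    unfolding \<omega>_def
  proof (rule form_span_sumI)
    show "differential (Y (fst a) (snd a)) \<in>
        {differential ((time_deriv N M f ^^ l) (h i)) | i l. i < P \<and> l \<le> N}"
      if "a \<in> {..<N} \<times> {..<P}" for a
      unfolding Y_def using that by (intro CollectI exI[of _ "snd a"] exI[of _ "fst a"]) auto
  qed (use c(1) in \<open>auto simp: mero_field_def\<close>)
  have \<omega>_State: "\<omega> (State j) = mero_partial (State j) \<zeta>" if "j < N" for j
    using c(2)[OF that]
    by (simp add: \<omega>_def differential_def sum.cartesian_product' mero_partial_sum sum_distrib_left)
  have \<omega>_in: "\<omega> v \<in> mero_in (all_vars N M)" for v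
    unfolding \<omega>_def differential_def
    by (intro mero_in_sum mero_in_mult mero_in_partial) (auto intro: c Y)
  have \<omega>_outside: "\<omega> v = 0" if "v \<notin> all_vars N M" for v
    unfolding \<omega>_def differential_def
    using that Y by (intro sum.neutral) (auto simp: mero_partial_outside[of _ "all_vars N M"])
  have \<omega>_finite: "finite {v. \<omega> v \<noteq> 0}"
  proof (rule finite_subset)
    show "{v. \<omega> v \<noteq> 0} \<subseteq> (\<Union>a\<in>{..<N} \<times> {..<P}. {v. mero_partial v (Y (fst a) (snd a)) \<noteq> 0})"
      unfolding \<omega>_def differential_def by (auto elim!: sum.not_neutral_contains_not_neutral)
    show "finite (\<Union>a\<in>{..<N} \<times> {..<P}. {v. mero_partial v (Y (fst a) (snd a)) \<noteq> 0})"
      by (intro finite_UN_I) (auto simp: finite_mero_partial_nonzero)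
  qed
  \<comment> \<open>Only finitely many input directions occur in \<omega>. The form \<eta> cancels
    them, since \<zeta> depends on states only.\<close>
  define B where "B = {a. fst a < M \<and> \<omega> (Input (fst a) (snd a)) \<noteq> 0}"
  define \<eta> where "\<eta> = (\<lambda>v. \<Sum>a\<in>B. - \<omega> (Input (fst a) (snd a)) *
      differential (mero_coord (Input (fst a) (snd a))) v)"
  have finite_B: "finite B"
  proof (rule finite_subset)
    show "B \<subseteq> (\<lambda>a. Input (fst a) (snd a)) -` {v. \<omega> v \<noteq> 0}" by (auto simp: B_def)
    show "finite ((\<lambda>a. Input (fst a) (snd a)) -` {v. \<omega> v \<noteq> 0})"
      by (rule finite_vimageI[OF \<omega>_finite]) (auto simp: inj_def)
  qed
  have \<eta>: "\<eta> \<in> form_span N M {differential (mero_coord (Input j l)) | j l. j < M}"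
    unfolding \<eta>_def
    by (rule form_span_sumI[OF finite_B])
       (auto simp: B_def mero_field_def intro: mero_in_uminus \<omega>_in)
  have \<eta>_Input: "\<eta> (Input j l) = - \<omega> (Input j l)" if j: "j < M" for j l
  proof -
    have "\<eta> (Input j l) = (\<Sum>a\<in>B. if a = (j, l) then - \<omega> (Input j l) else 0)"
      unfolding \<eta>_def differential_def by (intro sum.cong refl) (auto simp: mero_partial_coord)
    also have "\<dots> = - \<omega> (Input j l)"
      using finite_B j by (auto simp: B_def)
    finally show ?thesis .
  qed
  have \<eta>_other: "\<eta> v = 0" if "\<And>j l. j < M \<Longrightarrow> v \<noteq> Input j l" for v
    unfolding \<eta>_def differential_def using that
    by (intro sum.neutral) (auto simp: mero_partial_coord B_def)
  have \<zeta>_outside: "mero_partial v \<zeta> = 0" if "v \<notin> state_vars N" for v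
    using \<zeta> that by (rule mero_partial_outside)
  have "differential \<zeta> v = \<omega> v + \<eta> v" for v
  proof (cases v)
    case (State j)
    show ?thesis
    proof (cases "j < N")
      case False
      then have "v \<notin> all_vars N M" "v \<notin> state_vars N"
        using State by (auto simp: all_vars_def state_vars_def)
      then show ?thesis
        using State by (simp add: differential_def \<omega>_outside \<zeta>_outside \<eta>_other)
    qed (use State in \<open>simp add: differential_def \<omega>_State \<eta>_other\<close>)
  next
    case (Input j l)
    then have "mero_partial v \<zeta> = 0" by (intro \<zeta>_outside) (auto simp: state_vars_def)
    moreover have "\<omega> v + \<eta> v = 0"
    proof (cases "j < M")
      case True
      then show ?thesis using Input by (simp add: \<eta>_Input)
    next
      case False
      then have "v \<notin> all_vars N M" using Input by (auto simp: all_vars_def state_vars_def)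
      then show ?thesis using False Input by (simp add: \<omega>_outside \<eta>_other)
    qed
    ultimately show ?thesis by (simp add: differential_def)
  qed
  then have "differential \<zeta> = (\<lambda>v. \<omega> v + \<eta> v)" by (rule ext)
  with hidden[of N] \<omega> \<eta> show False by blast
qed

text \<open>Under unit-speed inputs exp (\<alpha> u) is an eigenfunction with eigenvalue \<alpha>,
  as exponentials of states are under the drift; \<open>input_deriv\<close> would produce the
  non-constant factor \<alpha> u' instead.\<close>

definition input_clock :: "nat \<Rightarrow> sysvar mero \<Rightarrow> sysvar mero" where
  "input_clock M \<phi> = (\<Sum>j<M. mero_partial (Input j 0) \<phi>)"

lemma input_clock_derivation: "mero_derivation (input_clock M)"
  unfolding mero_derivation_def input_clock_def
  by (simp add: mero_partial_add mero_partial_mult sum.distrib sum_distrib_left sum_distrib_right)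

lemma input_clock_partial_commute:
  "mero_partial (State i) (input_clock M \<phi>) = input_clock M (mero_partial (State i) \<phi>)"
  by (simp add: input_clock_def mero_partial_sum mero_partial_commute[of "State i"])

text \<open>Since the iterated derivatives of an autonomous element do not involve the inputs, the time
  derivative may be replaced by the one along constant-speed inputs, \<open>flow N f (input_clock M)\<close>.
  The rows of the matrix are the iterated Lie brackets of this field with the derivative
  of \<open>f\<close> along the inputs; all of them annihilate an autonomous element.\<close>
lemma accessible_if_nonsingular:
  assumes f: "\<And>i. i < N \<Longrightarrow> f i \<in> mero_in (state_vars N \<union> input_vars M)"
    and W_0: "\<And>i. i < N \<Longrightarrow> W 0 i = input_clock M (f i)"
    and W_Suc: "\<And>l i. i < N \<Longrightarrow> W (Suc l) i =
      flow N f (input_clock M) (W l i) - (\<Sum>m<N. mero_partial (State m) (f i) * W l m)"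
    and det: "det (mat N N (\<lambda>(l, i). W l i)) \<noteq> 0"
  shows "accessible N M f"
  unfolding accessible_def
proof
  let ?\<delta> = "flow N f (input_clock M)"
  have \<delta>: "mero_derivation ?\<delta>" by (rule flow_derivation[OF input_clock_derivation])
  assume "\<exists>\<xi>. autonomous_element N M f \<xi>"
  then obtain \<xi> where \<xi>: "\<xi> \<in> mero_in (state_vars N)" "\<xi> \<notin> range mero_const"
    and aut: "\<And>k j. j < M \<Longrightarrow> mero_partial (Input j 0) ((time_deriv N M f ^^ k) \<xi>) = 0"
    unfolding autonomous_element_def by blast
  define X where "X = (\<lambda>k. (time_deriv N M f ^^ k) \<xi>)"
  have X_Suc: "X (Suc k) = time_deriv N M f (X k)" for k by (simp add: X_def)
  \<comment> \<open>Autonomy excludes the inputs themselves from each derivative, and without them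
    the next time derivative cannot create an input derivative of higher order.\<close>
  have X: "X k \<in> mero_in (state_vars N \<union> input_vars M) \<and>
      (\<forall>v. v \<notin> state_vars N \<longrightarrow> mero_partial v (X k) = 0)" for k
  proof (induction k)
    case 0
    show ?case using \<xi>(1) by (auto simp: X_def intro: mero_in_mono mero_partial_outside)
  next
    case (Suc k)
    then have "mero_partial (Input j l) (X k) = 0" for j l
      by (auto simp: state_vars_def)
    then have "X (Suc k) = (\<Sum>i<N. mero_partial (State i) (X k) * f i)"
      by (simp add: X_Suc time_deriv_def)
    then have in_field: "X (Suc k) \<in> mero_in (state_vars N \<union> input_vars M)"
      using Suc f by (auto intro!: mero_in_sum mero_in_mult mero_in_partial)
    moreover have "mero_partial v (X (Suc k)) = 0" if v: "v \<notin> state_vars N" for v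
    proof (cases "v \<in> input_vars M")
      case True
      then show ?thesis using aut[of _ "Suc k"] by (auto simp: input_vars_def X_def)
    next
      case False
      with v show ?thesis by (intro mero_partial_outside[OF in_field]) auto
    qed
    ultimately show ?case by blast
  qed
  have X_Input: "mero_partial (Input j l) (X k) = 0" for j l k
    using X[of k] by (auto simp: state_vars_def)
  have \<delta>_X: "?\<delta> (X k) = X (Suc k)" for k
    by (simp add: X_Suc flow_def time_deriv_def input_clock_def X_Input)
  have annihilate: "(\<Sum>i<N. W l i * mero_partial (State i) (X k)) = 0" for l k
  proof (induction l arbitrary: k)
    case 0
    have "0 = input_clock M (X (Suc k))"
      by (simp add: input_clock_def X_Input)
    also have "X (Suc k) = (\<Sum>i<N. mero_partial (State i) (X k) * f i)"
      by (simp add: X_Suc time_deriv_def X_Input)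
    also have "input_clock M \<dots> = (\<Sum>i<N. mero_partial (State i) (X k) * input_clock M (f i))"
    proof -
      have "input_clock M (X k) = 0" by (simp add: input_clock_def X_Input)
      then have "input_clock M (mero_partial (State i) (X k)) = 0" for i
        using input_clock_partial_commute[where i = i and M = M and \<phi> = "X k"] by simp
      then show ?thesis
        by (simp add: mero_derivation_sum[OF input_clock_derivation]
            mero_derivation_mult[OF input_clock_derivation])
    qed
    finally show ?case by (simp add: W_0 mult.commute)
  next
    case (Suc l)
    have bracket: "?\<delta> (mero_partial (State i) (X k)) =
        mero_partial (State i) (X (Suc k)) - (\<Sum>m<N. mero_partial (State i) (f m) * mero_partial (State m) (X k))" for i
      using flow_partial_commute[OF input_clock_derivation[of M] input_clock_partial_commute, where j = i and N = N and f = f and \<phi> = "X k"]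
      by (simp add: \<delta>_X)
    \<comment> \<open>The identity for l is differentiated. The terms with \<open>X (Suc k)\<close>
      vanish by the induction hypothesis at \<open>Suc k\<close>, which is why k stays arbitrary;
      what remains is the identity for \<open>Suc l\<close>.\<close>
    have "0 = ?\<delta> (\<Sum>i<N. W l i * mero_partial (State i) (X k))"
      by (simp add: Suc.IH mero_derivation_0[OF \<delta>])
    also have "\<dots> = (\<Sum>i<N. ?\<delta> (W l i) * mero_partial (State i) (X k)) +
        (\<Sum>i<N. W l i * ?\<delta> (mero_partial (State i) (X k)))"
      by (simp add: mero_derivation_sum[OF \<delta>] mero_derivation_mult[OF \<delta>] sum.distrib)
    also have "(\<Sum>i<N. W l i * ?\<delta> (mero_partial (State i) (X k))) =
        - (\<Sum>i<N. \<Sum>m<N. W l i * (mero_partial (State i) (f m) * mero_partial (State m) (X k)))"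
      using Suc.IH[of "Suc k"]
      by (simp add: bracket right_diff_distrib sum_subtractf sum_distrib_left)
    also have "(\<Sum>i<N. \<Sum>m<N. W l i * (mero_partial (State i) (f m) * mero_partial (State m) (X k))) =
        (\<Sum>i<N. (\<Sum>m<N. mero_partial (State m) (f i) * W l m) * mero_partial (State i) (X k))"
      by (subst sum.swap) (simp add: sum_distrib_left sum_distrib_right mult_ac)
    finally show ?case
      by (simp add: W_Suc left_diff_distrib sum_subtractf)
  qed
  have "mero_partial (State i) \<xi> = 0" if "i < N" for i
    using det[unfolded det_nonzero_iff_trivial_kernel, rule_format, where z = "\<lambda>i. mero_partial (State i) \<xi>"]
      annihilate[of _ 0] that by (simp add: X_def)
  moreover have "mero_partial v \<xi> = 0" if "v \<notin> state_vars N" for v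
    using \<xi>(1) that by (rule mero_partial_outside)
  ultimately have "mero_partial v \<xi> = 0" for v
    by (cases "v \<in> state_vars N") (auto simp: state_vars_def)
  with mero_const_if_partials_0 \<xi>(2) show False by blast
qed

section \<open>Forests and perturbed exponential systems\<close>

definition parent_state :: "(nat \<Rightarrow> node) \<Rightarrow> nat \<Rightarrow> nat option" where
  "parent_state \<pi> i = (case \<pi> i of StateNode k \<Rightarrow> Some k | _ \<Rightarrow> None)"

text \<open>The exponents are chosen such that their sums along the paths to the roots are the distinct
  numbers \<open>1, 2, \<dots>, N\<close>.\<close>
definition branch_exponent :: "(nat \<Rightarrow> node) \<Rightarrow> nat \<Rightarrow> real" where
  "branch_exponent \<pi> i =
     (case parent_state \<pi> i of None \<Rightarrow> real (Suc i) | Some k \<Rightarrow> real (Suc i) - real (Suc k))"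

text \<open>Row \<open>i\<close> is rescaled by \<open>\<epsilon> ^ dep i\<close>; the weights make the forest arcs the only ones that
  survive the rescaling in the limit \<open>\<epsilon> = 0\<close>.\<close>
definition arc_weight ::
  "node rel \<Rightarrow> (nat \<Rightarrow> node) \<Rightarrow> (nat \<Rightarrow> nat) \<Rightarrow> real \<Rightarrow> nat \<Rightarrow> node \<Rightarrow> real" where
  "arc_weight R \<pi> dep \<epsilon> i w =
     (if (w, StateNode i) \<in> R then if w = \<pi> i then \<epsilon> else \<epsilon> ^ (dep i + 1) else 0)"

text \<open>This is the weight times \<epsilon> ^ (dep k - dep i), with \<open>dep k\<close> read as
  0 at a root, written out as a polynomial so that it makes sense at \<epsilon> = 0.\<close>

definition scaled_arc_weight ::
  "node rel \<Rightarrow> (nat \<Rightarrow> node) \<Rightarrow> (nat \<Rightarrow> nat) \<Rightarrow> real \<Rightarrow> nat \<Rightarrow> node \<Rightarrow> real" where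
  "scaled_arc_weight R \<pi> dep \<epsilon> i w =
     (if (w, StateNode i) \<in> R then
        if w = \<pi> i then 1 else \<epsilon> * (case w of StateNode k \<Rightarrow> \<epsilon> ^ dep k | _ \<Rightarrow> 1)
      else 0)"

lemma arc_weight_at_0 [simp]: "arc_weight R \<pi> dep 0 i w = 0"
  by (simp add: arc_weight_def)

lemma arc_weight_eq_0_iff: "\<epsilon> \<noteq> 0 \<Longrightarrow> arc_weight R \<pi> dep \<epsilon> i w = 0 \<longleftrightarrow> (w, StateNode i) \<notin> R"
  by (simp add: arc_weight_def)

lemma poly_family_mero_const_power: "poly_family (\<lambda>\<epsilon>. mero_const (\<epsilon> ^ n))"
  unfolding mero_const_power by (intro poly_family_power poly_family_const)

lemma poly_family_arc_weight: "poly_family (\<lambda>\<epsilon>. mero_const (arc_weight R \<pi> dep \<epsilon> i w))"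
  using poly_family_mero_const_power[of 1] poly_family_mero_const_power[of "dep i + 1"]
  by (cases "(w, StateNode i) \<in> R"; cases "w = \<pi> i") (simp_all add: arc_weight_def)

lemma poly_family_scaled_arc_weight:
  "poly_family (\<lambda>\<epsilon>. mero_const (scaled_arc_weight R \<pi> dep \<epsilon> i w))"
proof -
  have "poly_family (\<lambda>\<epsilon>. mero_const (\<epsilon> * (case w of StateNode k \<Rightarrow> \<epsilon> ^ dep k | _ \<Rightarrow> 1)))"
    using poly_family_mero_const_power[of 1]
    by (cases w) (simp_all add: mero_const_mult poly_family_mult poly_family_const poly_family_mero_const_power)
  then show ?thesis
    by (cases "(w, StateNode i) \<in> R"; cases "w = \<pi> i") (simp_all add: scaled_arc_weight_def)
qed

text \<open>Covers both halves: the arcs with the inputs as \<open>S\<close>, and the reversed arcs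
  with the outputs as \<open>S\<close>. In the second case the child of a forest arc is its tail in
  the original graph.\<close>

locale rooted_forest =
  fixes N :: nat and R :: "node rel" and S :: "node set" and \<pi> :: "nat \<Rightarrow> node" and dep :: "nat \<Rightarrow> nat"
  assumes parent_arc: "\<And>i. i < N \<Longrightarrow> (\<pi> i, StateNode i) \<in> R"
    and parent: "\<And>i. i < N \<Longrightarrow>
      \<pi> i \<in> S \<and> dep i = 1 \<or> (\<exists>k<N. \<pi> i = StateNode k \<and> dep i = Suc (dep k))"
    and finite_roots: "finite S" and StateNode_not_root: "\<And>k. StateNode k \<notin> S"
begin

lemma parent_stateD:
  "i < N \<Longrightarrow> parent_state \<pi> i = Some k \<Longrightarrow> k < N \<and> dep i = Suc (dep k)"
  using parent[of i] StateNode_not_root by (auto simp: parent_state_def split: node.splits)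

lemma parent_state_Some_iff: "parent_state \<pi> i = Some k \<longleftrightarrow> StateNode k = \<pi> i"
  by (auto simp: parent_state_def split: node.splits)

lemma parent_state_None_iff: "i < N \<Longrightarrow> parent_state \<pi> i = None \<longleftrightarrow> \<pi> i \<in> S"
  using parent[of i] StateNode_not_root by (auto simp: parent_state_def split: node.splits)

lemma root_dep: "i < N \<Longrightarrow> \<pi> i \<in> S \<Longrightarrow> dep i = 1"
  using parent[of i] StateNode_not_root by auto

text \<open>A state is not its own parent, as their depths differ. The exponents occur as
  denominators of coefficients below.\<close>

lemma branch_exponent_nonzero: "i < N \<Longrightarrow> branch_exponent \<pi> i \<noteq> 0"
  using parent_stateD[of i] by (force simp: branch_exponent_def split: option.splits)

lemma arc_weight_state:
  assumes "i < N"
  shows "arc_weight R \<pi> dep \<epsilon> i (StateNode k) * \<epsilon> ^ dep k =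
    \<epsilon> ^ dep i * scaled_arc_weight R \<pi> dep \<epsilon> i (StateNode k)"
  using parent_stateD[OF assms, of k]
  by (auto simp: arc_weight_def scaled_arc_weight_def parent_state_Some_iff)

lemma arc_weight_root:
  assumes "i < N" "w \<in> S"
  shows "arc_weight R \<pi> dep \<epsilon> i w = \<epsilon> ^ dep i * scaled_arc_weight R \<pi> dep \<epsilon> i w"
  using root_dep[OF assms(1)] assms(2) StateNode_not_root
  by (auto simp: arc_weight_def scaled_arc_weight_def split: node.splits)

text \<open>All weights vanish at \<epsilon> = 0 and \<open>W\<close> with them. Column i of
  \<open>W\<close> is \<epsilon> ^ \<open>dep i\<close> times that of a family \<open>x\<close> with
  a nontrivial limit, to which the perturbation lemma applies.\<close>

lemma forest_krylov_nonsingular: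
  fixes e :: "nat \<Rightarrow> node \<Rightarrow> 'v mero" and W :: "real \<Rightarrow> nat \<Rightarrow> nat \<Rightarrow> 'v mero"
    and \<delta> :: "real \<Rightarrow> 'v mero \<Rightarrow> 'v mero"
  assumes \<delta>: "\<And>\<epsilon>. mero_derivation (\<delta> \<epsilon>)"
    and \<delta>_family: "\<And>\<phi>. poly_family \<phi> \<Longrightarrow> poly_family (\<lambda>\<epsilon>. \<delta> \<epsilon> (\<phi> \<epsilon>))"
    and e_nonzero: "\<And>i. i < N \<Longrightarrow> e i (\<pi> i) \<noteq> 0"
    and \<delta>_e: "\<And>i. i < N \<Longrightarrow> \<delta> 0 (e i (\<pi> i)) = mero_const (branch_exponent \<pi> i) * e i (\<pi> i)"
    and W_0: "\<And>i \<epsilon>. i < N \<Longrightarrow> W \<epsilon> 0 i = (\<Sum>w\<in>S. mero_const (arc_weight R \<pi> dep \<epsilon> i w) * e i w)"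
    and W_Suc: "\<And>l i \<epsilon>. i < N \<Longrightarrow> W \<epsilon> (Suc l) i = \<delta> \<epsilon> (W \<epsilon> l i) +
      (\<Sum>k<N. mero_const (arc_weight R \<pi> dep \<epsilon> i (StateNode k)) * e i (StateNode k) * W \<epsilon> l k)"
  shows "\<exists>\<epsilon>. \<epsilon> \<noteq> 0 \<and> det (mat N N (\<lambda>(l, i). W \<epsilon> l i)) \<noteq> 0"
proof -
  define n where "n = (\<lambda>\<epsilon> i w. mero_const (scaled_arc_weight R \<pi> dep \<epsilon> i w) :: 'v mero)"
  \<comment> \<open>\<open>x\<close> has its own recursion, since dividing \<open>W\<close> by
    powers of \<epsilon> would be meaningless at \<epsilon> = 0.\<close>
  define x where "x = rec_nat (\<lambda>i \<epsilon>. \<Sum>w\<in>S. n \<epsilon> i w * e i w)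
    (\<lambda>l y i \<epsilon>. \<delta> \<epsilon> (y i \<epsilon>) + (\<Sum>k<N. n \<epsilon> i (StateNode k) * e i (StateNode k) * y k \<epsilon>))"
  have x_0: "x 0 i \<epsilon> = (\<Sum>w\<in>S. n \<epsilon> i w * e i w)" for i \<epsilon>
    by (simp add: x_def)
  have x_Suc: "x (Suc l) i \<epsilon> =
      \<delta> \<epsilon> (x l i \<epsilon>) + (\<Sum>k<N. n \<epsilon> i (StateNode k) * e i (StateNode k) * x l k \<epsilon>)" for l i \<epsilon>
    by (simp add: x_def)
  have n_family: "poly_family (\<lambda>\<epsilon>. n \<epsilon> i w)" for i w
    unfolding n_def by (rule poly_family_scaled_arc_weight)
  have n_at_0: "n 0 i w = (if w = \<pi> i then 1 else 0)" if "i < N" for i w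
    using parent_arc[OF that] by (auto simp: n_def scaled_arc_weight_def)
  have "\<exists>\<epsilon>. \<epsilon> \<noteq> 0 \<and> det (mat N N (\<lambda>(l, i). x l i \<epsilon>)) \<noteq> 0"
  proof (rule perturbed_krylov_nonsingular[where par = "parent_state \<pi>" and dep = dep
        and \<mu> = "\<lambda>i. real (Suc i)" and \<delta> = \<delta> and \<theta> = "\<lambda>i. e i (\<pi> i)"
        and Q = "\<lambda>i k \<epsilon>. n \<epsilon> i (StateNode k) * e i (StateNode k)"])
    show "poly_family (x 0 i)" for i
      unfolding x_0[abs_def] by (intro poly_family_sum poly_family_mult n_family poly_family_fixed)
    show "poly_family (\<lambda>\<epsilon>. n \<epsilon> i (StateNode k) * e i (StateNode k))" for i k
      by (intro poly_family_mult n_family poly_family_fixed)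
    show "x 0 i 0 = (if parent_state \<pi> i = None then e i (\<pi> i) else 0)" if i: "i < N" for i
    proof -
      have "x 0 i 0 = (\<Sum>w\<in>S. if w = \<pi> i then e i (\<pi> i) else 0)"
        unfolding x_0 using n_at_0[OF i] by (intro sum.cong) auto
      then show ?thesis
        using finite_roots parent_state_None_iff[OF i] by simp
    qed
    show "n 0 i (StateNode k) * e i (StateNode k) = (if parent_state \<pi> i = Some k then e i (\<pi> i) else 0)"
      if "i < N" for i k
      using n_at_0[OF that] by (auto simp: parent_state_Some_iff)
    show "inj_on (\<lambda>i. real (Suc i)) {..<N}" by (simp add: inj_on_def)
    show "\<delta> 0 (e i (\<pi> i)) = mero_const (case parent_state \<pi> i of None \<Rightarrow> real (Suc i)
        | Some k \<Rightarrow> real (Suc i) - real (Suc k)) * e i (\<pi> i)" if "i < N" for i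
      using \<delta>_e[OF that] by (simp add: branch_exponent_def)
  qed (use parent_stateD \<delta> \<delta>_family e_nonzero x_Suc in auto)
  then obtain \<epsilon> where \<epsilon>: "\<epsilon> \<noteq> 0" "det (mat N N (\<lambda>(l, i). x l i \<epsilon>)) \<noteq> 0" by blast
  have W: "i < N \<Longrightarrow> W \<epsilon> l i = mero_const (\<epsilon> ^ dep i) * x l i \<epsilon>" for l i
  proof (induction l arbitrary: i)
    case 0
    then show ?case
      by (simp add: W_0 x_0 n_def arc_weight_root mero_const_mult sum_distrib_left mult.assoc)
  next
    case (Suc l)
    have "mero_const (arc_weight R \<pi> dep \<epsilon> i (StateNode k)) * e i (StateNode k) * W \<epsilon> l k =
        mero_const (\<epsilon> ^ dep i) * (n \<epsilon> i (StateNode k) * e i (StateNode k) * x l k \<epsilon>)" if "k < N" for k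
    proof -
      have "mero_const (arc_weight R \<pi> dep \<epsilon> i (StateNode k)) * e i (StateNode k) * W \<epsilon> l k =
          mero_const (arc_weight R \<pi> dep \<epsilon> i (StateNode k) * \<epsilon> ^ dep k) * (e i (StateNode k) * x l k \<epsilon>)"
        using Suc.IH[OF that] by (simp add: mero_const_mult mult_ac)
      also have "\<dots> = mero_const (\<epsilon> ^ dep i) * (n \<epsilon> i (StateNode k) * e i (StateNode k) * x l k \<epsilon>)"
        unfolding arc_weight_state[OF Suc.prems] by (simp add: n_def mero_const_mult mult_ac)
      finally show ?thesis .
    qed
    then have "(\<Sum>k<N. mero_const (arc_weight R \<pi> dep \<epsilon> i (StateNode k)) * e i (StateNode k) * W \<epsilon> l k) =
        mero_const (\<epsilon> ^ dep i) * (\<Sum>k<N. n \<epsilon> i (StateNode k) * e i (StateNode k) * x l k \<epsilon>)"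
      unfolding sum_distrib_left by (intro sum.cong refl) simp
    then show ?case
      unfolding W_Suc[OF Suc.prems] x_Suc Suc.IH[OF Suc.prems]
      by (simp add: mero_derivation_const_mult[OF \<delta>] distrib_left)
  qed
  \<comment> \<open>The columns of the two matrices differ by nonzero constant factors, so their
    kernels correspond.\<close>
  have "det (mat N N (\<lambda>(l, i). W \<epsilon> l i)) \<noteq> 0"
    unfolding det_nonzero_iff_trivial_kernel
  proof (intro allI impI)
    fix z i assume z: "\<forall>l<N. (\<Sum>i<N. W \<epsilon> l i * z i) = 0" and i: "i < N"
    have "(\<Sum>i<N. x l i \<epsilon> * (mero_const (\<epsilon> ^ dep i) * z i)) = 0" if "l < N" for l
      using z that by (simp add: W mult_ac)
    then have "mero_const (\<epsilon> ^ dep i) * z i = 0"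
      using \<epsilon>(2)[unfolded det_nonzero_iff_trivial_kernel, rule_format, where z = "\<lambda>i. mero_const (\<epsilon> ^ dep i) * z i"] i
      by blast
    with \<epsilon>(1) show "z i = 0" by simp
  qed
  with \<epsilon>(1) show ?thesis by blast
qed

end

section \<open>Exponential systems realising a given graph\<close>

definition exp_sum :: "('i \<Rightarrow> sysvar) \<Rightarrow> 'i set \<Rightarrow> ('i \<Rightarrow> real) \<Rightarrow> ('i \<Rightarrow> real) \<Rightarrow> sysvar mero" where
  "exp_sum z A c a = (\<Sum>k\<in>A. mero_const (c k) * mero_exp (a k) (z k))"

lemma mero_partial_exp_sum:
  "mero_partial v (exp_sum z A c a) =
     (\<Sum>k\<in>A. if v = z k then mero_const (c k * a k) * mero_exp (a k) v else 0)"
  unfolding exp_sum_def mero_partial_sum mero_partial_const_mult mero_partial_exp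
  by (intro sum.cong) (auto simp: mero_const_mult mult.assoc)

lemma mero_in_exp_sum: "z ` A \<subseteq> V \<Longrightarrow> exp_sum z A c a \<in> mero_in V"
  unfolding exp_sum_def by (intro mero_in_sum mero_in_mult mero_in_exp) auto

lemma poly_family_exp_sum:
  assumes "\<And>k. k \<in> A \<Longrightarrow> poly_family (\<lambda>\<epsilon>. mero_const (c \<epsilon> k) :: sysvar mero)"
  shows "poly_family (\<lambda>\<epsilon>. exp_sum z A (c \<epsilon>) a)"
  unfolding exp_sum_def using assms by (intro poly_family_sum poly_family_mult) auto

text \<open>The constant 1 survives when all coefficients vanish and provides the uniform drift of
  the limit.\<close>

definition exp_field where
  "exp_field N M C a B b i =
     1 + exp_sum State {..<N} (C i) (a i) + exp_sum (\<lambda>k. Input k 0) {..<M} (B i) (b i)"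

lemma mero_partial_exp_sum_State:
  "mero_partial (State k) (exp_sum State {..<N} c a) =
     (if k < N then mero_const (c k * a k) * mero_exp (a k) (State k) else 0)"
  "mero_partial (Input j l) (exp_sum State {..<N} c a) = 0"
  by (simp_all add: mero_partial_exp_sum)

lemma mero_partial_exp_sum_Input:
  "mero_partial (State k) (exp_sum (\<lambda>k. Input k 0) {..<M} c a) = 0"
  "mero_partial (Input j 0) (exp_sum (\<lambda>k. Input k 0) {..<M} c a) =
     (if j < M then mero_const (c j * a j) * mero_exp (a j) (Input j 0) else 0)"
  by (simp_all add: mero_partial_exp_sum)

lemma mero_partial_exp_field:
  "mero_partial (State k) (exp_field N M C a B b i) =
     (if k < N then mero_const (C i k * a i k) * mero_exp (a i k) (State k) else 0)"
  "mero_partial (Input j 0) (exp_field N M C a B b i) =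
     (if j < M then mero_const (B i j * b i j) * mero_exp (b i j) (Input j 0) else 0)"
  by (simp_all add: exp_field_def mero_partial_add mero_partial_exp_sum_State mero_partial_exp_sum_Input)

lemma mero_in_exp_field: "exp_field N M C a B b i \<in> mero_in (state_vars N \<union> input_vars M)"
  unfolding exp_field_def
  by (intro mero_in_add mero_in_exp_sum) (auto simp: state_vars_def input_vars_def)

lemma exp_field_in_pairs_with_graph:
  assumes G: "system_graph N M P G"
    and C: "\<And>i k. i < N \<Longrightarrow> k < N \<Longrightarrow> C i k * a i k \<noteq> 0 \<longleftrightarrow> (StateNode k, StateNode i) \<in> parcs G"
    and B: "\<And>i k. i < N \<Longrightarrow> k < M \<Longrightarrow> B i k * b i k \<noteq> 0 \<longleftrightarrow> (InputNode k, StateNode i) \<in> parcs G"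
    and D: "\<And>i k. i < P \<Longrightarrow> k < N \<Longrightarrow> D i k * d i k \<noteq> 0 \<longleftrightarrow> (StateNode k, OutputNode i) \<in> parcs G"
  shows "(exp_field N M C a B b, \<lambda>i. exp_sum State {..<N} (D i) (d i)) \<in> pairs_with_graph N M P G"
proof -
  have "meromorphic_pair N M P (exp_field N M C a B b) (\<lambda>i. exp_sum State {..<N} (D i) (d i))"
    unfolding meromorphic_pair_def
    by (intro conjI allI impI mero_in_exp_field mero_in_exp_sum) (auto simp: state_vars_def)
  moreover have "graph_of_pair N M P (exp_field N M C a B b) (\<lambda>i. exp_sum State {..<N} (D i) (d i)) = G"
    (is "?G = G")
  proof (rule pair_pre_digraph.equality)
    have "parcs G \<subseteq> state_nodes N \<times> state_nodes N \<union> input_nodes M \<times> state_nodes N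
        \<union> state_nodes N \<times> output_nodes P"
      using G by (simp add: system_graph_def)
    note sub = subsetD[OF this]
    have bounds: "k < N \<and> i < N" if "(StateNode k, StateNode i) \<in> parcs G" for i k
      using sub[OF that] by (auto simp: state_nodes_def input_nodes_def output_nodes_def)
    have bounds': "k < M \<and> i < N" if "(InputNode k, StateNode i) \<in> parcs G" for i k
      using sub[OF that] by (auto simp: state_nodes_def input_nodes_def output_nodes_def)
    have bounds'': "k < N \<and> i < P" if "(StateNode k, OutputNode i) \<in> parcs G" for i k
      using sub[OF that] by (auto simp: state_nodes_def input_nodes_def output_nodes_def)
    have no_arcs: "(v, InputNode k) \<notin> parcs G" "(OutputNode k, v) \<notin> parcs G"
        "(InputNode k, OutputNode i) \<notin> parcs G" for i k v
      using sub[of "(v, InputNode k)"] sub[of "(OutputNode k, v)"] sub[of "(InputNode k, OutputNode i)"]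
      by (auto simp: state_nodes_def input_nodes_def output_nodes_def)
    have no_arcs': "(v, InputNode k) \<notin> parcs ?G" "(OutputNode k, v) \<notin> parcs ?G"
        "(InputNode k, OutputNode i) \<notin> parcs ?G" for i k v
      by (auto simp: graph_of_pair_def)
    have state_arcs: "(StateNode k, StateNode i) \<in> parcs ?G \<longleftrightarrow> (StateNode k, StateNode i) \<in> parcs G" for i k
    proof (cases "k < N \<and> i < N")
      case True
      then show ?thesis using C[of i k] by (simp add: graph_of_pair_arcs mero_partial_exp_field)
    next
      case False
      then show ?thesis using bounds[of k i] by (simp only: graph_of_pair_arcs) blast
    qed
    have input_arcs: "(InputNode k, StateNode i) \<in> parcs ?G \<longleftrightarrow> (InputNode k, StateNode i) \<in> parcs G" for i k
    proof (cases "k < M \<and> i < N")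
      case True
      then show ?thesis using B[of i k] by (simp add: graph_of_pair_arcs mero_partial_exp_field)
    next
      case False
      then show ?thesis using bounds'[of k i] by (simp only: graph_of_pair_arcs) blast
    qed
    have output_arcs: "(StateNode k, OutputNode i) \<in> parcs ?G \<longleftrightarrow> (StateNode k, OutputNode i) \<in> parcs G" for i k
    proof (cases "k < N \<and> i < P")
      case True
      then show ?thesis using D[of i k] by (simp add: graph_of_pair_arcs mero_partial_exp_sum_State)
    next
      case False
      then show ?thesis using bounds''[of k i] by (simp only: graph_of_pair_arcs) blast
    qed
    have "(u, v) \<in> parcs ?G \<longleftrightarrow> (u, v) \<in> parcs G" for u v
      by (cases u; cases v) (simp_all only: state_arcs input_arcs output_arcs no_arcs no_arcs')
    then show "parcs ?G = parcs G" by auto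
  qed (use G in \<open>simp_all add: graph_of_pair_def system_graph_def\<close>)
  ultimately show ?thesis by (simp add: pairs_with_graph_def)
qed

lemma poly_family_flow:
  assumes "\<And>i. i < N \<Longrightarrow> poly_family (\<lambda>\<epsilon>. f \<epsilon> i)" "mero_derivation \<tau>" "poly_family \<phi>"
  shows "poly_family (\<lambda>\<epsilon>. flow N (f \<epsilon>) \<tau> (\<phi> \<epsilon>))"
proof -
  have "poly_family (\<lambda>\<epsilon>. mero_partial (State i) (\<phi> \<epsilon>) * f \<epsilon> i)" if "i < N" for i
    by (rule poly_family_mult[OF poly_family_derivation[OF mero_partial_derivation assms(3)] assms(1)[OF that]])
  then have "poly_family (\<lambda>\<epsilon>. \<Sum>i<N. mero_partial (State i) (\<phi> \<epsilon>) * f \<epsilon> i)"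
    by (rule poly_family_sum) simp
  then show ?thesis
    unfolding flow_def by (rule poly_family_add[OF _ poly_family_derivation[OF assms(2,3)]])
qed

lemma poly_family_const_divide:
  assumes "poly_family (\<lambda>\<epsilon>. mero_const (c \<epsilon>) :: 'v mero)"
  shows "poly_family (\<lambda>\<epsilon>. mero_const (c \<epsilon> / a) :: 'v mero)"
  using poly_family_mult[OF assms poly_family_fixed[of "mero_const (1 / a)"]]
  by (simp flip: mero_const_mult)

section \<open>Construction of accessible and observable systems\<close>

lemma reachable_imp_accessible:
  assumes G: "system_graph N M P G"
    and reach: "\<And>i. i < N \<Longrightarrow> \<exists>u\<in>input_nodes M. (u, StateNode i) \<in> (parcs G)\<^sup>*"
  shows "structurally_accessible N M P G"
proof -
  have arcs: "a \<in> input_nodes M \<or> a \<in> state_nodes N"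
    if "i < N" "(a, StateNode i) \<in> parcs G" for a i
    using G that unfolding system_graph_def output_nodes_def by blast
  have disjoint: "input_nodes M \<inter> state_nodes N = {}"
    by (auto simp: input_nodes_def state_nodes_def)
  obtain \<pi> dep where \<pi>: "\<And>i. i < N \<Longrightarrow> (\<pi> i, StateNode i) \<in> parcs G"
    "\<And>i. i < N \<Longrightarrow> \<pi> i \<in> input_nodes M \<and> dep i = 1 \<or> (\<exists>k<N. \<pi> i = StateNode k \<and> dep i = Suc (dep k))"
  proof (rule spanning_forest)
    show "\<exists>s\<in>input_nodes M. (s, StateNode i) \<in> (parcs G)\<^sup>*" if "i < N" for i
      by (rule reach[OF that])
    show "a \<in> input_nodes M \<or> a \<in> state_nodes N" if "i < N" "(a, StateNode i) \<in> parcs G" for a i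
      by (rule arcs[OF that])
  qed (rule disjoint, rule that, blast+)
  interpret rooted_forest N "parcs G" "input_nodes M" \<pi> dep
    by unfold_locales (use \<pi> in \<open>auto simp: input_nodes_def\<close>)
  define \<alpha> where "\<alpha> = branch_exponent \<pi>"
  have \<alpha>: "\<alpha> i \<noteq> 0" if "i < N" for i using branch_exponent_nonzero[OF that] by (simp add: \<alpha>_def)
  define wt where "wt = arc_weight (parcs G) \<pi> dep"
  \<comment> \<open>The exponent belongs to the head i, the child in the forest. Dividing by it
    cancels the factor from differentiation, and the minus sign turns the difference in the bracket
    recursion into the sum that \<open>forest_krylov_nonsingular\<close> expects.\<close>
  define f where "f = (\<lambda>\<epsilon>. exp_field N M (\<lambda>i k. - wt \<epsilon> i (StateNode k) / \<alpha> i) (\<lambda>i k. \<alpha> i)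
    (\<lambda>i k. wt \<epsilon> i (InputNode k) / \<alpha> i) (\<lambda>i k. \<alpha> i))"
  define \<delta> where "\<delta> = (\<lambda>\<epsilon>. flow N (f \<epsilon>) (input_clock M))"
  \<comment> \<open>The value at \<open>OutputNode\<close> is a dummy.\<close>
  define e where "e = (\<lambda>i w. mero_exp (\<alpha> i) (case w of StateNode k \<Rightarrow> State k | InputNode k \<Rightarrow> Input k 0 | OutputNode k \<Rightarrow> State k))"
  define W where "W = (\<lambda>\<epsilon>. rec_nat (\<lambda>i. input_clock M (f \<epsilon> i))
    (\<lambda>l y i. \<delta> \<epsilon> (y i) - (\<Sum>m<N. mero_partial (State m) (f \<epsilon> i) * y m)))"
  have W_0: "W \<epsilon> 0 i = input_clock M (f \<epsilon> i)" for \<epsilon> i by (simp add: W_def)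
  have W_Suc: "W \<epsilon> (Suc l) i = \<delta> \<epsilon> (W \<epsilon> l i) - (\<Sum>m<N. mero_partial (State m) (f \<epsilon> i) * W \<epsilon> l m)" for \<epsilon> l i
    by (simp add: W_def)
  have f_at_0: "f 0 i = 1" for i by (simp add: f_def exp_field_def exp_sum_def wt_def)
  have f_State: "mero_partial (State k) (f \<epsilon> i) = - (mero_const (wt \<epsilon> i (StateNode k)) * e i (StateNode k))"
    if "i < N" "k < N" for \<epsilon> i k
    using that \<alpha>[OF that(1)] by (simp add: f_def mero_partial_exp_field e_def mero_const_minus)
  have f_Input: "mero_partial (Input k 0) (f \<epsilon> i) = mero_const (wt \<epsilon> i (InputNode k)) * e i (InputNode k)"
    if "i < N" "k < M" for \<epsilon> i k
    using that \<alpha>[OF that(1)] by (simp add: f_def mero_partial_exp_field e_def)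
  have f_family: "poly_family (\<lambda>\<epsilon>. f \<epsilon> i)" for i
  proof -
    have *: "poly_family (\<lambda>\<epsilon>. mero_const (wt \<epsilon> i w / c))" for w c
      unfolding wt_def by (intro poly_family_const_divide poly_family_arc_weight)
    have "poly_family (\<lambda>\<epsilon>. mero_const (- wt \<epsilon> i w / \<alpha> i))" for w
      using *[of w "- \<alpha> i"] by simp
    then show ?thesis
      unfolding f_def exp_field_def
      by (intro poly_family_add poly_family_exp_sum poly_family_fixed *)
  qed
  have "\<exists>\<epsilon>. \<epsilon> \<noteq> 0 \<and> det (mat N N (\<lambda>(l, i). W \<epsilon> l i)) \<noteq> 0"
  proof (rule forest_krylov_nonsingular[where \<delta> = \<delta> and e = e])
    show "mero_derivation (\<delta> \<epsilon>)" for \<epsilon>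
      unfolding \<delta>_def by (rule flow_derivation[OF input_clock_derivation])
    show "poly_family (\<lambda>\<epsilon>. \<delta> \<epsilon> (\<phi> \<epsilon>))" if "poly_family \<phi>" for \<phi>
      unfolding \<delta>_def by (intro poly_family_flow f_family input_clock_derivation that)
    show "e i (\<pi> i) \<noteq> 0" for i by (simp add: e_def)
    show "\<delta> 0 (e i (\<pi> i)) = mero_const (branch_exponent \<pi> i) * e i (\<pi> i)" if "i < N" for i
      using parent[OF that]
      by (auto simp: \<delta>_def flow_def f_at_0 e_def input_clock_def mero_partial_exp input_nodes_def \<alpha>_def)
    show "W \<epsilon> 0 i = (\<Sum>w\<in>input_nodes M. mero_const (arc_weight (parcs G) \<pi> dep \<epsilon> i w) * e i w)"
      if "i < N" for i \<epsilon>
      unfolding W_0 input_nodes_def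
      by (subst sum.reindex) (simp_all add: inj_on_def input_clock_def f_Input that wt_def)
    show "W \<epsilon> (Suc l) i = \<delta> \<epsilon> (W \<epsilon> l i) +
      (\<Sum>k<N. mero_const (arc_weight (parcs G) \<pi> dep \<epsilon> i (StateNode k)) * e i (StateNode k) * W \<epsilon> l k)"
      if "i < N" for l i \<epsilon>
      unfolding W_Suc by (simp add: f_State that wt_def sum_negf)
  qed
  then obtain \<epsilon> where \<epsilon>: "\<epsilon> \<noteq> 0" "det (mat N N (\<lambda>(l, i). W \<epsilon> l i)) \<noteq> 0" by blast
  define h where "h = (\<lambda>i. exp_sum State {..<N} (\<lambda>k. if (StateNode k, OutputNode i) \<in> parcs G then 1 else 0) (\<lambda>_. 1))"
  have "(f \<epsilon>, h) \<in> pairs_with_graph N M P G"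
    unfolding f_def h_def
    by (rule exp_field_in_pairs_with_graph[OF G])
       (use \<alpha> arc_weight_eq_0_iff[OF \<epsilon>(1)] in \<open>auto simp: wt_def\<close>)
  moreover have "accessible N M (f \<epsilon>)"
    using W_0 W_Suc \<epsilon>(2)
    by (intro accessible_if_nonsingular[where W = "W \<epsilon>"]) (auto simp: f_def mero_in_exp_field \<delta>_def)
  ultimately show ?thesis
    unfolding structurally_accessible_def by blast
qed

lemma coreachable_imp_observable:
  assumes G: "system_graph N M P G"
    and reach: "\<And>i. i < N \<Longrightarrow> \<exists>y\<in>output_nodes P. (StateNode i, y) \<in> (parcs G)\<^sup>*"
  shows "structurally_observable N M P G"
proof -
  have arcs: "a \<in> output_nodes P \<or> a \<in> state_nodes N"
    if "i < N" "(a, StateNode i) \<in> (parcs G)\<inverse>" for a i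
    using G that unfolding system_graph_def by blast
  have disjoint: "output_nodes P \<inter> state_nodes N = {}"
    by (auto simp: output_nodes_def state_nodes_def)
  have reach': "\<exists>y\<in>output_nodes P. (y, StateNode i) \<in> ((parcs G)\<inverse>)\<^sup>*" if "i < N" for i
    using reach[OF that] by (simp add: rtrancl_converse)
  obtain \<pi> dep where \<pi>: "\<And>i. i < N \<Longrightarrow> (\<pi> i, StateNode i) \<in> (parcs G)\<inverse>"
    "\<And>i. i < N \<Longrightarrow> \<pi> i \<in> output_nodes P \<and> dep i = 1 \<or> (\<exists>k<N. \<pi> i = StateNode k \<and> dep i = Suc (dep k))"
  proof (rule spanning_forest)
    show "\<exists>s\<in>output_nodes P. (s, StateNode i) \<in> ((parcs G)\<inverse>)\<^sup>*" if "i < N" for i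
      by (rule reach'[OF that])
    show "a \<in> output_nodes P \<or> a \<in> state_nodes N" if "i < N" "(a, StateNode i) \<in> (parcs G)\<inverse>" for a i
      by (rule arcs[OF that])
  qed (rule disjoint, rule that, blast+)
  interpret rooted_forest N "(parcs G)\<inverse>" "output_nodes P" \<pi> dep
    by unfold_locales (use \<pi> in \<open>auto simp: output_nodes_def\<close>)
  define \<alpha> where "\<alpha> = branch_exponent \<pi>"
  have \<alpha>: "\<alpha> i \<noteq> 0" if "i < N" for i using branch_exponent_nonzero[OF that] by (simp add: \<alpha>_def)
  define wt where "wt = arc_weight ((parcs G)\<inverse>) \<pi> dep"
  \<comment> \<open>With reversed arcs the child is the tail k, so the exponent is \<alpha> k. Input
    arcs carry the coefficient \<epsilon> rather than 1 so that \<open>f 0 i\<close> is the pure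
    drift.\<close>
  define f where "f = (\<lambda>\<epsilon>. exp_field N M (\<lambda>i k. wt \<epsilon> k (StateNode i) / \<alpha> k) (\<lambda>i k. \<alpha> k)
    (\<lambda>i k. if (InputNode k, StateNode i) \<in> parcs G then \<epsilon> else 0) (\<lambda>i k. 1))"
  define h where "h = (\<lambda>\<epsilon> i. exp_sum State {..<N} (\<lambda>k. wt \<epsilon> k (OutputNode i) / \<alpha> k) \<alpha>)"
  define \<delta> where "\<delta> = (\<lambda>\<epsilon>. time_deriv N M (f \<epsilon>))"
  have \<delta>: "mero_derivation (\<delta> \<epsilon>)" for \<epsilon> unfolding \<delta>_def by (rule time_deriv_derivation)
  define e where "e = (\<lambda>i (w::node). mero_exp (\<alpha> i) (State i))"
  \<comment> \<open>Summing the outputs produces, in the initial row, the sum over all roots in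
    \<open>S\<close>.\<close>
  define Y where "Y = (\<lambda>\<epsilon> l. \<Sum>i<P. (\<delta> \<epsilon> ^^ l) (h \<epsilon> i))"
  have Y_Suc: "Y \<epsilon> (Suc l) = \<delta> \<epsilon> (Y \<epsilon> l)" for \<epsilon> l
    by (simp add: Y_def mero_derivation_sum[OF \<delta>])
  have f_at_0: "f 0 i = 1" for i by (simp add: f_def exp_field_def exp_sum_def wt_def)
  have f_State: "mero_partial (State k) (f \<epsilon> i) = mero_const (wt \<epsilon> k (StateNode i)) * e k (StateNode i)"
    if "k < N" for \<epsilon> i k
    using that \<alpha>[OF that] by (simp add: f_def mero_partial_exp_field e_def)
  have h_State: "mero_partial (State k) (h \<epsilon> i) = mero_const (wt \<epsilon> k (OutputNode i)) * e k (OutputNode i)"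
    if "k < N" for \<epsilon> i k
    using that \<alpha>[OF that] by (simp add: h_def mero_partial_exp_sum_State e_def)
  have f_family: "poly_family (\<lambda>\<epsilon>. f \<epsilon> i)" for i
  proof -
    have "poly_family (\<lambda>\<epsilon>. mero_const (wt \<epsilon> k w / c))" for k w c
      unfolding wt_def by (intro poly_family_const_divide poly_family_arc_weight)
    moreover have "poly_family (\<lambda>\<epsilon>. mero_const (if (InputNode k, StateNode i) \<in> parcs G then \<epsilon> else 0))" for k
      by (cases "(InputNode k, StateNode i) \<in> parcs G") (simp_all add: poly_family_const)
    ultimately show ?thesis
      unfolding f_def exp_field_def
      by (intro poly_family_add poly_family_exp_sum poly_family_fixed)
  qed
  have "\<exists>\<epsilon>. \<epsilon> \<noteq> 0 \<and> det (mat N N (\<lambda>(l, j). mero_partial (State j) (Y \<epsilon> l))) \<noteq> 0"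
  proof (rule forest_krylov_nonsingular[where \<delta> = \<delta> and e = e and W = "\<lambda>\<epsilon> l j. mero_partial (State j) (Y \<epsilon> l)", OF \<delta>])
    show "poly_family (\<lambda>\<epsilon>. \<delta> \<epsilon> (\<phi> \<epsilon>))" if "poly_family \<phi>" for \<phi>
      unfolding \<delta>_def time_deriv_eq_flow by (intro poly_family_flow f_family input_deriv_derivation that)
    show "e i (\<pi> i) \<noteq> 0" for i by (simp add: e_def)
    show "\<delta> 0 (e i (\<pi> i)) = mero_const (branch_exponent \<pi> i) * e i (\<pi> i)" if "i < N" for i
      using that by (simp add: \<delta>_def time_deriv_def f_at_0 e_def mero_partial_exp \<alpha>_def)
    show "mero_partial (State j) (Y \<epsilon> 0) =
        (\<Sum>w\<in>output_nodes P. mero_const (arc_weight ((parcs G)\<inverse>) \<pi> dep \<epsilon> j w) * e j w)"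
      if "j < N" for j \<epsilon>
      unfolding output_nodes_def
      by (subst sum.reindex) (simp_all add: inj_on_def Y_def mero_partial_sum h_State that wt_def)
    show "mero_partial (State j) (Y \<epsilon> (Suc l)) = \<delta> \<epsilon> (mero_partial (State j) (Y \<epsilon> l)) +
      (\<Sum>k<N. mero_const (arc_weight ((parcs G)\<inverse>) \<pi> dep \<epsilon> j (StateNode k)) * e j (StateNode k) *
        mero_partial (State k) (Y \<epsilon> l))"
      if "j < N" for l j \<epsilon>
      unfolding Y_Suc \<delta>_def time_deriv_partial_commute by (simp add: f_State that wt_def)
  qed
  then obtain \<epsilon> where \<epsilon>: "\<epsilon> \<noteq> 0" "det (mat N N (\<lambda>(l, j). mero_partial (State j) (Y \<epsilon> l))) \<noteq> 0" by blast
  have pair: "(f \<epsilon>, h \<epsilon>) \<in> pairs_with_graph N M P G"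
    unfolding f_def h_def
    by (rule exp_field_in_pairs_with_graph[OF G])
       (use \<alpha> arc_weight_eq_0_iff[OF \<epsilon>(1)] \<epsilon>(1) in \<open>auto simp: wt_def\<close>)
  moreover have "observable N M P (f \<epsilon>) (h \<epsilon>)"
    by (rule observable_if_nonsingular)
       (use pair \<epsilon>(2) in \<open>auto simp: Y_def \<delta>_def pairs_with_graph_def\<close>)
  ultimately show ?thesis
    unfolding structurally_observable_def by blast
qed

theorem theorem2:
  fixes N M P :: nat and G :: "node pair_pre_digraph"
  assumes "system_graph N M P G"
  shows "(structurally_accessible N M P G \<longleftrightarrow>
            (\<forall>x \<in> state_nodes N. \<exists>u \<in> input_nodes M. \<exists>\<pi>. pre_digraph.apath (with_proj G) u \<pi> x)) \<and>
         (structurally_observable N M P G \<longleftrightarrow>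
            (\<forall>x \<in> state_nodes N. \<exists>y \<in> output_nodes P. \<exists>\<pi>. pre_digraph.apath (with_proj G) x \<pi> y))"
proof -
  have verts: "state_nodes N \<subseteq> pverts G" "input_nodes M \<subseteq> pverts G" "output_nodes P \<subseteq> pverts G"
    using assms by (auto simp: system_graph_def)
  have "structurally_accessible N M P G \<longleftrightarrow>
      (\<forall>i<N. \<exists>u\<in>input_nodes M. (u, StateNode i) \<in> (parcs G)\<^sup>*)"
    using accessible_imp_reachable reachable_imp_accessible[OF assms]
    unfolding structurally_accessible_def by blast
  moreover have "structurally_observable N M P G \<longleftrightarrow>
      (\<forall>i<N. \<exists>y\<in>output_nodes P. (StateNode i, y) \<in> (parcs G)\<^sup>*)"
    using observable_imp_coreachable coreachable_imp_observable[OF assms]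
    unfolding structurally_observable_def by blast
  moreover have "(\<exists>\<pi>. pre_digraph.apath (with_proj G) u \<pi> (StateNode i)) \<longleftrightarrow> (u, StateNode i) \<in> (parcs G)\<^sup>*"
    if "u \<in> input_nodes M" "i < N" for u i
    using that verts by (intro system_graph_apath_iff[OF assms]) (auto simp: state_nodes_def)
  moreover have "(\<exists>\<pi>. pre_digraph.apath (with_proj G) (StateNode i) \<pi> y) \<longleftrightarrow> (StateNode i, y) \<in> (parcs G)\<^sup>*"
    if "y \<in> output_nodes P" "i < N" for y i
    using that verts by (intro system_graph_apath_iff[OF assms]) (auto simp: state_nodes_def)
  moreover have "(\<forall>x\<in>state_nodes N. Q x) \<longleftrightarrow> (\<forall>i<N. Q (StateNode i))" for Q
    by (auto simp: state_nodes_def)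
  ultimately show ?thesis by simp
qed

end
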